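(* Assume that $G$ satisfies condition (G) (stated in the context) for some $\gamma\in\mathbf{N}$, $d>0$ and $L>0$. Let $0\le K<L$ with $[K]+1\le\gamma$. For any $\varphi\in L^1_K$, put $$v(x,t):=e^{t\mathcal L}\varphi(x)-\sum_{|\alpha|\le K}M_\alpha(\varphi,0)\,g_\alpha(x,t).$$ Then, for any $j\in\{0,\dots,\gamma\}$, $q\in[1,\infty]$ and $\ell\in[0,K]$, there exists a constant $C$ independent of $\varphi\in L^1_K$ such that $$t^{\frac{N}{d}(1-\frac1q)+\frac jd}\|\nabla^j v(t)\|_q+t^{\frac jd}(1+t)^{-\frac{\ell}{d}}|||\nabla^j v(t)|||_\ell\le C(1+t)^{-\frac Kd}|||\varphi|||_K$$ for all $t>0$. Furthermore, for any $\varphi\in L^1_K$ (and any such $j,q,\ell$), $$\lim_{t\to\infty}t^{\frac Kd}\left[t^{\frac{N}{d}(1-\frac1q)+\frac jd}\|\nabla^j v(t)\|_q+t^{-\frac{\ell}{d}+\frac jd}|||\nabla^j v(t)|||_\ell\right]=0.$$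
   Context: $N\ge1$ is an integer and $\mathbf N=\{1,2,\dots\}$. For $k\ge0$, $[k]$ is the integer with $k-1<[k]\le k$. $\mathbf M=(\mathbf N\cup\{0\})^N$ is the set of multi-indices, with the usual $|\alpha|$, $\alpha!$, $x^\alpha$, $\partial_x^\alpha$; $\beta\le\alpha$ means $\beta_i\le\alpha_i$ for all $i$. $\sum_{|\alpha|\le K}$ is the sum over $\alpha\in\mathbf M$ with $|\alpha|\le K$. $\nabla^j$ denotes the collection of all $x$-derivatives of order $j$. $\|\cdot\|_r$ is the norm of $L^r(\mathbf R^N)$. For $k\ge0$, $L^1_k=L^1(\mathbf R^N,(1+|x|^k)dx)$ with norm $|||f|||_k=\int_{\mathbf R^N}|f(x)|(1+|x|^k)\,dx$. Condition (G) (for $\gamma\in\mathbf N$, $d>0$, $L>0$) on a kernel $G:\mathbf R^N\times(0,\infty)\to\mathbf R$: (i) $G\in C^\gamma(\mathbf R^N\times(0,\infty))$; (ii) $G(x,t)=t^{-N/d}G(x/t^{1/d},1)$ for $x\in\mathbf R^N$, $t>0$, and $\sup_{x\in\mathbf R^N}(1+|x|)^{N+L+j}|\nabla_x^jG(x,1)|<\infty$ for $j=0,\dots,\gamma$; (iii) $G(x,t)=\int_{\mathbf R^N}G(x-y,t-s)G(y,s)\,dy$ for $x\in\mathbf R^N$, $t>s>0$. Put $e^{t\mathcal L}\varphi(x)=\int_{\mathbf R^N}G(x-y,t)\varphi(y)\,dy$ for $t>0$ (and $e^{0\mathcal L}\varphi=\varphi$), $g(x,t)=G(x,t+1)$, and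 $g_\alpha(x,t)=\frac{(-1)^{|\alpha|}}{\alpha!}\partial_x^\alpha g(x,t)$ for $|\alpha|\le\gamma$. For $f\in L^1_k$ with $0\le k<L$, $[k]\le\gamma$, and $t\ge0$, the numbers $M_\alpha(f,t)$ ($|\alpha|\le k$) are defined inductively by $M_0(f,t)=\int_{\mathbf R^N}f(x)\,dx$ and, for $\alpha\ne0$, $$M_\alpha(f,t)=\int_{\mathbf R^N}x^\alpha f(x)\,dx-\sum_{\beta\le\alpha,\ \beta\ne\alpha}M_\beta(f,t)\int_{\mathbf R^N}x^\alpha g_\beta(x,t)\,dx.$$ *)

theory Defs
  imports "HOL-Analysis.Analysis" "HOL-Probability.Essential_Supremum"
begin

text \<open>
  The space is \<open>real ^ 'n\<close> with an arbitrary finite index type, so the dimension is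
  \<open>CARD('n)\<close>. Multi-indices are functions \<open>'n \<Rightarrow> nat\<close>, ordered pointwise.
  All integrals are with respect to Lebesgue measure. Norms take values in \<open>ennreal\<close>,
  so that an inequality between norms includes the finiteness of its left-hand side.
\<close>

definition mi_abs :: "('n::finite \<Rightarrow> nat) \<Rightarrow> nat" where
  "mi_abs \<alpha> = (\<Sum>i\<in>UNIV. \<alpha> i)"

definition mi_fact :: "('n::finite \<Rightarrow> nat) \<Rightarrow> real" where
  "mi_fact \<alpha> = (\<Prod>i\<in>UNIV. fact (\<alpha> i))"

definition mi_power :: "real ^ 'n \<Rightarrow> ('n::finite \<Rightarrow> nat) \<Rightarrow> real" where
  "mi_power x \<alpha> = (\<Prod>i\<in>UNIV. (x $ i) ^ \<alpha> i)"

definition dir_deriv :: "'a::euclidean_space \<Rightarrow> ('a \<Rightarrow> real) \<Rightarrow> 'a \<Rightarrow> real" where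
  "dir_deriv b f x = deriv (\<lambda>s. f (x + s *\<^sub>R b)) 0"

text \<open>
  \<open>Ck_on k S f\<close>, meant for open \<open>S\<close>: all iterated partial derivatives of \<open>f\<close> of order
  at most \<open>k\<close> exist and are continuous on \<open>S\<close>.
\<close>

primrec Ck_on :: "nat \<Rightarrow> 'a::euclidean_space set \<Rightarrow> ('a \<Rightarrow> real) \<Rightarrow> bool" where
  "Ck_on 0 S f \<longleftrightarrow> continuous_on S f"
| "Ck_on (Suc k) S f \<longleftrightarrow> continuous_on S f \<and>
     (\<forall>b\<in>Basis. (\<forall>x\<in>S. (\<lambda>s. f (x + s *\<^sub>R b)) differentiable (at 0)) \<and>
                 Ck_on k S (dir_deriv b f))"

text \<open>
  An iterated partial derivative needs an order in which to differentiate; an arbitrary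
  enumeration of the coordinates is chosen. The order is immaterial for functions of
  class \<open>C\<^sup>k\<close> with \<open>k \<ge> mi_abs \<alpha>\<close>.
\<close>

definition coords :: "'n::finite list" where
  "coords = (SOME is. distinct is \<and> set is = UNIV)"

definition mi_deriv :: "('n::finite \<Rightarrow> nat) \<Rightarrow> (real ^ 'n \<Rightarrow> real) \<Rightarrow> real ^ 'n \<Rightarrow> real" where
  "mi_deriv \<alpha> f = foldr (\<lambda>i. dir_deriv (axis i 1) ^^ \<alpha> i) coords f"

text \<open>The Euclidean length of the collection of all partial derivatives of order \<open>j\<close>.\<close>

definition nabla_norm :: "nat \<Rightarrow> (real ^ 'n::finite \<Rightarrow> real) \<Rightarrow> real ^ 'n \<Rightarrow> real" where
  "nabla_norm j f x = L2_set (\<lambda>\<alpha>. mi_deriv \<alpha> f x) {\<alpha>. mi_abs \<alpha> = j}"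

definition Lq_norm :: "ennreal \<Rightarrow> (real ^ 'n::finite \<Rightarrow> real) \<Rightarrow> ennreal" where
  "Lq_norm q f =
     (if q = \<infinity> then esssup lebesgue (\<lambda>x. ennreal \<bar>f x\<bar>)
      else let I = (\<integral>\<^sup>+ x. ennreal (\<bar>f x\<bar> powr enn2real q) \<partial>lebesgue)
           in if I = \<infinity> then \<infinity> else ennreal (enn2real I powr (1 / enn2real q)))"

text \<open>
  For \<open>k = 0\<close>, \<open>norm x powr k\<close> is \<open>0\<close> instead of \<open>1\<close> at the single point \<open>x = 0\<close>, which
  does not affect the integral.
\<close>

definition weighted_norm :: "real \<Rightarrow> (real ^ 'n::finite \<Rightarrow> real) \<Rightarrow> ennreal" where
  "weighted_norm k f = (\<integral>\<^sup>+ x. ennreal (\<bar>f x\<bar> * (1 + norm x powr k)) \<partial>lebesgue)"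

definition L1_weighted :: "real \<Rightarrow> (real ^ 'n::finite \<Rightarrow> real) set" where
  "L1_weighted k = {f \<in> borel_measurable lebesgue. weighted_norm k f < \<infinity>}"

definition condition_G :: "nat \<Rightarrow> real \<Rightarrow> real \<Rightarrow> (real ^ 'n::finite \<Rightarrow> real \<Rightarrow> real) \<Rightarrow> bool" where
  "condition_G \<gamma> d L G \<longleftrightarrow>
     Ck_on \<gamma> (UNIV \<times> {0<..}) (\<lambda>(x, t). G x t) \<and>
     (\<forall>x. \<forall>t>0. G x t = t powr (- (real CARD('n) / d)) * G (x /\<^sub>R (t powr (1 / d))) 1) \<and>
     (\<forall>j\<le>\<gamma>. bdd_above (range (\<lambda>x.
         (1 + norm x) powr (real CARD('n) + L + real j) * nabla_norm j (\<lambda>y. G y 1) x))) \<and>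
     (\<forall>x s t. 0 < s \<and> s < t \<longrightarrow> G x t = (\<integral>y. G (x - y) (t - s) * G y s \<partial>lebesgue))"

definition evol ::
    "(real ^ 'n::finite \<Rightarrow> real \<Rightarrow> real) \<Rightarrow> real \<Rightarrow> (real ^ 'n \<Rightarrow> real) \<Rightarrow> real ^ 'n \<Rightarrow> real" where
  "evol G t \<phi> x = (if t = 0 then \<phi> x else (\<integral>y. G (x - y) t * \<phi> y \<partial>lebesgue))"

definition g_fun ::
    "(real ^ 'n::finite \<Rightarrow> real \<Rightarrow> real) \<Rightarrow> ('n \<Rightarrow> nat) \<Rightarrow> real ^ 'n \<Rightarrow> real \<Rightarrow> real" where
  "g_fun G \<alpha> x t =
     (- 1) ^ mi_abs \<alpha> / mi_fact \<alpha> * mi_deriv \<alpha> (\<lambda>y. G y (t + 1)) x"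

function moment ::
    "(real ^ 'n::finite \<Rightarrow> real \<Rightarrow> real) \<Rightarrow> (real ^ 'n \<Rightarrow> real) \<Rightarrow> real \<Rightarrow> ('n \<Rightarrow> nat) \<Rightarrow> real" where
  "moment G f t \<alpha> =
     (if \<alpha> = (\<lambda>_. 0) then (\<integral>x. f x \<partial>lebesgue)
      else (\<integral>x. mi_power x \<alpha> * f x \<partial>lebesgue)
           - (\<Sum>\<beta> | \<beta> \<le> \<alpha> \<and> \<beta> \<noteq> \<alpha>.
                moment G f t \<beta> * (\<integral>x. mi_power x \<alpha> * g_fun G \<beta> x t \<partial>lebesgue)))"
  by pat_completeness auto
termination
proof (relation "Wellfounded.measure (\<lambda>(G, f, t, \<alpha>). mi_abs \<alpha>)", goal_cases)
  case 1
  show ?case by simp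
next
  case (2 G f t \<alpha> \<beta>)
  then have le: "\<And>i. \<beta> i \<le> \<alpha> i" and "\<beta> \<noteq> \<alpha>" by (auto simp: le_fun_def)
  then obtain i where "\<beta> i < \<alpha> i" by (metis ext le_neq_implies_less)
  with le have "mi_abs \<beta> < mi_abs \<alpha>"
    unfolding mi_abs_def by (intro sum_strict_mono_ex1) auto
  then show ?case by simp
qed

declare moment.simps [simp del]

definition remainder_v ::
    "(real ^ 'n::finite \<Rightarrow> real \<Rightarrow> real) \<Rightarrow> real \<Rightarrow> (real ^ 'n \<Rightarrow> real) \<Rightarrow> real \<Rightarrow> real ^ 'n \<Rightarrow> real" where
  "remainder_v G K \<phi> t x =
     evol G t \<phi> x - (\<Sum>\<alpha> | real (mi_abs \<alpha>) \<le> K. moment G \<phi> 0 \<alpha> * g_fun G \<alpha> x t)"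

end

theory Submission
  imports Defs
begin

text \<open>
  The error \<open>v\<close> of the expansion is itself a solution: the evolution takes \<open>g\<^sub>\<alpha>(0)\<close> to \<open>g\<^sub>\<alpha>(t)\<close>, so
  \<open>v(t)\<close> is the convolution of the kernel \<open>G(t)\<close> with the datum \<open>w = \<phi> - \<Sum> M\<^sub>\<alpha> g\<^sub>\<alpha>(0)\<close>
  (\<open>conv_kern_corrected\<close>). The coefficients are chosen such that all moments of \<open>w\<close> of order up to \<open>K\<close>
  vanish. Indeed, integration by parts shows that the moment of order \<open>\<alpha>\<close> of \<open>g\<^sub>\<beta>(0)\<close> is zero unless
  \<open>\<beta> \<le> \<alpha>\<close>, and equal to the mass of \<open>G\<close> if \<open>\<beta> = \<alpha>\<close> (\<open>moment_word_deriv\<close>); and the recursion for \<open>M\<^sub>\<alpha>\<close>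
  solves this triangular system (\<open>corrected_moment_free\<close>), provided that the mass is one. The semigroup
  property forces the mass to be one or the kernel to vanish (\<open>mass_dichotomy\<close>).

  For a datum \<open>w\<close> without moments, a Taylor polynomial in \<open>y\<close> may be subtracted from \<open>G(x - y, t)\<close> in the
  convolution. Let \<open>r = t\<^sup>1\<^sup>/\<^sup>d\<close> be the length scale of \<open>G(t)\<close>. After rescaling by \<open>r\<close>, the remainder at \<open>y\<close>
  has a weighted \<open>L\<^sup>1\<close> norm of at most a constant times \<open>\<theta>(y / r)\<close>, where \<open>\<theta>(z)\<close> is the minimum of \<open>|z|\<^sup>K\<close> and
  \<open>|z|\<^sup>m\<close> with \<open>m = \<lfloor>K\<rfloor> + 1 > K\<close> (\<open>taylor_rem_integral_le\<close>, where \<open>\<theta>\<close> is called \<open>cancel_weight K\<close>). Hence the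
  norm of \<open>v(t)\<close> with the weight \<open>(1 + |x| / r)\<^sup>K\<close> is at most a constant times the integral of
  \<open>\<theta>(y / r) |w(y)|\<close> (\<open>conv_moment_free_le\<close>). This is \<open>O(r\<^sup>-\<^sup>K)\<close> because \<open>\<theta>(z) \<le> |z|\<^sup>K\<close>, and it is \<open>o(r\<^sup>-\<^sup>K)\<close>
  by dominated convergence because \<open>\<theta>(z) = o(|z|\<^sup>K)\<close> as \<open>z\<close> tends to zero (\<open>cancel_mass_tendsto_0\<close>).

  The estimate of the weighted \<open>L\<^sup>1\<close> norm implies all others. Writing \<open>v(t)\<close> as the convolution of \<open>G(t / 2)\<close> with
  \<open>v(t / 2)\<close> and letting the derivatives fall on the kernel, one obtains the supremum and the weighted \<open>L\<^sup>1\<close> norm of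
  \<open>\<nabla>\<^sup>j v(t)\<close>; the other exponents \<open>q\<close> and \<open>l\<close> follow by interpolation and comparison of weights (\<open>norms_le\<close>,
  \<open>moment_free_estimate\<close>). For small \<open>t\<close> the kernel is applied to \<open>w\<close> directly.
\<close>

section \<open>Iterated partial derivatives\<close>

abbreviation partial :: "'n::finite \<Rightarrow> (real ^ 'n \<Rightarrow> real) \<Rightarrow> real ^ 'n \<Rightarrow> real" where
  "partial i \<equiv> dir_deriv (axis i 1)"

text \<open>
  A word \<open>[i\<^sub>1, \<dots>, i\<^sub>m]\<close> stands for \<open>\<partial>\<^bsub>i\<^sub>1\<^esub> \<dots> \<partial>\<^bsub>i\<^sub>m\<^esub>\<close>, the last letter acting first.
  Powers of a directional derivative expand into words with coefficients that are plain products of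
  coordinates, so that Taylor's formula needs no multinomial coefficients. Multi-indices enter only where
  the decay of the kernel and the moments are expressed in them.
\<close>

definition word_deriv :: "'n::finite list \<Rightarrow> (real ^ 'n \<Rightarrow> real) \<Rightarrow> real ^ 'n \<Rightarrow> real" where
  "word_deriv is f = foldr partial is f"

lemma word_deriv_simps [simp]:
  "word_deriv [] f = f"
  "word_deriv (i # is) f = partial i (word_deriv is f)"
  "word_deriv (is @ js) f = word_deriv is (word_deriv js f)"
  by (simp_all add: word_deriv_def)

lemma Basis_real_vec: "(Basis :: (real ^ 'n::finite) set) = range (\<lambda>i. axis i 1)"
  by (auto simp: Basis_vec_def)

lemma Ck_on_SucD: "Ck_on (Suc k) S f \<Longrightarrow> Ck_on k S f"
  by (induction k arbitrary: f) auto

lemma Ck_on_continuous: "Ck_on k S f \<Longrightarrow> continuous_on S f"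
  by (cases k) auto

lemma Ck_on_le: "Ck_on k S f \<Longrightarrow> j \<le> k \<Longrightarrow> Ck_on j S f"
  by (induction k) (auto simp: le_Suc_eq dest: Ck_on_SucD simp del: Ck_on.simps(2))

lemma Ck_on_partial:
  fixes f :: "real ^ 'n::finite \<Rightarrow> real"
  assumes "Ck_on (Suc k) S f"
  shows "Ck_on k S (partial i f)"
  using assms by (auto simp: Basis_real_vec)

lemma Ck_on_word_deriv:
  "Ck_on (m + length is) S f \<Longrightarrow> Ck_on m S (word_deriv is f)"
proof (induction "is" arbitrary: m)
  case (Cons i "is")
  from Cons.IH[of "Suc m"] Cons.prems have "Ck_on (Suc m) S (word_deriv is f)"
    by (simp only: length_Cons add_Suc add_Suc_right)
  then show ?case by (simp add: Ck_on_partial del: Ck_on.simps)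
qed simp

lemma Ck_onD_continuous:
  "Ck_on k S f \<Longrightarrow> length is \<le> k \<Longrightarrow> continuous_on S (word_deriv is f)"
  using Ck_on_word_deriv[of 0 "is" S f] Ck_on_le[of k S f "length is"] by simp

lemma has_real_derivative_partial:
  fixes f :: "real ^ 'n::finite \<Rightarrow> real"
  assumes "Ck_on (Suc k) UNIV f"
  shows "((\<lambda>s. f (x + s *\<^sub>R axis i 1)) has_real_derivative partial i f (x + s *\<^sub>R axis i 1)) (at s)"
proof -
  have "(\<lambda>r. f ((x + s *\<^sub>R axis i 1) + r *\<^sub>R axis i 1)) differentiable (at 0)"
    using assms by (auto simp: Basis_real_vec)
  then have "((\<lambda>r. f ((x + s *\<^sub>R axis i 1) + r *\<^sub>R axis i 1)) has_real_derivative
      partial i f (x + s *\<^sub>R axis i 1)) (at 0)"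
    by (simp add: dir_deriv_def DERIV_deriv_iff_real_differentiable)
  then have "((\<lambda>r. f (x + (r + s) *\<^sub>R axis i 1)) has_real_derivative
      partial i f (x + s *\<^sub>R axis i 1)) (at 0)"
    by (simp add: scaleR_add_left algebra_simps)
  then show ?thesis
    using DERIV_shift[of "\<lambda>r. f (x + r *\<^sub>R axis i 1)" _ 0 s] by (simp add: add.commute)
qed

text \<open>
  \<open>Ck_on\<close> recurses on the derivative that is taken first, which is the last letter of a word; hence the
  induction appends letters on the right.
\<close>

lemma Ck_onI:
  fixes f :: "real ^ 'n::finite \<Rightarrow> real"
  assumes "\<And>is. length is \<le> k \<Longrightarrow> continuous_on UNIV (word_deriv is f)"
    and "\<And>is i x. length is < k \<Longrightarrow> (\<lambda>s. word_deriv is f (x + s *\<^sub>R axis i 1)) differentiable (at 0)"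
  shows "Ck_on k UNIV f"
  using assms
proof (induction k arbitrary: f)
  case 0
  from 0(1)[of "[]"] show ?case by simp
next
  case (Suc k)
  have "Ck_on k UNIV (partial i f)" for i
  proof (rule Suc.IH)
    show "continuous_on UNIV (word_deriv is (partial i f))" if "length is \<le> k" for "is"
      using Suc.prems(1)[of "is @ [i]"] that by simp
    show "(\<lambda>s. word_deriv is (partial i f) (x + s *\<^sub>R axis j 1)) differentiable (at 0)"
      if "length is < k" for "is" j x
      using Suc.prems(2)[of "is @ [i]" x j] that by simp
  qed
  then show ?case
    using Suc.prems(1)[of "[]"] Suc.prems(2)[of "[]"] by (auto simp: Basis_real_vec)
qed

text \<open>
  Schwarz's theorem. The second difference of \<open>f\<close> over a square of side \<open>h\<close> is \<open>h\<^sup>2\<close> times either mixed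
  derivative at some point of the square; continuity of both lets \<open>h\<close> tend to zero.
\<close>

lemma partial_commute:
  fixes f :: "real ^ 'n::finite \<Rightarrow> real"
  assumes f: "Ck_on 2 UNIV f"
  shows "partial i (partial j f) = partial j (partial i f)"
proof (rule ext, rule ccontr)
  fix x assume ne: "partial i (partial j f) x \<noteq> partial j (partial i f) x"
  define e where "e = \<bar>partial i (partial j f) x - partial j (partial i f) x\<bar> / 2"
  have e: "e > 0" using ne by (simp add: e_def)
  have Cf: "Ck_on (Suc (Suc 0)) UNIV f" using f by (simp add: numeral_2_eq_2)
  have C1: "Ck_on (Suc 0) UNIV (partial a f)" for a by (rule Ck_on_partial[OF Cf])
  have cont: "continuous_on UNIV (partial a (partial b f))" for a b
    using Ck_on_partial[OF C1[of b], of a] by simp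
  have mvt: "\<exists>\<xi> \<eta>. 0 < \<xi> \<and> \<xi> < h \<and> 0 < \<eta> \<and> \<eta> < h \<and>
      f (x + h *\<^sub>R axis a 1 + h *\<^sub>R axis b 1) - f (x + h *\<^sub>R axis a 1) - f (x + h *\<^sub>R axis b 1) + f x
      = h * h * partial b (partial a f) (x + \<xi> *\<^sub>R axis a 1 + \<eta> *\<^sub>R axis b 1)"
    if h: "0 < h" for h a b
  proof -
    have d1: "((\<lambda>s. f (x + h *\<^sub>R axis b 1 + s *\<^sub>R axis a 1) - f (x + s *\<^sub>R axis a 1)) has_real_derivative
       (partial a f (x + h *\<^sub>R axis b 1 + s *\<^sub>R axis a 1) - partial a f (x + s *\<^sub>R axis a 1))) (at s)" for s
      by (intro DERIV_diff has_real_derivative_partial[OF Cf])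
    have "\<exists>z. 0 < z \<and> z < h \<and>
      f (x + h *\<^sub>R axis b 1 + h *\<^sub>R axis a 1) - f (x + h *\<^sub>R axis a 1)
        - (f (x + h *\<^sub>R axis b 1 + 0 *\<^sub>R axis a 1) - f (x + 0 *\<^sub>R axis a 1))
       = (h - 0) * (partial a f (x + h *\<^sub>R axis b 1 + z *\<^sub>R axis a 1) - partial a f (x + z *\<^sub>R axis a 1))"
      by (rule MVT2[OF h]) (rule d1)
    then obtain \<xi> where \<xi>: "0 < \<xi>" "\<xi> < h" and eq1:
      "f (x + h *\<^sub>R axis b 1 + h *\<^sub>R axis a 1) - f (x + h *\<^sub>R axis a 1) - (f (x + h *\<^sub>R axis b 1) - f x)
       = h * (partial a f (x + h *\<^sub>R axis b 1 + \<xi> *\<^sub>R axis a 1) - partial a f (x + \<xi> *\<^sub>R axis a 1))"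
      by auto
    have d2: "((\<lambda>s. partial a f (x + \<xi> *\<^sub>R axis a 1 + s *\<^sub>R axis b 1)) has_real_derivative
       (partial b (partial a f) (x + \<xi> *\<^sub>R axis a 1 + s *\<^sub>R axis b 1))) (at s)" for s
      by (intro has_real_derivative_partial[OF C1])
    have "\<exists>z. 0 < z \<and> z < h \<and>
      partial a f (x + \<xi> *\<^sub>R axis a 1 + h *\<^sub>R axis b 1) - partial a f (x + \<xi> *\<^sub>R axis a 1 + 0 *\<^sub>R axis b 1)
       = (h - 0) * partial b (partial a f) (x + \<xi> *\<^sub>R axis a 1 + z *\<^sub>R axis b 1)"
      by (rule MVT2[OF h]) (rule d2)
    then obtain \<eta> where \<eta>: "0 < \<eta>" "\<eta> < h" and eq2:
      "partial a f (x + \<xi> *\<^sub>R axis a 1 + h *\<^sub>R axis b 1) - partial a f (x + \<xi> *\<^sub>R axis a 1)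
       = h * partial b (partial a f) (x + \<xi> *\<^sub>R axis a 1 + \<eta> *\<^sub>R axis b 1)"
      by auto
    show ?thesis
      using \<xi> \<eta> eq1 eq2 by (intro exI[of _ \<xi>] exI[of _ \<eta>]) (simp add: algebra_simps)
  qed
  have near: "\<exists>\<delta>>0. \<forall>y. dist y x < \<delta> \<longrightarrow> \<bar>partial a (partial b f) y - partial a (partial b f) x\<bar> < e" for a b
    using cont[of a b] e unfolding continuous_on_iff by (auto simp: dist_real_def)
  obtain \<delta>1 where \<delta>1: "\<delta>1 > 0" "\<And>y. dist y x < \<delta>1 \<Longrightarrow> \<bar>partial i (partial j f) y - partial i (partial j f) x\<bar> < e"
    using near[of i j] by auto
  obtain \<delta>2 where \<delta>2: "\<delta>2 > 0" "\<And>y. dist y x < \<delta>2 \<Longrightarrow> \<bar>partial j (partial i f) y - partial j (partial i f) x\<bar> < e"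
    using near[of j i] by auto
  define h where "h = min \<delta>1 \<delta>2 / 2"
  have h: "h > 0" "2 * h \<le> \<delta>1" "2 * h \<le> \<delta>2" using \<delta>1 \<delta>2 by (auto simp: h_def)
  have close: "dist (x + \<xi> *\<^sub>R axis a 1 + \<eta> *\<^sub>R axis b 1) x < 2 * h"
    if "0 < \<xi>" "\<xi> < h" "0 < \<eta>" "\<eta> < h" for \<xi> \<eta> and a b :: 'n
  proof -
    have "dist (x + \<xi> *\<^sub>R axis a 1 + \<eta> *\<^sub>R axis b 1) x \<le> norm (\<xi> *\<^sub>R axis a (1::real)) + norm (\<eta> *\<^sub>R axis b (1::real))"
      by (simp add: dist_norm norm_triangle_ineq add.assoc del: norm_scaleR)
    then show ?thesis using that by simp
  qed
  obtain \<xi>1 \<eta>1 where 1: "0 < \<xi>1" "\<xi>1 < h" "0 < \<eta>1" "\<eta>1 < h"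
    "f (x + h *\<^sub>R axis i 1 + h *\<^sub>R axis j 1) - f (x + h *\<^sub>R axis i 1) - f (x + h *\<^sub>R axis j 1) + f x
      = h * h * partial j (partial i f) (x + \<xi>1 *\<^sub>R axis i 1 + \<eta>1 *\<^sub>R axis j 1)"
    using mvt[OF h(1), of i j] by blast
  obtain \<xi>2 \<eta>2 where 2: "0 < \<xi>2" "\<xi>2 < h" "0 < \<eta>2" "\<eta>2 < h"
    "f (x + h *\<^sub>R axis j 1 + h *\<^sub>R axis i 1) - f (x + h *\<^sub>R axis j 1) - f (x + h *\<^sub>R axis i 1) + f x
      = h * h * partial i (partial j f) (x + \<xi>2 *\<^sub>R axis j 1 + \<eta>2 *\<^sub>R axis i 1)"
    using mvt[OF h(1), of j i] by blast
  have "h * h * partial j (partial i f) (x + \<xi>1 *\<^sub>R axis i 1 + \<eta>1 *\<^sub>R axis j 1)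
      = h * h * partial i (partial j f) (x + \<xi>2 *\<^sub>R axis j 1 + \<eta>2 *\<^sub>R axis i 1)"
    unfolding 1(5)[symmetric] 2(5)[symmetric] by (simp add: algebra_simps)
  then have "partial j (partial i f) (x + \<xi>1 *\<^sub>R axis i 1 + \<eta>1 *\<^sub>R axis j 1)
      = partial i (partial j f) (x + \<xi>2 *\<^sub>R axis j 1 + \<eta>2 *\<^sub>R axis i 1)"
    using h by simp
  moreover have "\<bar>partial j (partial i f) (x + \<xi>1 *\<^sub>R axis i 1 + \<eta>1 *\<^sub>R axis j 1) - partial j (partial i f) x\<bar> < e"
    using \<delta>2(2) close[OF 1(1-4), of i j] h by simp
  moreover have "\<bar>partial i (partial j f) (x + \<xi>2 *\<^sub>R axis j 1 + \<eta>2 *\<^sub>R axis i 1) - partial i (partial j f) x\<bar> < e"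
    using \<delta>1(2) close[OF 2(1-4), of j i] h by simp
  moreover have "False" if "p = q" "\<bar>p - a\<bar> < e" "\<bar>q - b\<bar> < e" "e = \<bar>b - a\<bar> / 2" for p q a b :: real
    using that by (simp add: abs_if split: if_splits)
  ultimately show False using e_def by blast
qed

lemma word_deriv_snoc_commute:
  assumes "Ck_on (Suc (length is)) UNIV f"
  shows "partial i (word_deriv is f) = word_deriv is (partial i f)"
  using assms
proof (induction "is")
  case (Cons j "is")
  have C: "Ck_on (2 + length is) UNIV f" using Cons.prems by (simp only: length_Cons) (simp del: Ck_on.simps)
  have "partial i (partial j (word_deriv is f)) = partial j (partial i (word_deriv is f))"
    by (rule partial_commute) (rule Ck_on_word_deriv[OF C])
  moreover have "Ck_on (Suc (length is)) UNIV f" by (rule Ck_on_le[OF C]) simp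
  ultimately show ?case using Cons.IH by simp
qed simp

text \<open>
  The first letter of one word is moved to the front of the other by adjacent exchanges, and the rest follows
  by induction.
\<close>

lemma word_deriv_mset:
  assumes "Ck_on (length is) UNIV f" "mset is = mset js"
  shows "word_deriv is f = word_deriv js f"
  using assms
proof (induction "is" arbitrary: js)
  case (Cons i "is")
  then have "i \<in> set js" by (metis list.set_intros(1) mset_eq_setD)
  then obtain ys zs where js: "js = ys @ i # zs" by (meson split_list)
  have m: "mset is = mset (ys @ zs)" using Cons.prems(2) by (simp add: js)
  have len: "length is = length ys + length zs" using m by (metis length_append size_mset)
  have "Ck_on (Suc (length ys) + length zs) UNIV f" using Cons.prems(1) len by (simp del: Ck_on.simps)
  then have "Ck_on (Suc (length ys)) UNIV (word_deriv zs f)" by (rule Ck_on_word_deriv)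
  from word_deriv_snoc_commute[OF this, of i]
  have "word_deriv js f = partial i (word_deriv (ys @ zs) f)" by (simp add: js)
  also have "word_deriv (ys @ zs) f = word_deriv is f"
    using Cons.IH[OF Ck_on_SucD m] Cons.prems(1) by (simp only: length_Cons)
  finally show ?case by simp
qed simp

definition mi_word :: "('n::finite \<Rightarrow> nat) \<Rightarrow> 'n list" where
  "mi_word \<alpha> = concat (map (\<lambda>i. replicate (\<alpha> i) i) coords)"

lemma coords: "distinct (coords :: 'n::finite list)" "set (coords :: 'n list) = UNIV"
proof -
  have "\<exists>is :: 'n list. distinct is \<and> set is = UNIV"
    using finite_distinct_list[of "UNIV :: 'n set"] by auto
  from someI_ex[OF this] show "distinct (coords :: 'n list)" "set (coords :: 'n list) = UNIV"
    unfolding coords_def by auto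
qed

lemma mi_deriv_eq_word_deriv: "mi_deriv \<alpha> f = word_deriv (mi_word \<alpha>) f"
proof -
  have *: "word_deriv (replicate n i) h = (partial i ^^ n) h" for n and i :: "'m::finite" and h
    by (induction n) auto
  have "foldr (\<lambda>i. partial i ^^ \<alpha> i) xs f = word_deriv (concat (map (\<lambda>i. replicate (\<alpha> i) i) xs)) f" for xs
    by (induction xs) (auto simp: *)
  then show ?thesis by (simp add: mi_deriv_def mi_word_def)
qed

lemma count_mset_mi_word: "count (mset (mi_word \<alpha>)) = \<alpha>"
proof
  fix j
  have "count (mset (concat (map (\<lambda>i. replicate (\<alpha> i) i) xs))) j = (\<Sum>i\<leftarrow>xs. if i = j then \<alpha> i else 0)" for xs
    by (induction xs) auto
  also have "(\<Sum>i\<leftarrow>coords. if i = j then \<alpha> i else 0) = (\<Sum>i\<in>UNIV. if i = j then \<alpha> i else 0)"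
    using coords by (metis sum.distinct_set_conv_list)
  finally show "count (mset (mi_word \<alpha>)) j = \<alpha> j" by (simp add: mi_word_def)
qed

lemma length_eq_mi_abs_count: "length (is :: 'n::finite list) = mi_abs (count (mset is))"
proof -
  have "size (mset is) = sum (count (mset is)) UNIV"
    unfolding size_multiset_overloaded_eq by (rule sum.mono_neutral_left) (auto simp: not_in_iff)
  then show ?thesis by (simp add: mi_abs_def)
qed

lemma length_mi_word: "length (mi_word \<alpha>) = mi_abs \<alpha>"
  by (simp add: length_eq_mi_abs_count count_mset_mi_word)

lemma word_deriv_eq_mi_deriv:
  assumes "Ck_on (length is) UNIV f"
  shows "word_deriv is f = mi_deriv (count (mset is)) f"
  unfolding mi_deriv_eq_word_deriv
  by (rule word_deriv_mset[OF assms]) (simp add: count_inject[symmetric] count_mset_mi_word)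

section \<open>Taylor expansion along a line\<close>

lemma MVT_signed:
  fixes f :: "real \<Rightarrow> real"
  assumes "\<And>s. (f has_real_derivative f' s) (at s)"
  shows "\<exists>\<theta>. \<bar>\<theta>\<bar> \<le> \<bar>r\<bar> \<and> f r - f 0 = r * f' \<theta>"
proof -
  consider "r = 0" | "0 < r" | "r < 0" by linarith
  then show ?thesis
  proof cases
    case 2
    from MVT2[OF this, of f f'] assms obtain z where "0 < z" "z < r" "f r - f 0 = (r - 0) * f' z" by blast
    then show ?thesis by (intro exI[of _ z]) auto
  next
    case 3
    from MVT2[OF this, of f f'] assms obtain z where "r < z" "z < 0" "f 0 - f r = (0 - r) * f' z" by blast
    then show ?thesis by (intro exI[of _ z]) (auto simp: algebra_simps)
  qed auto
qed

text \<open>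
  Existence of partial derivatives does not give differentiability, continuity does: changing the coordinates
  one after the other, each increment is by the mean value theorem a partial derivative at a nearby point
  times the increment of that coordinate.
\<close>

lemma C1_has_derivative:
  fixes f :: "real ^ 'n::finite \<Rightarrow> real"
  assumes f: "Ck_on (Suc k) UNIV f"
  shows "(f has_derivative (\<lambda>h. \<Sum>i\<in>UNIV. h $ i * partial i f x)) (at x)"
proof -
  have step: "\<forall>e::real. e > 0 \<longrightarrow> ( \<exists>\<delta>>0. \<forall>h. norm h < \<delta> \<longrightarrow>
     \<bar>f (x + (\<Sum>i\<in>B. h $ i *\<^sub>R axis i 1)) - f x - (\<Sum>i\<in>B. h $ i * partial i f x)\<bar> \<le> e * card B * norm h)"
    if "finite B" for B :: "'n set"
    using that
  proof induction
    case empty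
    show ?case by (intro allI impI, rule exI[of _ 1]) simp
  next
    case (insert c B)
    show ?case
    proof (intro allI impI)
      fix e :: real assume e: "e > 0"
      obtain \<delta>1 where \<delta>1: "\<delta>1 > 0" "\<And>h. norm h < \<delta>1 \<Longrightarrow>
        \<bar>f (x + (\<Sum>i\<in>B. h $ i *\<^sub>R axis i 1)) - f x - (\<Sum>i\<in>B. h $ i * partial i f x)\<bar> \<le> e * card B * norm h"
        using insert.IH e by blast
      have "continuous_on UNIV (partial c f)" using Ck_on_partial[OF f] by (rule Ck_on_continuous)
      then obtain \<delta>2 where \<delta>2: "\<delta>2 > 0" "\<And>z. norm (z - x) < \<delta>2 \<Longrightarrow> \<bar>partial c f z - partial c f x\<bar> < e"
        using e unfolding continuous_on_iff by (metis UNIV_I dist_norm real_norm_def)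
      define \<delta> where "\<delta> = min \<delta>1 (\<delta>2 / (card B + 1))"
      have \<delta>: "\<delta> > 0" using \<delta>1 \<delta>2 by (simp add: \<delta>_def)
      show "\<exists>\<delta>>0. \<forall>h. norm h < \<delta> \<longrightarrow>
        \<bar>f (x + (\<Sum>i\<in>insert c B. h $ i *\<^sub>R axis i 1)) - f x - (\<Sum>i\<in>insert c B. h $ i * partial i f x)\<bar>
          \<le> e * card (insert c B) * norm h"
      proof (intro exI[of _ \<delta>] conjI allI impI \<delta>)
        fix h :: "real ^ 'n" assume h: "norm h < \<delta>"
        define y where "y = x + (\<Sum>i\<in>B. h $ i *\<^sub>R axis i 1)"
        obtain \<theta> where \<theta>: "\<bar>\<theta>\<bar> \<le> \<bar>h $ c\<bar>"
          "f (y + (h $ c) *\<^sub>R axis c 1) - f (y + 0 *\<^sub>R axis c 1) = h $ c * partial c f (y + \<theta> *\<^sub>R axis c 1)"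
          using MVT_signed[of "\<lambda>s. f (y + s *\<^sub>R axis c 1)", OF has_real_derivative_partial[OF f]] by blast
        have "norm (y - x) \<le> (\<Sum>i\<in>B. norm (h $ i *\<^sub>R (axis i 1 :: real ^ 'n)))"
          unfolding y_def by (simp add: norm_sum del: norm_scaleR)
        also have "\<dots> \<le> (\<Sum>i\<in>B. norm h)" by (intro sum_mono) (simp add: component_le_norm_cart)
        finally have ny: "norm (y - x) \<le> card B * norm h" by simp
        have "norm (y + \<theta> *\<^sub>R axis c 1 - x) \<le> norm (y - x) + norm (\<theta> *\<^sub>R (axis c 1 :: real ^ 'n))"
          by (metis (no_types, lifting) add_diff_eq diff_add_eq norm_triangle_ineq)
        also have "\<dots> \<le> card B * norm h + norm h"
          using ny \<theta>(1) component_le_norm_cart[of h c] by simp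
        also have "\<dots> = (card B + 1) * norm h" by (simp add: algebra_simps)
        also have "\<dots> < (card B + 1) * (\<delta>2 / (card B + 1))"
          by (rule mult_strict_left_mono) (use h \<delta>_def in auto)
        also have "\<dots> = \<delta>2" by simp
        finally have "\<bar>partial c f (y + \<theta> *\<^sub>R axis c 1) - partial c f x\<bar> < e" by (rule \<delta>2(2))
        then have "\<bar>h $ c * partial c f (y + \<theta> *\<^sub>R axis c 1) - h $ c * partial c f x\<bar> \<le> norm h * e"
          unfolding right_diff_distrib[symmetric] abs_mult
          using component_le_norm_cart[of h c] by (intro mult_mono) auto
        moreover have "\<bar>f y - f x - (\<Sum>i\<in>B. h $ i * partial i f x)\<bar> \<le> e * card B * norm h"
          unfolding y_def using h \<delta>_def by (intro \<delta>1(2)) simp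
        moreover have "x + (\<Sum>i\<in>insert c B. h $ i *\<^sub>R axis i 1) = y + (h $ c) *\<^sub>R axis c 1"
          using insert by (simp add: y_def algebra_simps)
        moreover have "(\<Sum>i\<in>insert c B. h $ i * partial i f x) = h $ c * partial c f x + (\<Sum>i\<in>B. h $ i * partial i f x)"
          using insert by simp
        moreover have "e * card (insert c B) * norm h = e * card B * norm h + norm h * e"
          using insert by (simp add: algebra_simps)
        ultimately show "\<bar>f (x + (\<Sum>i\<in>insert c B. h $ i *\<^sub>R axis i 1)) - f x
            - (\<Sum>i\<in>insert c B. h $ i * partial i f x)\<bar> \<le> e * card (insert c B) * norm h"
          using \<theta>(2) by simp
      qed
    qed
  qed
  have expand: "(\<Sum>i\<in>UNIV. h $ i *\<^sub>R axis i 1) = h" for h :: "real ^ 'n"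
    using basis_expansion[of h] by (simp add: scalar_mult_eq_scaleR)
  show ?thesis
    unfolding has_derivative_at_alt
  proof (intro conjI allI impI)
    show "bounded_linear (\<lambda>h. \<Sum>i\<in>UNIV. h $ i * partial i f x)"
      by (intro bounded_linear_sum bounded_linear_mult_const bounded_linear_vec_nth)
    fix e :: real assume e: "e > 0"
    have card: "real CARD('n) > 0" by simp
    have e': "e / CARD('n) > 0" using e card by simp
    from step[of UNIV, OF finite, THEN spec, THEN mp, OF e'] obtain \<delta> where \<delta>: "\<delta> > 0" "\<And>h. norm h < \<delta> \<Longrightarrow>
     \<bar>f (x + h) - f x - (\<Sum>i\<in>UNIV. h $ i * partial i f x)\<bar> \<le> e / CARD('n) * CARD('n) * norm h"
      unfolding expand by blast
    have "norm (f y - f x - (\<Sum>i\<in>UNIV. (y - x) $ i * partial i f x)) \<le> e * norm (y - x)"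
      if "norm (y - x) < \<delta>" for y
      using \<delta>(2)[OF that] card by simp
    with \<delta>(1) show "\<exists>d>0. \<forall>y. norm (y - x) < d \<longrightarrow>
        norm (f y - f x - (\<Sum>i\<in>UNIV. (y - x) $ i * partial i f x)) \<le> e * norm (y - x)"
      by blast
  qed
qed

lemma DERIV_along_line:
  fixes f :: "real ^ 'n::finite \<Rightarrow> real"
  assumes f: "Ck_on (Suc k) UNIV f"
  shows "((\<lambda>s. f (x + s *\<^sub>R h)) has_real_derivative (\<Sum>i\<in>UNIV. h $ i * partial i f (x + s *\<^sub>R h))) (at s)"
proof -
  have "((\<lambda>s. x + s *\<^sub>R h) has_derivative (\<lambda>r. r *\<^sub>R h)) (at s)"
    by (auto intro!: derivative_eq_intros)
  from has_derivative_compose[OF this C1_has_derivative[OF f]]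
  have "((\<lambda>s. f (x + s *\<^sub>R h)) has_derivative
      (\<lambda>r. \<Sum>i\<in>UNIV. (r *\<^sub>R h) $ i * partial i f (x + s *\<^sub>R h))) (at s)" .
  moreover have "(\<lambda>r. \<Sum>i\<in>UNIV. (r *\<^sub>R h) $ i * partial i f (x + s *\<^sub>R h))
      = (*) (\<Sum>i\<in>UNIV. h $ i * partial i f (x + s *\<^sub>R h))"
    by (auto simp: sum_distrib_left mult_ac)
  ultimately show ?thesis
    by (simp only: has_field_derivative_def)
qed

text \<open>
  The \<open>m\<close>-th derivative at \<open>s = 0\<close> of \<open>f (x + s h)\<close>. The direction enters only through monomials: a function
  of \<open>h\<close> whose moments of order \<open>m\<close> vanish is therefore orthogonal to every \<open>line_deriv m h f x\<close>.
\<close>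

definition line_deriv :: "nat \<Rightarrow> real ^ 'n \<Rightarrow> (real ^ 'n::finite \<Rightarrow> real) \<Rightarrow> real ^ 'n \<Rightarrow> real" where
  "line_deriv m h f x = (\<Sum>is | length is = m. (\<Prod>i\<leftarrow>is. h $ i) * word_deriv is f x)"

lemma finite_words: "finite {is :: 'n::finite list. length is = m}"
  using finite_lists_length_eq[of "UNIV :: 'n set" m] by simp

lemma DERIV_line_deriv:
  fixes f :: "real ^ 'n::finite \<Rightarrow> real"
  assumes f: "Ck_on (Suc m) UNIV f"
  shows "((\<lambda>s. line_deriv m h f (x + s *\<^sub>R h)) has_real_derivative line_deriv (Suc m) h f (x + s *\<^sub>R h)) (at s)"
proof -
  have words: "{is :: 'n list. length is = Suc m} = (\<lambda>(is, i). i # is) ` ({is. length is = m} \<times> UNIV)"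
    by (auto simp: length_Suc_conv image_iff)
  have inj: "inj_on (\<lambda>(is, i). i # is) ({is :: 'n list. length is = m} \<times> UNIV)"
    by (auto simp: inj_on_def)
  have "line_deriv (Suc m) h f (x + s *\<^sub>R h) =
      (\<Sum>is | length is = m. (\<Prod>i\<leftarrow>is. h $ i) * (\<Sum>i\<in>UNIV. h $ i * partial i (word_deriv is f) (x + s *\<^sub>R h)))"
    unfolding line_deriv_def words
    by (subst sum.reindex[OF inj])
       (simp add: case_prod_unfold sum.cartesian_product sum_distrib_left mult_ac)
  moreover have "((\<lambda>s. word_deriv is f (x + s *\<^sub>R h)) has_real_derivative
      (\<Sum>i\<in>UNIV. h $ i * partial i (word_deriv is f) (x + s *\<^sub>R h))) (at s)" if "length is = m" for "is"
    by (rule DERIV_along_line[of 0]) (use f that in \<open>simp add: Ck_on_word_deriv del: Ck_on.simps\<close>)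
  ultimately show ?thesis
    unfolding line_deriv_def by (auto intro!: DERIV_sum DERIV_cmult)
qed

lemma Taylor_along_line:
  fixes f :: "real ^ 'n::finite \<Rightarrow> real"
  assumes f: "Ck_on (Suc k) UNIV f"
  shows "\<exists>s. 0 < s \<and> s < 1 \<and>
    f (x + h) = (\<Sum>m\<le>k. line_deriv m h f x / fact m) + line_deriv (Suc k) h f (x + s *\<^sub>R h) / fact (Suc k)"
proof -
  let ?d = "\<lambda>m s. line_deriv m h f (x + s *\<^sub>R h)"
  have "\<exists>t. 0 < t \<and> t < 1 \<and>
      ?d 0 1 = (\<Sum>m<Suc k. ?d m 0 / fact m * 1 ^ m) + ?d (Suc k) t / fact (Suc k) * 1 ^ Suc k"
    by (rule Maclaurin) (auto intro!: DERIV_line_deriv Ck_on_le[OF f] simp del: Ck_on.simps)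
  then show ?thesis by (simp add: line_deriv_def lessThan_Suc_atMost)
qed

lemma abs_line_deriv_le:
  fixes f :: "real ^ 'n::finite \<Rightarrow> real"
  assumes "\<And>is. length is = m \<Longrightarrow> \<bar>word_deriv is f x\<bar> \<le> B"
  shows "\<bar>line_deriv m h f x\<bar> \<le> real (card {is :: 'n list. length is = m}) * norm h ^ m * B"
proof -
  have prod: "\<bar>\<Prod>i\<leftarrow>is. h $ i\<bar> \<le> norm h ^ length is" for "is"
    by (induction "is") (simp_all add: abs_mult mult_mono component_le_norm_cart)
  have "\<bar>line_deriv m h f x\<bar> \<le> (\<Sum>is | length is = m. \<bar>(\<Prod>i\<leftarrow>is. h $ i) * word_deriv is f x\<bar>)"
    unfolding line_deriv_def by (rule sum_abs)
  also have "\<dots> \<le> (\<Sum>is\<in>{is :: 'n list. length is = m}. norm h ^ m * B)"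
    unfolding abs_mult using prod assms by (intro sum_mono mult_mono) auto
  finally show ?thesis by simp
qed

section \<open>Integrals over Euclidean space\<close>

abbreviation weight :: "real \<Rightarrow> 'a::real_normed_vector \<Rightarrow> real" where
  "weight K x \<equiv> (1 + norm x) powr K"

abbreviation wnorm :: "real \<Rightarrow> ('a::euclidean_space \<Rightarrow> real) \<Rightarrow> ennreal" where
  "wnorm K f \<equiv> \<integral>\<^sup>+y. ennreal (\<bar>f y\<bar> * weight K y) \<partial>lborel"

abbreviation swnorm :: "real \<Rightarrow> real \<Rightarrow> ('a::euclidean_space \<Rightarrow> real) \<Rightarrow> ennreal" where
  "swnorm r K f \<equiv> \<integral>\<^sup>+y. ennreal (\<bar>f y\<bar> * weight K (y /\<^sub>R r)) \<partial>lborel"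

abbreviation l1norm :: "('a::euclidean_space \<Rightarrow> real) \<Rightarrow> ennreal" where
  "l1norm f \<equiv> \<integral>\<^sup>+y. ennreal \<bar>f y\<bar> \<partial>lborel"

abbreviation moment_free :: "real \<Rightarrow> (real ^ 'n::finite \<Rightarrow> real) \<Rightarrow> bool" where
  "moment_free K w \<equiv> \<forall>\<alpha>. real (mi_abs \<alpha>) \<le> K \<longrightarrow> (\<integral>y. mi_power y \<alpha> * w y \<partial>lborel) = 0"

text \<open>
  On the dyadic shell \<open>2\<^sup>n \<le> 1 + |x| < 2\<^sup>n\<^sup>+\<^sup>1\<close> the integrand is at most \<open>2\<^sup>-\<^sup>p\<^sup>n\<close>, while the shell lies in a
  ball of volume proportional to \<open>2\<^sup>n\<^sup>N\<close>; for \<open>p > N\<close> the sum over \<open>n\<close> is a convergent geometric series.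
\<close>

lemma integrable_decay:
  fixes p :: real
  assumes p: "p > real DIM('a::euclidean_space)"
  shows "integrable lborel (\<lambda>x::'a. weight (- p) x)"
proof (rule integrableI_bounded)
  let ?n = "DIM('a)"
  define c where "c = measure lborel (ball 0 1 :: 'a set)"
  define r where "r = 2 powr (real ?n - p)"
  have "r < 2 powr 0" unfolding r_def by (rule powr_less_mono) (use p in auto)
  then have r: "0 < r" "r < 1" by (simp_all add: r_def)
  have c: "c \<ge> 0" by (simp add: c_def)
  have term_le: "a n \<le> (\<Sum>n. a n)" for a :: "nat \<Rightarrow> ennreal" and n
    using sum_le_suminf[of a "{n}"] by simp
  have pw: "ennreal (norm (weight (- p) x))
      \<le> (\<Sum>n. ennreal (2 powr (- p * n)) * indicator (ball 0 (2 ^ Suc n)) x)" for x :: 'a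
  proof -
    \<comment> \<open>The shell that contains \<open>x\<close>.\<close>
    define n where "n = nat \<lfloor>log 2 (1 + norm x)\<rfloor>"
    have pos: "0 < 1 + norm x" by (simp add: add_pos_nonneg)
    have l0: "0 \<le> log 2 (1 + norm x)" using pos by (subst zero_le_log_cancel_iff) auto
    have n: "real n \<le> log 2 (1 + norm x)" "log 2 (1 + norm x) < real (Suc n)"
      using l0 unfolding n_def by linarith+
    have n': "2 powr n \<le> 1 + norm x" "1 + norm x < 2 powr (Suc n)"
      using n le_log_iff[OF _ pos, of 2 "real n"] log_less_iff[OF _ pos, of 2 "real (Suc n)"] by linarith+
    have "weight (- p) x \<le> (2 powr n) powr (- p)"
      using n'(1) p by (intro powr_mono2') (auto intro: order_trans[OF _ less_imp_le])
    also have "(2 powr n) powr (- p) = 2 powr (- p * n)"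
      by (simp only: powr_powr mult.commute)
    finally have le: "weight (- p) x \<le> 2 powr (- p * n)" .
    have "1 + norm x < 2 ^ Suc n"
      using n'(2) powr_realpow[of 2 "Suc n"] by simp
    then have mem: "x \<in> ball 0 (2 ^ Suc n)" by (simp del: power_Suc)
    have "ennreal (norm (weight (- p) x)) \<le> ennreal (2 powr (- p * n)) * indicator (ball 0 (2 ^ Suc n)) x"
      using le mem by (simp add: ennreal_leI del: power_Suc)
    also have "\<dots> \<le> (\<Sum>n. ennreal (2 powr (- p * n)) * indicator (ball 0 (2 ^ Suc n)) x)"
      by (rule term_le)
    finally show ?thesis .
  qed
  have em: "emeasure lborel (ball 0 R :: 'a set) = ennreal (R ^ ?n * c)" if "R > 0" for R
    using emeasure_eq_ennreal_measure[of lborel "ball 0 R :: 'a set"]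
      content_ball_conv_unit_ball[of R "0::'a"] emeasure_lborel_ball_finite[of "0::'a" R] that
    by (simp add: c_def)
  have "(\<integral>\<^sup>+x. ennreal (norm (weight (- p) (x::'a))) \<partial>lborel)
      \<le> (\<integral>\<^sup>+x. (\<Sum>n. ennreal (2 powr (- p * n)) * indicator (ball 0 (2 ^ Suc n) :: 'a set) x) \<partial>lborel)"
    by (intro nn_integral_mono pw)
  also have "\<dots> = (\<Sum>n. \<integral>\<^sup>+x. ennreal (2 powr (- p * n)) * indicator (ball 0 (2 ^ Suc n) :: 'a set) x \<partial>lborel)"
    by (rule nn_integral_suminf) (intro borel_measurable_times_ennreal borel_measurable_const borel_measurable_indicator, simp)
  also have "\<dots> = (\<Sum>n. ennreal (2 powr (- p * n)) * ennreal ((2 ^ Suc n) ^ ?n * c))"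
    by (simp only: nn_integral_cmult_indicator[of _ lborel] sets_lborel borel_open open_ball em zero_less_power zero_less_numeral)
  also have "\<dots> = (\<Sum>n. ennreal (2 ^ ?n * c * r ^ n))"
  proof (intro suminf_cong)
    fix n
    have pow: "(2 ^ Suc n) ^ ?n = 2 powr (real (Suc n * ?n))"
      by (simp only: powr_realpow[OF zero_less_numeral] power_mult)
    have rn: "r ^ n = 2 powr ((real ?n - p) * n)"
      using powr_realpow[OF r(1), of n] by (simp add: r_def powr_powr)
    have "2 powr (- p * n) * (2 ^ Suc n) ^ ?n = 2 powr (- p * n + real (Suc n * ?n))"
      by (simp only: powr_add pow)
    also have "- p * n + real (Suc n * ?n) = real ?n + (real ?n - p) * n" by (simp add: algebra_simps)
    also have "2 powr (real ?n + (real ?n - p) * n) = 2 ^ ?n * r ^ n"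
      by (simp only: rn powr_add powr_realpow[OF zero_less_numeral])
    finally have "2 powr (- p * n) * ((2 ^ Suc n) ^ ?n * c) = 2 ^ ?n * c * r ^ n"
      by (simp only: mult.assoc[symmetric]) (simp only: mult_ac)
    then have "ennreal (2 powr (- p * n) * ((2 ^ Suc n) ^ ?n * c)) = ennreal (2 ^ ?n * c * r ^ n)"
      by (rule arg_cong)
    moreover have "ennreal (2 powr (- p * n) * ((2 ^ Suc n) ^ ?n * c))
        = ennreal (2 powr (- p * n)) * ennreal ((2 ^ Suc n) ^ ?n * c)"
      by (rule ennreal_mult) (auto simp: c)
    ultimately show "ennreal (2 powr (- p * n)) * ennreal ((2 ^ Suc n) ^ ?n * c) = ennreal (2 ^ ?n * c * r ^ n)"
      by (simp only:)
  qed
  also have "\<dots> < \<infinity>"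
  proof -
    have "summable (\<lambda>n. 2 ^ ?n * c * r ^ n)" using r by (intro summable_mult summable_geometric) auto
    then show ?thesis using r c by (simp add: ennreal_suminf_neq_top less_top)
  qed
  finally show "(\<integral>\<^sup>+x. ennreal (norm (weight (- p) (x::'a))) \<partial>lborel) < \<infinity>" .
qed measurable

text \<open>
  The mean value theorem bounds the difference quotients by the same majorant as the derivative, so that
  dominated convergence applies along every sequence of increments.
\<close>

lemma DERIV_lebesgue_integral:
  fixes F :: "real \<Rightarrow> 'a \<Rightarrow> real"
  assumes int: "\<And>s. \<bar>s\<bar> < 1 \<Longrightarrow> integrable M (F s)"
    and der: "\<And>s x. \<bar>s\<bar> < 1 \<Longrightarrow> ((\<lambda>s. F s x) has_real_derivative F' s x) (at s)"
    and bound: "\<And>s x. \<bar>s\<bar> < 1 \<Longrightarrow> \<bar>F' s x\<bar> \<le> w x"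
    and w: "integrable M w"
    and meas: "F' 0 \<in> borel_measurable M"
  shows "((\<lambda>s. \<integral>x. F s x \<partial>M) has_real_derivative (\<integral>x. F' 0 x \<partial>M)) (at 0)"
  unfolding DERIV_def tendsto_at_iff_sequentially comp_def
proof (intro allI impI)
  fix h :: "nat \<Rightarrow> real" assume h: "\<forall>i. h i \<in> UNIV - {0}" and lim: "h \<longlonglongrightarrow> 0"
  from lim have "eventually (\<lambda>n. \<bar>h n\<bar> < 1) sequentially"
    by (auto simp: tendsto_iff dist_real_def)
  then obtain n0 where n0: "\<And>n. n \<ge> n0 \<Longrightarrow> \<bar>h n\<bar> < 1" by (auto simp: eventually_sequentially)
  define k where "k n = h (n + n0)" for n
  have k: "\<bar>k n\<bar> < 1" "k n \<noteq> 0" for n using n0 h by (auto simp: k_def)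
  have klim: "k \<longlonglongrightarrow> 0" unfolding k_def using lim by (rule LIMSEQ_ignore_initial_segment)
  have "(\<lambda>n. \<integral>x. (F (k n) x - F 0 x) / k n \<partial>M) \<longlonglongrightarrow> (\<integral>x. F' 0 x \<partial>M)"
  proof (rule integral_dominated_convergence[where w = w])
    show "(\<lambda>x. (F (k n) x - F 0 x) / k n) \<in> borel_measurable M" for n
      using int[of "k n"] int[of 0] k by auto
    show "AE x in M. (\<lambda>n. (F (k n) x - F 0 x) / k n) \<longlonglongrightarrow> F' 0 x"
    proof (rule AE_I2)
      fix x
      from der[of 0 x] have d: "((\<lambda>r. (F r x - F 0 x) / r) \<longlongrightarrow> F' 0 x) (at 0)"
        by (simp add: DERIV_def)
      have "filterlim k (at 0) sequentially" by (simp add: filterlim_at klim k(2))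
      from filterlim_compose[OF d this]
      show "(\<lambda>n. (F (k n) x - F 0 x) / k n) \<longlonglongrightarrow> F' 0 x" .
    qed
    show "AE x in M. norm ((F (k n) x - F 0 x) / k n) \<le> w x" for n
    proof (rule AE_I2)
      fix x
      have small: "\<bar>z\<bar> < 1" if "z \<in> {- \<bar>k n\<bar>..\<bar>k n\<bar>}" for z
      proof -
        have "- \<bar>k n\<bar> \<le> z" "z \<le> \<bar>k n\<bar>" using that by simp_all
        then show ?thesis using k(1)[of n] by linarith
      qed
      have "norm (F (k n) x - F 0 x) \<le> w x * norm (k n - 0)"
      proof (rule field_differentiable_bound[where f' = "\<lambda>s. F' s x" and S = "{- \<bar>k n\<bar>..\<bar>k n\<bar>}"])
        show "((\<lambda>s. F s x) has_field_derivative F' z x) (at z within {- \<bar>k n\<bar>..\<bar>k n\<bar>})"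
          if "z \<in> {- \<bar>k n\<bar>..\<bar>k n\<bar>}" for z
          by (rule has_field_derivative_at_within) (rule der[OF small[OF that]])
        show "norm (F' z x) \<le> w x" if "z \<in> {- \<bar>k n\<bar>..\<bar>k n\<bar>}" for z
          using bound[OF small[OF that], of x] by simp
        show "convex {- \<bar>k n\<bar>..\<bar>k n\<bar>}" by (rule convex_real_interval)
        show "k n \<in> {- \<bar>k n\<bar>..\<bar>k n\<bar>}" "0 \<in> {- \<bar>k n\<bar>..\<bar>k n\<bar>}"
          using abs_ge_self[of "k n"] abs_ge_minus_self[of "k n"] by (auto simp: minus_le_iff)
      qed
      then show "norm ((F (k n) x - F 0 x) / k n) \<le> w x"
        using k(2)[of n] by (simp add: divide_simps)
    qed
  qed (use w meas in auto)
  moreover have quot: "(\<integral>x. (F (k n) x - F 0 x) / k n \<partial>M) = ((\<integral>x. F (0 + k n) x \<partial>M) - (\<integral>x. F 0 x \<partial>M)) / k n" for n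
    using int[of "k n"] int[of 0] k by simp
  ultimately have "(\<lambda>n. ((\<integral>x. F (0 + k n) x \<partial>M) - (\<integral>x. F 0 x \<partial>M)) / k n) \<longlonglongrightarrow> (\<integral>x. F' 0 x \<partial>M)"
    by (simp only:)
  then have "(\<lambda>n. ((\<integral>x. F (0 + h (n + n0)) x \<partial>M) - (\<integral>x. F 0 x \<partial>M)) / h (n + n0)) \<longlonglongrightarrow> (\<integral>x. F' 0 x \<partial>M)"
    by (simp only: k_def)
  then show "(\<lambda>n. ((\<integral>x. F (0 + h n) x \<partial>M) - (\<integral>x. F 0 x \<partial>M)) / h n) \<longlonglongrightarrow> (\<integral>x. F' 0 x \<partial>M)"
    by (rule LIMSEQ_offset)
qed

lemma distr_lborel_reflect: "distr lborel borel (\<lambda>y. x - y) = (lborel :: 'a::euclidean_space measure)"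
proof -
  have "(lborel :: 'a measure) = density (distr lborel borel (\<lambda>y. x + (- 1) *\<^sub>R y)) (\<lambda>_. ennreal (\<bar>- 1\<bar> ^ DIM('a)))"
    by (rule lborel_affine) simp
  then show ?thesis by (simp add: density_1)
qed

lemma distr_lborel_shift: "distr lborel borel (\<lambda>y. y - a) = (lborel :: 'a::euclidean_space measure)"
proof -
  have "(+) (- a) = (\<lambda>y. y - a)" by auto
  then show ?thesis using lborel_distr_plus[of "- a"] by simp
qed

lemma nn_integral_shift:
  fixes f :: "'a::euclidean_space \<Rightarrow> ennreal"
  assumes "f \<in> borel_measurable borel"
  shows "(\<integral>\<^sup>+y. f (y - a) \<partial>lborel) = (\<integral>\<^sup>+y. f y \<partial>lborel)"
  using nn_integral_distr[of "\<lambda>y. y - a" lborel borel f] assms by (simp add: distr_lborel_shift)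

lemma integral_reflect:
  fixes f :: "'a::euclidean_space \<Rightarrow> real"
  assumes "f \<in> borel_measurable borel"
  shows "(LBINT y. f (x - y)) = (LBINT y. f y)"
  using integral_distr[of "\<lambda>y. x - y" lborel borel f] assms by (simp add: distr_lborel_reflect)

lemma integral_shift:
  fixes f :: "'a::euclidean_space \<Rightarrow> real"
  assumes "f \<in> borel_measurable borel"
  shows "(LBINT y. f (y - a)) = (LBINT y. f y)"
  using integral_distr[of "\<lambda>y. y - a" lborel borel f] assms by (simp add: distr_lborel_shift)

lemma integrable_shift:
  fixes f :: "'a::euclidean_space \<Rightarrow> real"
  assumes "integrable lborel f"
  shows "integrable lborel (\<lambda>y. f (y - a))"
  using integrable_distr_eq[of "\<lambda>y. y - a" lborel borel f] assms by (simp add: distr_lborel_shift)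

lemma nn_integral_scale:
  fixes f :: "'a::euclidean_space \<Rightarrow> ennreal"
  assumes [measurable]: "f \<in> borel_measurable borel" and r: "r > 0"
  shows "(\<integral>\<^sup>+x. f (x /\<^sub>R r) \<partial>lborel) = ennreal (r ^ DIM('a)) * (\<integral>\<^sup>+x. f x \<partial>lborel)"
proof -
  let ?c = "inverse r"
  have eq: "(lborel :: 'a measure) = density (distr lborel borel (\<lambda>x. 0 + ?c *\<^sub>R x)) (\<lambda>_. \<bar>?c\<bar> ^ DIM('a))"
    by (rule lborel_affine) (use r in simp)
  have "(\<integral>\<^sup>+x. f x \<partial>lborel) = (\<integral>\<^sup>+x. f x \<partial>density (distr lborel borel (\<lambda>x. 0 + ?c *\<^sub>R x)) (\<lambda>_. \<bar>?c\<bar> ^ DIM('a)))"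
    by (simp only: eq[symmetric])
  also have "\<dots> = (\<integral>\<^sup>+x. ennreal (\<bar>?c\<bar> ^ DIM('a)) * f (?c *\<^sub>R x) \<partial>lborel)"
    by (subst nn_integral_density) (auto simp: nn_integral_distr)
  also have "\<dots> = ennreal (?c ^ DIM('a)) * (\<integral>\<^sup>+x. f (x /\<^sub>R r) \<partial>lborel)"
    using r by (subst nn_integral_cmult) auto
  finally have "ennreal (r ^ DIM('a)) * (\<integral>\<^sup>+x. f x \<partial>lborel)
     = (ennreal (r ^ DIM('a)) * ennreal (?c ^ DIM('a))) * (\<integral>\<^sup>+x. f (x /\<^sub>R r) \<partial>lborel)"
    by (simp only: mult.assoc)
  also have "ennreal (r ^ DIM('a)) * ennreal (?c ^ DIM('a)) = 1"
    using r by (simp add: ennreal_mult[symmetric] power_mult_distrib[symmetric])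
  finally show ?thesis by simp
qed

section \<open>Convolution\<close>

lemma integrable_bounded_mult:
  fixes g w :: "'a::euclidean_space \<Rightarrow> real"
  assumes "g \<in> borel_measurable borel" "\<And>x. \<bar>g x\<bar> \<le> B" "integrable lborel w"
  shows "integrable lborel (\<lambda>y. g y * w y)"
proof (rule Bochner_Integration.integrable_bound[of _ "\<lambda>y. B * w y"])
  show "integrable lborel (\<lambda>y. B * w y)" using assms by auto
  show "(\<lambda>y. g y * w y) \<in> borel_measurable lborel" using assms by auto
  have "B \<ge> 0" using assms(2)[of 0] by linarith
  then show "AE x in lborel. norm (g x * w x) \<le> norm (B * w x)"
    using assms(2) by (auto simp: abs_mult intro!: mult_right_mono)
qed

definition conv :: "('a::euclidean_space \<Rightarrow> real) \<Rightarrow> ('a \<Rightarrow> real) \<Rightarrow> 'a \<Rightarrow> real" where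
  "conv f w x = (LBINT y. f (x - y) * w y)"

lemma conv_integrable:
  fixes g w :: "'a::euclidean_space \<Rightarrow> real" and B :: real
  assumes g: "g \<in> borel_measurable borel" and b: "\<And>x. \<bar>g x\<bar> \<le> B" and w: "integrable lborel w"
  shows "integrable lborel (\<lambda>y. g (x - y) * w y)"
proof (rule integrable_bounded_mult[where B = B, OF _ _ w])
  show "\<bar>g (x - y)\<bar> \<le> B" for y by (rule b)
  show "(\<lambda>y. g (x - y)) \<in> borel_measurable borel"
    by (rule measurable_compose[OF _ g]) simp
qed

lemma conv_commute:
  fixes f g :: "'a::euclidean_space \<Rightarrow> real"
  assumes [measurable]: "f \<in> borel_measurable borel" "g \<in> borel_measurable borel"
  shows "conv f g x = conv g f x"
  unfolding conv_def using integral_reflect[of "\<lambda>y. f (x - y) * g y" x] by (simp add: mult.commute)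

lemma continuous_on_conv:
  fixes g w :: "'a::euclidean_space \<Rightarrow> real"
  assumes c: "continuous_on UNIV g" and b: "\<And>x. \<bar>g x\<bar> \<le> B" and w: "integrable lborel w"
  shows "continuous_on UNIV (conv g w)"
  unfolding continuous_on_sequentially comp_def conv_def
proof (intro ballI allI impI)
  have g[measurable]: "g \<in> borel_measurable borel" using c by (rule borel_measurable_continuous_onI)
  have [measurable]: "w \<in> borel_measurable borel" using w by auto
  have B: "B \<ge> 0" using b[of 0] by linarith
  fix X :: "nat \<Rightarrow> 'a" and a assume "(\<forall>n. X n \<in> UNIV) \<and> X \<longlonglongrightarrow> a"
  then have X: "X \<longlonglongrightarrow> a" by simp
  show "(\<lambda>n. \<integral>y. g (X n - y) * w y \<partial>lborel) \<longlonglongrightarrow> (LBINT y. g (a - y) * w y)"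
  proof (rule integral_dominated_convergence[where w = "\<lambda>y. B * \<bar>w y\<bar>"])
    show "integrable lborel (\<lambda>y. B * \<bar>w y\<bar>)" using w by auto
    show "AE y in lborel. (\<lambda>n. g (X n - y) * w y) \<longlonglongrightarrow> g (a - y) * w y"
    proof (rule AE_I2)
      fix y
      have "isCont g (a - y)" using c by (simp add: continuous_on_eq_continuous_at)
      moreover have "(\<lambda>n. X n - y) \<longlonglongrightarrow> a - y" using X by (intro tendsto_diff tendsto_const)
      ultimately have "(\<lambda>n. g (X n - y)) \<longlonglongrightarrow> g (a - y)" by (rule isCont_tendsto_compose)
      then show "(\<lambda>n. g (X n - y) * w y) \<longlonglongrightarrow> g (a - y) * w y" by (intro tendsto_mult tendsto_const)
    qed
    show "AE y in lborel. norm (g (X n - y) * w y) \<le> B * \<bar>w y\<bar>" for n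
      using b by (auto simp: abs_mult intro!: mult_right_mono)
  qed measurable
qed

text \<open>
  The derivative falls on the kernel, where it is bounded; the datum is merely integrable.
\<close>

lemma DERIV_conv:
  fixes g w :: "real ^ 'n::finite \<Rightarrow> real"
  assumes g: "Ck_on (Suc 0) UNIV g" and b: "\<And>x. \<bar>g x\<bar> \<le> B" "\<And>x. \<bar>partial i g x\<bar> \<le> B"
    and w: "integrable lborel w"
  shows "((\<lambda>s. conv g w (x + s *\<^sub>R axis i 1)) has_real_derivative conv (partial i g) w x) (at 0)"
proof -
  have g_meas: "g \<in> borel_measurable borel"
    using Ck_on_continuous[OF g] by (rule borel_measurable_continuous_onI)
  have dg[measurable]: "partial i g \<in> borel_measurable borel"
    using Ck_on_continuous[OF Ck_on_partial[OF g]] by (rule borel_measurable_continuous_onI)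
  have [measurable]: "w \<in> borel_measurable borel" using w by auto
  have "((\<lambda>s. \<integral>y. g (x + s *\<^sub>R axis i 1 - y) * w y \<partial>lborel) has_real_derivative
      (LBINT y. partial i g (x + 0 *\<^sub>R axis i 1 - y) * w y)) (at 0)"
  proof (rule DERIV_lebesgue_integral[where w = "\<lambda>y. B * \<bar>w y\<bar>"])
    show "integrable lborel (\<lambda>y. g (x + s *\<^sub>R axis i 1 - y) * w y)" for s
      by (rule conv_integrable[OF g_meas b(1) w])
    show "integrable lborel (\<lambda>y. B * \<bar>w y\<bar>)" using w by auto
    show "\<bar>partial i g (x + s *\<^sub>R axis i 1 - y) * w y\<bar> \<le> B * \<bar>w y\<bar>" for s y
      using b(2) by (auto simp: abs_mult intro!: mult_right_mono)
    show "((\<lambda>s. g (x + s *\<^sub>R axis i 1 - y) * w y) has_real_derivative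
        partial i g (x + s *\<^sub>R axis i 1 - y) * w y) (at s)" for s y
      using DERIV_cmult_right[OF has_real_derivative_partial[OF g, of "x - y" i s], of "w y"]
      by (simp add: algebra_simps)
  qed measurable
  then show ?thesis by (simp add: conv_def[abs_def])
qed

lemma word_deriv_conv:
  fixes g w :: "real ^ 'n::finite \<Rightarrow> real"
  assumes g: "Ck_on k UNIV g" and b: "\<And>is x. length is \<le> k \<Longrightarrow> \<bar>word_deriv is g x\<bar> \<le> B"
    and w: "integrable lborel w" and l: "length is \<le> k"
  shows "word_deriv is (conv g w) = conv (word_deriv is g) w"
  using l
proof (induction "is")
  case (Cons i "is")
  have C: "Ck_on (Suc 0) UNIV (word_deriv is g)"
    by (rule Ck_on_word_deriv) (rule Ck_on_le[OF g], use Cons.prems in simp)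
  have "((\<lambda>s. conv (word_deriv is g) w (x + s *\<^sub>R axis i 1)) has_real_derivative
      conv (partial i (word_deriv is g)) w x) (at 0)" for x
    by (rule DERIV_conv[OF C _ _ w, where B = B]) (use b[of "is"] b[of "i # is"] Cons.prems in auto)
  then have "partial i (conv (word_deriv is g) w) = conv (partial i (word_deriv is g)) w"
    by (intro ext) (simp add: dir_deriv_def[of _ "conv (word_deriv is g) w"] DERIV_imp_deriv)
  then show ?case
    using Cons by simp
qed simp

lemma Ck_on_conv:
  fixes g w :: "real ^ 'n::finite \<Rightarrow> real"
  assumes g: "Ck_on k UNIV g" and b: "\<And>is x. length is \<le> k \<Longrightarrow> \<bar>word_deriv is g x\<bar> \<le> B"
    and w: "integrable lborel w"
  shows "Ck_on k UNIV (conv g w)"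
proof (rule Ck_onI)
  show "continuous_on UNIV (word_deriv is (conv g w))" if "length is \<le> k" for "is"
    by (subst word_deriv_conv[OF g b w that], assumption, rule continuous_on_conv[OF Ck_onD_continuous[OF g that] _ w, where B = B]) (use b that in auto)
  show "(\<lambda>s. word_deriv is (conv g w) (x + s *\<^sub>R axis i 1)) differentiable (at 0)" if "length is < k" for "is" i x
  proof -
    have C: "Ck_on (Suc 0) UNIV (word_deriv is g)"
      by (rule Ck_on_word_deriv) (rule Ck_on_le[OF g], use that in simp)
    have eq: "word_deriv is (conv g w) = conv (word_deriv is g) w"
      using that by (intro word_deriv_conv[OF g b w]) auto
    have "((\<lambda>s. conv (word_deriv is g) w (x + s *\<^sub>R axis i 1)) has_real_derivative
        conv (partial i (word_deriv is g)) w x) (at 0)"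
      by (rule DERIV_conv[OF C _ _ w, where B = B]) (use b[of "is"] b[of "i # is"] that in auto)
    then show ?thesis
      unfolding eq by (auto simp: real_differentiable_def)
  qed
qed

lemma integrable_conv_pair:
  fixes g h :: "'a::euclidean_space \<Rightarrow> real"
  assumes g: "integrable lborel g" and h: "integrable lborel h"
  shows "integrable (lborel \<Otimes>\<^sub>M lborel) (\<lambda>(z, y). g (y - z) * h z)"
proof (rule integrableI_bounded)
  have [measurable]: "g \<in> borel_measurable borel" "h \<in> borel_measurable borel" using g h by auto
  show "(\<lambda>(z, y). g (y - z) * h z) \<in> borel_measurable (lborel \<Otimes>\<^sub>M lborel)" by measurable
  have gf: "(\<integral>\<^sup>+y. ennreal (norm (g y)) \<partial>lborel) < \<infinity>" and hf: "(\<integral>\<^sup>+y. ennreal (norm (h y)) \<partial>lborel) < \<infinity>"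
    using g h by (auto simp: integrable_iff_bounded)
  have "(\<integral>\<^sup>+x. ennreal (norm (case x of (z, y) \<Rightarrow> g (y - z) * h z)) \<partial>(lborel \<Otimes>\<^sub>M lborel))
      = (\<integral>\<^sup>+z. \<integral>\<^sup>+y. ennreal (norm (h z)) * ennreal (norm (g (y - z))) \<partial>lborel \<partial>lborel)"
    by (subst lborel.nn_integral_fst[symmetric]) (auto simp: abs_mult ennreal_mult mult.commute)
  also have "\<dots> = (\<integral>\<^sup>+z. ennreal (norm (h z)) * (\<integral>\<^sup>+y. ennreal (norm (g y)) \<partial>lborel) \<partial>lborel)"
    by (simp add: nn_integral_cmult nn_integral_shift[of "\<lambda>y. ennreal (norm (g y))", simplified])
  also have "\<dots> = (\<integral>\<^sup>+z. ennreal (norm (h z)) \<partial>lborel) * (\<integral>\<^sup>+y. ennreal (norm (g y)) \<partial>lborel)"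
    by (simp add: nn_integral_multc)
  also have "\<dots> < \<infinity>" using gf hf by (simp add: ennreal_mult_less_top)
  finally show "(\<integral>\<^sup>+x. ennreal (norm (case x of (z, y) \<Rightarrow> g (y - z) * h z)) \<partial>(lborel \<Otimes>\<^sub>M lborel)) < \<infinity>" .
qed

lemma integrable_conv:
  fixes g h :: "'a::euclidean_space \<Rightarrow> real"
  assumes g: "integrable lborel g" and h: "integrable lborel h"
  shows "integrable lborel (conv g h)"
  using lborel_pair.integrable_snd[OF integrable_conv_pair[OF g h]] by (simp add: conv_def[abs_def])

lemma integral_conv:
  fixes g h :: "'a::euclidean_space \<Rightarrow> real"
  assumes g: "integrable lborel g" and h: "integrable lborel h"
  shows "(LBINT x. conv g h x) = (LBINT x. g x) * (LBINT x. h x)"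
proof -
  have [measurable]: "g \<in> borel_measurable borel" using g by auto
  have "(LBINT x. conv g h x) = (\<integral>z. \<integral>y. g (y - z) * h z \<partial>lborel \<partial>lborel)"
    unfolding conv_def by (rule lborel_pair.Fubini_integral[OF integrable_conv_pair[OF g h]])
  also have "\<dots> = (\<integral>z. (LBINT y. g y) * h z \<partial>lborel)"
    by (simp add: integral_shift)
  finally show ?thesis by simp
qed

text \<open>
  Bounded times integrable suffices for Fubini's theorem, which leaves the order of integration free.
\<close>

lemma conv_assoc:
  fixes f g h :: "'a::euclidean_space \<Rightarrow> real"
  assumes f[measurable]: "f \<in> borel_measurable borel" and b: "\<And>x. \<bar>f x\<bar> \<le> B"
    and g: "integrable lborel g" and h: "integrable lborel h"
  shows "conv f (conv g h) x = conv (conv f g) h x"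
proof -
  have [measurable]: "g \<in> borel_measurable borel" "h \<in> borel_measurable borel" using g h by auto
  have B: "B \<ge> 0" using b[of 0] by linarith
  have int: "integrable (lborel \<Otimes>\<^sub>M lborel) (\<lambda>(z, y). f (x - y) * (g (y - z) * h z))"
  proof (rule Bochner_Integration.integrable_bound)
    show "integrable (lborel \<Otimes>\<^sub>M lborel) (\<lambda>p. B * (case p of (z, y) \<Rightarrow> g (y - z) * h z))"
      using integrable_conv_pair[OF g h] by (rule integrable_mult_right)
    show "(\<lambda>(z, y). f (x - y) * (g (y - z) * h z)) \<in> borel_measurable (lborel \<Otimes>\<^sub>M lborel)" by measurable
    show "AE p in lborel \<Otimes>\<^sub>M lborel. norm (case p of (z, y) \<Rightarrow> f (x - y) * (g (y - z) * h z))
        \<le> norm (B * (case p of (z, y) \<Rightarrow> g (y - z) * h z))"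
      using b B by (auto simp: abs_mult intro!: mult_right_mono AE_I2)
  qed
  have "conv f (conv g h) x = (\<integral>y. \<integral>z. f (x - y) * (g (y - z) * h z) \<partial>lborel \<partial>lborel)"
    by (simp add: conv_def)
  also have "\<dots> = (\<integral>z. \<integral>y. f (x - y) * (g (y - z) * h z) \<partial>lborel \<partial>lborel)"
    by (rule lborel_pair.Fubini_integral[OF int])
  also have "\<dots> = (\<integral>z. (LBINT y. f (x - y) * g (y - z)) * h z \<partial>lborel)"
    by (simp add: mult.assoc[symmetric])
  also have "\<dots> = (LBINT z. conv f g (x - z) * h z)"
    using integral_shift[of "\<lambda>y. f (x - z - y) * g y" z for z]
    by (simp add: conv_def algebra_simps)
  finally show ?thesis by (simp add: conv_def)
qed

text \<open>
  Young's inequality for weighted \<open>L\<^sup>1\<close> norms: a weight \<open>c\<close> with \<open>c (x + y) \<le> a x b y\<close> splits between the two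
  factors of a convolution. Three different weights are allowed because kernel and datum live on different
  length scales.
\<close>

lemma nn_conv_weight:
  fixes k h a b c :: "'a::euclidean_space \<Rightarrow> ennreal"
  assumes [measurable]: "k \<in> borel_measurable borel" "h \<in> borel_measurable borel" "a \<in> borel_measurable borel"
     "b \<in> borel_measurable borel" "c \<in> borel_measurable borel"
    and le: "\<And>x y. c (x + y) \<le> a x * b y"
  shows "(\<integral>\<^sup>+x. (\<integral>\<^sup>+y. k (x - y) * h y \<partial>lborel) * c x \<partial>lborel)
    \<le> (\<integral>\<^sup>+x. k x * a x \<partial>lborel) * (\<integral>\<^sup>+y. h y * b y \<partial>lborel)"
proof -
  have "(\<integral>\<^sup>+x. (\<integral>\<^sup>+y. k (x - y) * h y \<partial>lborel) * c x \<partial>lborel)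
      = (\<integral>\<^sup>+x. \<integral>\<^sup>+y. k (x - y) * h y * c x \<partial>lborel \<partial>lborel)"
    by (simp add: nn_integral_multc)
  also have "\<dots> = (\<integral>\<^sup>+y. \<integral>\<^sup>+x. k (x - y) * h y * c x \<partial>lborel \<partial>lborel)"
    by (rule lborel_pair.Fubini') measurable
  also have "\<dots> \<le> (\<integral>\<^sup>+y. \<integral>\<^sup>+x. (k (x - y) * a (x - y)) * (h y * b y) \<partial>lborel \<partial>lborel)"
  proof (intro nn_integral_mono)
    fix x y
    have "k (x - y) * h y * c x \<le> k (x - y) * h y * (a (x - y) * b y)"
      using le[of "x - y" y] by (intro mult_left_mono) auto
    then show "k (x - y) * h y * c x \<le> (k (x - y) * a (x - y)) * (h y * b y)" by (simp add: mult_ac)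
  qed
  also have "\<dots> = (\<integral>\<^sup>+y. (\<integral>\<^sup>+x. k x * a x \<partial>lborel) * (h y * b y) \<partial>lborel)"
    by (simp add: nn_integral_multc nn_integral_shift[of "\<lambda>x. k x * a x", simplified])
  also have "\<dots> = (\<integral>\<^sup>+x. k x * a x \<partial>lborel) * (\<integral>\<^sup>+y. h y * b y \<partial>lborel)"
    by (simp add: nn_integral_cmult)
  finally show ?thesis .
qed

section \<open>Weights and monomials\<close>

text \<open>
  Submultiplicativity with constant one is the reason for using \<open>(1 + |x|)\<^sup>K\<close> in place of the equivalent
  weight \<open>1 + |x|\<^sup>K\<close>.
\<close>

lemma weight_add_le:
  fixes x y :: "'a::real_normed_vector"
  assumes "K \<ge> 0"
  shows "weight K (x + y) \<le> weight K x * weight K y"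
proof -
  have "1 + norm (x + y) \<le> 1 + (norm x + norm y)" by (simp add: norm_triangle_ineq)
  also have "\<dots> \<le> (1 + norm x) * (1 + norm y)" by (simp add: algebra_simps)
  finally have "weight K (x + y) \<le> ((1 + norm x) * (1 + norm y)) powr K"
    using assms by (intro powr_mono2) auto
  then show ?thesis by (simp add: powr_mult)
qed

lemma wnorm_diff_le:
  fixes f g :: "'a::euclidean_space \<Rightarrow> real"
  assumes [measurable]: "f \<in> borel_measurable borel" "g \<in> borel_measurable borel"
  shows "wnorm K (\<lambda>y. f y - c * g y) \<le> wnorm K f + ennreal \<bar>c\<bar> * wnorm K g"
proof -
  have "wnorm K (\<lambda>y. f y - c * g y) \<le> (\<integral>\<^sup>+y. ennreal (\<bar>f y\<bar> * weight K y) + ennreal \<bar>c\<bar> * ennreal (\<bar>g y\<bar> * weight K y) \<partial>lborel)"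
  proof (rule nn_integral_mono)
    fix y :: 'a
    have "\<bar>f y - c * g y\<bar> * weight K y \<le> (\<bar>f y\<bar> + \<bar>c\<bar> * \<bar>g y\<bar>) * weight K y"
      by (intro mult_right_mono order_trans[OF abs_triangle_ineq4]) (auto simp: abs_mult)
    also have "\<dots> = \<bar>f y\<bar> * weight K y + \<bar>c\<bar> * (\<bar>g y\<bar> * weight K y)" by (simp add: distrib_right)
    finally show "ennreal (\<bar>f y - c * g y\<bar> * weight K y) \<le> ennreal (\<bar>f y\<bar> * weight K y) + ennreal \<bar>c\<bar> * ennreal (\<bar>g y\<bar> * weight K y)"
      by (simp add: ennreal_leI flip: ennreal_mult ennreal_plus)
  qed
  also have "\<dots> = wnorm K f + ennreal \<bar>c\<bar> * wnorm K g"
    by (simp add: nn_integral_add nn_integral_cmult)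
  finally show ?thesis .
qed

lemma wnorm_diff_sum_le:
  fixes f :: "'a::euclidean_space \<Rightarrow> real" and g :: "'b \<Rightarrow> 'a \<Rightarrow> real"
  assumes "finite S" "f \<in> borel_measurable borel" "\<And>b. b \<in> S \<Longrightarrow> g b \<in> borel_measurable borel"
  shows "wnorm K (\<lambda>y. f y - (\<Sum>b\<in>S. c b * g b y)) \<le> wnorm K f + (\<Sum>b\<in>S. ennreal \<bar>c b\<bar> * wnorm K (g b))"
  using assms(1,3)
proof (induction S)
  case (insert b S)
  have "wnorm K (\<lambda>y. f y - (\<Sum>b\<in>insert b S. c b * g b y)) = wnorm K (\<lambda>y. (f y - (\<Sum>b\<in>S. c b * g b y)) - c b * g b y)"
    using insert.hyps by (simp add: algebra_simps)
  also have "\<dots> \<le> wnorm K (\<lambda>y. f y - (\<Sum>b\<in>S. c b * g b y)) + ennreal \<bar>c b\<bar> * wnorm K (g b)"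
    using insert.prems assms(2)
    by (intro wnorm_diff_le borel_measurable_diff borel_measurable_sum borel_measurable_times) auto
  also have "\<dots> \<le> (wnorm K f + (\<Sum>b\<in>S. ennreal \<bar>c b\<bar> * wnorm K (g b))) + ennreal \<bar>c b\<bar> * wnorm K (g b)"
    using insert by (intro add_right_mono) auto
  finally show ?case using insert.hyps by (simp add: add_ac)
qed simp

lemma weight_near:
  fixes x z :: "'a::real_normed_vector"
  assumes "q \<ge> 0" "norm z \<le> 1"
  shows "weight (- q) (x + z) \<le> 2 powr q * weight (- q) x"
proof -
  have "weight q (x + z + (- z)) \<le> weight q (x + z) * weight q (- z)"
    by (rule weight_add_le) (rule assms(1))
  also have "\<dots> \<le> weight q (x + z) * 2 powr q"
    using assms by (intro mult_left_mono powr_mono2) auto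
  finally have "weight q x \<le> weight q (x + z) * 2 powr q" by simp
  moreover have "0 < 1 + norm x" "0 < 1 + norm (x + z)" by (simp_all add: add_pos_nonneg)
  then have "0 < weight q x" "0 < weight q (x + z)" by (simp_all only: powr_gt_zero)
  ultimately show ?thesis
    by (simp add: powr_minus divide_simps mult.commute)
qed

lemma abs_mi_power_le: "\<bar>mi_power x \<alpha>\<bar> \<le> norm x ^ mi_abs \<alpha>"
proof -
  have "\<bar>mi_power x \<alpha>\<bar> = (\<Prod>i\<in>UNIV. \<bar>x $ i\<bar> ^ \<alpha> i)"
    by (simp add: mi_power_def abs_prod power_abs)
  also have "\<dots> \<le> (\<Prod>i\<in>UNIV. norm x ^ \<alpha> i)"
    by (intro prod_mono conjI power_mono component_le_norm_cart) auto
  also have "\<dots> = norm x ^ mi_abs \<alpha>" by (simp add: mi_abs_def power_sum)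
  finally show ?thesis .
qed

lemma abs_mi_power_le_weight:
  assumes "real (mi_abs \<alpha>) \<le> K"
  shows "\<bar>mi_power x \<alpha>\<bar> \<le> weight K x"
proof -
  have "norm x ^ mi_abs \<alpha> \<le> (1 + norm x) ^ mi_abs \<alpha>" by (intro power_mono) auto
  also have "\<dots> = weight (mi_abs \<alpha>) x" by (rule powr_realpow[symmetric]) (simp add: add_pos_nonneg)
  also have "\<dots> \<le> weight K x" using assms by (intro powr_mono) auto
  finally show ?thesis using abs_mi_power_le[of x \<alpha>] by linarith
qed

lemma measurable_mi_power [measurable]: "(\<lambda>x. mi_power x \<alpha>) \<in> borel_measurable borel"
  unfolding mi_power_def
  by (intro borel_measurable_continuous_onI continuous_intros)

lemma mi_power_eq_prod_list:
  fixes h :: "real ^ 'n::finite"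
  shows "(\<Prod>i\<leftarrow>is. (c *\<^sub>R h) $ i) = c ^ length is * mi_power h (count (mset is))"
proof (induction "is")
  case (Cons j "is")
  have "mi_power h (count (mset (j # is))) = (\<Prod>i\<in>UNIV. (if i = j then h $ i else 1) * (h $ i) ^ count (mset is) i)"
    unfolding mi_power_def by (intro prod.cong) auto
  also have "\<dots> = h $ j * mi_power h (count (mset is))"
    by (simp add: mi_power_def prod.distrib)
  finally have step: "mi_power h (count (mset (j # is))) = h $ j * mi_power h (count (mset is))" .
  show ?case unfolding step using Cons.IH by (simp del: mset.simps)
qed (simp add: mi_power_def)

lemma finite_mi_abs_eq: "finite {\<alpha> :: 'n::finite \<Rightarrow> nat. mi_abs \<alpha> = j}"
proof (rule finite_subset)
  show "{\<alpha> :: 'n \<Rightarrow> nat. mi_abs \<alpha> = j} \<subseteq> (\<lambda>is. count (mset is)) ` {is. length is = j}"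
  proof
    fix \<alpha> :: "'n \<Rightarrow> nat" assume "\<alpha> \<in> {\<alpha>. mi_abs \<alpha> = j}"
    then show "\<alpha> \<in> (\<lambda>is. count (mset is)) ` {is. length is = j}"
      by (intro image_eqI[of _ _ "mi_word \<alpha>"]) (simp_all add: length_mi_word count_mset_mi_word)
  qed
  show "finite ((\<lambda>is. count (mset is)) ` {is :: 'n list. length is = j})"
    using finite_words by (rule finite_imageI)
qed

lemma mi_abs_mono: "\<beta> \<le> \<alpha> \<Longrightarrow> mi_abs \<beta> \<le> mi_abs \<alpha>"
  unfolding mi_abs_def by (intro sum_mono) (simp add: le_funD)

lemma mi_abs_strict_mono:
  assumes "\<beta> \<le> \<alpha>" "\<beta> \<noteq> \<alpha>"
  shows "mi_abs \<beta> < mi_abs \<alpha>"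
proof -
  have le: "\<And>i. \<beta> i \<le> \<alpha> i" using assms(1) by (auto simp: le_fun_def)
  from assms obtain i where "\<beta> i < \<alpha> i" using le by (metis ext le_neq_implies_less)
  with le show ?thesis
    unfolding mi_abs_def by (intro sum_strict_mono_ex1) auto
qed

lemma finite_mi_abs_le: "finite {\<alpha> :: 'n::finite \<Rightarrow> nat. real (mi_abs \<alpha>) \<le> K}"
proof (rule finite_subset)
  show "{\<alpha> :: 'n \<Rightarrow> nat. real (mi_abs \<alpha>) \<le> K} \<subseteq> (\<Union>j\<le>nat \<lfloor>K\<rfloor>. {\<alpha>. mi_abs \<alpha> = j})"
    by (auto simp: le_nat_iff le_floor_iff)
qed (auto intro: finite_mi_abs_eq)

lemma finite_mi_below: "finite {\<beta> :: 'n::finite \<Rightarrow> nat. \<beta> \<le> \<alpha> \<and> \<beta> \<noteq> \<alpha>}"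
  by (rule finite_subset[OF _ finite_mi_abs_le[of "real (mi_abs \<alpha>)"]]) (auto dest: mi_abs_mono)

section \<open>Moments of a decaying profile\<close>

text \<open>
  The profile is the kernel at time one, and \<open>p\<close> plays the role of \<open>N + L\<close>. A single rate \<open>p\<close> serves all
  derivatives: the weights below grow at most like \<open>|x|\<^sup>K\<close> with \<open>K < L = p - N\<close>.
\<close>

locale decaying_profile =
  fixes F :: "real ^ 'n::finite \<Rightarrow> real" and k :: nat and B p :: real
  assumes Ck: "Ck_on k UNIV F"
    and decay: "\<And>is x. length is \<le> k \<Longrightarrow> \<bar>word_deriv is F x\<bar> \<le> B * weight (- p) x"
    and p_gt: "p > real CARD('n)"
begin

lemma B_nonneg: "B \<ge> 0"
proof -
  have "0 \<le> B * weight (- p) (0 :: real ^ 'n)"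
    using decay[of "[]" 0] abs_ge_zero[of "F 0"] by (simp del: abs_ge_zero)
  then show ?thesis by simp
qed

lemma p_pos: "p > 0"
  using p_gt by (meson of_nat_0_le_iff order_le_less_trans)

lemma measurable_word_deriv:
  "length is \<le> k \<Longrightarrow> word_deriv is F \<in> borel_measurable borel"
  using Ck_onD_continuous[OF Ck] by (intro borel_measurable_continuous_onI) auto

lemma measurable_F [measurable]: "F \<in> borel_measurable borel"
  using measurable_word_deriv[of "[]"] by simp

lemma integrable_weight:
  assumes "K < p - real CARD('n)"
  shows "integrable lborel (\<lambda>x :: real ^ 'n. weight (K - p) x)"
  using integrable_decay[where 'a = "real ^ 'n", of "p - K"] assms by simp

definition weight_mass :: "real \<Rightarrow> real" where
  "weight_mass K = (LBINT x. weight (K - p) (x :: real ^ 'n))"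

lemma weight_mass_nonneg: "weight_mass K \<ge> 0"
  by (simp add: weight_mass_def)

lemma nn_weight_mass:
  assumes "K < p - real CARD('n)"
  shows "(\<integral>\<^sup>+x. ennreal (weight (K - p) (x :: real ^ 'n)) \<partial>lborel) = ennreal (weight_mass K)"
  unfolding weight_mass_def by (rule nn_integral_eq_integral[OF integrable_weight[OF assms]]) simp

lemma abs_mi_power_word_le:
  assumes "length is \<le> k" "real (mi_abs \<alpha>) \<le> a"
  shows "\<bar>mi_power x \<alpha> * word_deriv is F x\<bar> \<le> B * weight (a - p) x"
proof -
  have "\<bar>mi_power x \<alpha> * word_deriv is F x\<bar> \<le> weight a x * (B * weight (- p) x)"
    unfolding abs_mult by (intro mult_mono abs_mi_power_le_weight decay assms) auto
  also have "\<dots> = B * (weight a x * weight (- p) x)" by simp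
  also have "weight a x * weight (- p) x = weight (a - p) x"
    by (simp only: powr_add[symmetric]) simp
  finally show ?thesis .
qed

lemma integrable_mi_power_word:
  assumes "length is \<le> k" "real (mi_abs \<alpha>) < p - real CARD('n)"
  shows "integrable lborel (\<lambda>x. mi_power x \<alpha> * word_deriv is F x)"
proof (rule Bochner_Integration.integrable_bound)
  show "integrable lborel (\<lambda>x :: real ^ 'n. B * weight (real (mi_abs \<alpha>) - p) x)"
    using integrable_weight[OF assms(2)] by (rule integrable_mult_right)
  show "(\<lambda>x. mi_power x \<alpha> * word_deriv is F x) \<in> borel_measurable lborel"
    using measurable_word_deriv[OF assms(1)] by measurable
  show "AE x in lborel. norm (mi_power x \<alpha> * word_deriv is F x) \<le> norm (B * weight (real (mi_abs \<alpha>) - p) x)"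
    using abs_mi_power_word_le[OF assms(1) order_refl] B_nonneg by (auto simp: abs_mult)
qed

lemma integrable_F: "integrable lborel F"
  using integrable_mi_power_word[of "[]" "\<lambda>_. 0"] p_gt by (simp add: mi_power_def mi_abs_def)

lemma decay_near:
  assumes "length is \<le> k" "norm z \<le> 1"
  shows "\<bar>word_deriv is F (x + z)\<bar> \<le> B * 2 powr p * weight (- p) x"
proof -
  have "\<bar>word_deriv is F (x + z)\<bar> \<le> B * weight (- p) (x + z)" by (rule decay[OF assms(1)])
  also have "\<dots> \<le> B * (2 powr p * weight (- p) x)"
    using B_nonneg p_pos assms(2) by (intro mult_left_mono weight_near) auto
  finally show ?thesis by simp
qed

text \<open>
  The integral of \<open>x\<^sup>\<alpha> D\<^sub>w F\<close> does not change when the integrand is translated in direction \<open>i\<close>. Differentiating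
  under the integral sign, the integral of \<open>\<partial>\<^sub>i (x\<^sup>\<alpha> D\<^sub>w F)\<close> vanishes.
\<close>

lemma integral_by_parts:
  assumes len: "length is < k" and \<alpha>: "real (mi_abs \<alpha>) < p - real CARD('n)"
  shows "(LBINT x. mi_power x \<alpha> * word_deriv (i # is) F x)
    = - real (\<alpha> i) * (LBINT x. mi_power x (\<alpha>(i := \<alpha> i - 1)) * word_deriv is F x)"
proof -
  let ?h = "word_deriv is F" and ?e = "axis i 1 :: real ^ 'n" and ?a = "real (mi_abs \<alpha>)"
  define \<beta> where "\<beta> = \<alpha>(i := \<alpha> i - 1)"
  define f where "f y = mi_power y \<alpha> * ?h y" for y
  define f' where "f' y = real (\<alpha> i) * (mi_power y \<beta> * ?h y) + mi_power y \<alpha> * partial i ?h y" for y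
  have C: "Ck_on (Suc 0) UNIV ?h"
    by (rule Ck_on_word_deriv) (rule Ck_on_le[OF Ck], use len in simp)
  have [measurable]: "?h \<in> borel_measurable borel" "partial i ?h \<in> borel_measurable borel"
    using measurable_word_deriv[of "is"] measurable_word_deriv[of "i # is"] len by auto
  have \<beta>_le: "mi_abs \<beta> \<le> mi_abs \<alpha>" unfolding mi_abs_def by (intro sum_mono) (simp add: \<beta>_def)
  have int: "integrable lborel f" "integrable lborel (\<lambda>y. mi_power y \<beta> * ?h y)"
      "integrable lborel (\<lambda>y. mi_power y \<alpha> * partial i ?h y)"
    unfolding f_def using len \<alpha> \<beta>_le integrable_mi_power_word[of "is"] integrable_mi_power_word[of "i # is" \<alpha>] by auto
  have dm: "((\<lambda>s. mi_power (x + s *\<^sub>R ?e) \<alpha>) has_real_derivative real (\<alpha> i) * mi_power (x + s *\<^sub>R ?e) \<beta>) (at s)" for x s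
  proof -
    let ?R = "\<Prod>j\<in>UNIV - {i}. (x $ j) ^ \<alpha> j"
    have split: "mi_power (x + s *\<^sub>R ?e) \<gamma> = (x $ i + s) ^ \<gamma> i * ?R" if "\<And>j. j \<noteq> i \<Longrightarrow> \<gamma> j = \<alpha> j" for \<gamma> s
      unfolding mi_power_def prod.remove[OF finite UNIV_I[of i]]
      by (intro arg_cong2[where f = "(*)"] prod.cong) (auto simp: axis_def that)
    have "((\<lambda>s. (x $ i + s) ^ \<alpha> i * ?R) has_real_derivative real (\<alpha> i) * ((x $ i + s) ^ (\<alpha> i - 1) * ?R)) (at s)"
      by (auto intro!: derivative_eq_intros)
    then show ?thesis
      by (simp add: split \<beta>_def)
  qed
  let ?w = "\<lambda>x :: real ^ 'n. (real (\<alpha> i) + 1) * B * 2 powr (p - ?a) * weight (?a - p) x"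
  have "((\<lambda>s. LBINT x. f (x + s *\<^sub>R ?e)) has_real_derivative (LBINT x. f' (x + 0 *\<^sub>R ?e))) (at 0)"
  proof (rule DERIV_lebesgue_integral[where w = ?w])
    show "integrable lborel (\<lambda>x. f (x + s *\<^sub>R ?e))" for s
      using integrable_shift[OF int(1), of "- (s *\<^sub>R ?e)"] by simp
    show "integrable lborel ?w" using integrable_weight[OF \<alpha>] by (rule integrable_mult_right)
    show "((\<lambda>s. f (x + s *\<^sub>R ?e)) has_real_derivative f' (x + s *\<^sub>R ?e)) (at s)" for s x
      using DERIV_mult[OF dm has_real_derivative_partial[OF C]] unfolding f_def f'_def
      by (simp add: mult_ac add.commute)
    show "\<bar>f' (x + s *\<^sub>R ?e)\<bar> \<le> ?w x" if s: "\<bar>s\<bar> < 1" for s x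
    proof -
      let ?y = "x + s *\<^sub>R ?e"
      have "\<bar>mi_power ?y \<beta> * ?h ?y\<bar> \<le> B * weight (?a - p) ?y" "\<bar>mi_power ?y \<alpha> * partial i ?h ?y\<bar> \<le> B * weight (?a - p) ?y"
        using abs_mi_power_word_le[of "is" \<beta> ?a ?y] abs_mi_power_word_le[of "i # is" \<alpha> ?a ?y] len \<beta>_le by auto
      then have "\<bar>f' ?y\<bar> \<le> real (\<alpha> i) * (B * weight (?a - p) ?y) + B * weight (?a - p) ?y"
        unfolding f'_def by (intro order_trans[OF abs_triangle_ineq] add_mono) (simp_all add: abs_mult mult_left_mono)
      also have "\<dots> = (real (\<alpha> i) + 1) * B * weight (- (p - ?a)) ?y" by (simp add: algebra_simps)
      also have "\<dots> \<le> (real (\<alpha> i) + 1) * B * (2 powr (p - ?a) * weight (- (p - ?a)) x)"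
        using s \<alpha> B_nonneg by (intro mult_left_mono weight_near) auto
      finally show ?thesis by (simp add: mult.assoc)
    qed
    show "(\<lambda>x. f' (x + 0 *\<^sub>R ?e)) \<in> borel_measurable lborel" unfolding f'_def by measurable
  qed
  moreover have "(LBINT x. f (x + s *\<^sub>R ?e)) = (LBINT x. f x)" for s
    using integral_shift[of f "- (s *\<^sub>R ?e)"] int(1) by simp
  ultimately have "((\<lambda>s. LBINT x. f x) has_real_derivative (LBINT x. f' x)) (at 0)" by simp
  from DERIV_unique[OF this DERIV_const] have "(LBINT x. f' x) = 0" .
  then show ?thesis
    using int unfolding f'_def \<beta>_def by simp
qed

text \<open>
  Each integration by parts removes a letter \<open>i\<close> from the word and one factor \<open>x\<^sub>i\<close> from the monomial. If the
  word contains a letter more often than the monomial does, the monomial is killed; if both match exactly,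
  the factors \<open>-\<alpha>\<^sub>i\<close> multiply up to \<open>(-1)\<^bsup>|\<alpha>|\<^esup> \<alpha>!\<close>. The matrix of moments is thus triangular.
\<close>

lemma moment_word_deriv:
  assumes "length is \<le> k" "real (mi_abs \<alpha>) < p - real CARD('n)"
  shows moment_word_deriv_eq_0: "\<not> count (mset is) \<le> \<alpha> \<Longrightarrow> (LBINT x. mi_power x \<alpha> * word_deriv is F x) = 0"
    and moment_word_deriv_diag: "count (mset is) = \<alpha> \<Longrightarrow>
      (LBINT x. mi_power x \<alpha> * word_deriv is F x) = (- 1) ^ mi_abs \<alpha> * mi_fact \<alpha> * (LBINT x. F x)"
proof -
  have "(\<not> count (mset is) \<le> \<alpha> \<longrightarrow> (LBINT x. mi_power x \<alpha> * word_deriv is F x) = 0) \<and>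
     (count (mset is) = \<alpha> \<longrightarrow>
      (LBINT x. mi_power x \<alpha> * word_deriv is F x) = (- 1) ^ mi_abs \<alpha> * mi_fact \<alpha> * (LBINT x. F x))"
    using assms
  proof (induction "is" arbitrary: \<alpha>)
    case Nil
    then show ?case by (auto simp: le_fun_def mi_power_def mi_abs_def mi_fact_def)
  next
    case (Cons i "is")
    define b where "b = \<alpha>(i := \<alpha> i - 1)"
    have "mi_abs b \<le> mi_abs \<alpha>" unfolding mi_abs_def by (intro sum_mono) (auto simp: b_def)
    with Cons.prems have \<beta>: "real (mi_abs b) < p - real CARD('n)" by linarith
    note IH = Cons.IH[OF _ \<beta>]
    have parts: "(LBINT x. mi_power x \<alpha> * word_deriv (i # is) F x)
      = - real (\<alpha> i) * (LBINT x. mi_power x b * word_deriv is F x)"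
      using Cons.prems unfolding b_def by (intro integral_by_parts) auto
    show ?case
    proof (intro conjI impI)
      assume n: "\<not> count (mset (i # is)) \<le> \<alpha>"
      show "(LBINT x. mi_power x \<alpha> * word_deriv (i # is) F x) = 0"
      proof (cases "\<alpha> i = 0")
        case False
        from n obtain j where "\<not> count (mset (i # is)) j \<le> \<alpha> j" by (auto simp: le_fun_def)
        then have "\<not> count (mset is) j \<le> b j" using False by (auto simp: b_def split: if_splits)
        then have "\<not> count (mset is) \<le> b" by (metis le_funD)
        then show ?thesis using IH Cons.prems parts by simp
      qed (use parts in simp)
    next
      assume e: "count (mset (i # is)) = \<alpha>"
      then have \<alpha>i: "\<alpha> i = Suc (count (mset is) i)" by auto
      have \<beta>e: "count (mset is) = b" unfolding b_def e[symmetric] by (rule ext) simp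
      have abs: "mi_abs \<alpha> = Suc (mi_abs b)"
        using length_eq_mi_abs_count[of "i # is"] length_eq_mi_abs_count[of "is"] e \<beta>e by simp
      have "mi_fact \<alpha> = fact (\<alpha> i) * (\<Prod>j\<in>UNIV - {i}. fact (\<alpha> j))"
        unfolding mi_fact_def by (simp add: prod.remove[of UNIV i])
      also have "(\<Prod>j\<in>UNIV - {i}. fact (\<alpha> j)) = (\<Prod>j\<in>UNIV - {i}. fact (b j) :: real)"
        by (intro prod.cong) (auto simp: b_def)
      also have "fact (\<alpha> i) = real (\<alpha> i) * fact (b i)" by (simp add: b_def \<alpha>i)
      finally have "mi_fact \<alpha> = real (\<alpha> i) * mi_fact b"
        unfolding mi_fact_def by (simp add: prod.remove[of UNIV i] mult.assoc)
      then show "(LBINT x. mi_power x \<alpha> * word_deriv (i # is) F x) = (- 1) ^ mi_abs \<alpha> * mi_fact \<alpha> * (LBINT x. F x)"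
        using IH \<beta>e Cons.prems parts abs by simp
    qed
  qed
  then show "\<not> count (mset is) \<le> \<alpha> \<Longrightarrow> (LBINT x. mi_power x \<alpha> * word_deriv is F x) = 0"
    and "count (mset is) = \<alpha> \<Longrightarrow>
      (LBINT x. mi_power x \<alpha> * word_deriv is F x) = (- 1) ^ mi_abs \<alpha> * mi_fact \<alpha> * (LBINT x. F x)"
    by auto
qed

end

section \<open>Convolution with a rescaled profile\<close>

lemma integral_scale:
  fixes f :: "'a::euclidean_space \<Rightarrow> real"
  assumes [measurable]: "f \<in> borel_measurable borel" and r: "r > 0"
  shows "(LBINT x. f (x /\<^sub>R r)) = r ^ DIM('a) * (LBINT x. f x)"
proof -
  let ?c = "inverse r"
  have eq: "(lborel :: 'a measure) = density (distr lborel borel (\<lambda>x. 0 + ?c *\<^sub>R x)) (\<lambda>_. ennreal (\<bar>?c\<bar> ^ DIM('a)))"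
    by (rule lborel_affine) (use r in simp)
  have "(LBINT x. f x) = (\<integral>x. f x \<partial>density (distr lborel borel (\<lambda>x. 0 + ?c *\<^sub>R x)) (\<lambda>_. ennreal (\<bar>?c\<bar> ^ DIM('a))))"
    by (simp only: eq[symmetric])
  also have "\<dots> = (\<integral>x. \<bar>?c\<bar> ^ DIM('a) *\<^sub>R f x \<partial>distr lborel borel (\<lambda>x. 0 + ?c *\<^sub>R x))"
    by (rule integral_density) auto
  also have "\<dots> = (LBINT x. \<bar>?c\<bar> ^ DIM('a) *\<^sub>R f (0 + ?c *\<^sub>R x))"
    by (rule integral_distr) measurable
  also have "\<dots> = ?c ^ DIM('a) * (LBINT x. f (x /\<^sub>R r))"
    using r by simp
  finally show ?thesis using r by (simp add: power_inverse field_simps)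
qed

lemma DERIV_scaled:
  fixes h :: "real ^ 'n::finite \<Rightarrow> real"
  assumes h: "Ck_on (Suc 0) UNIV h"
  shows "((\<lambda>s. h ((x + s *\<^sub>R axis i 1) /\<^sub>R r)) has_real_derivative partial i h (x /\<^sub>R r) / r) (at 0)"
proof -
  have "((\<lambda>u. h (x /\<^sub>R r + u *\<^sub>R axis i 1)) has_real_derivative partial i h (x /\<^sub>R r)) (at (0 / r))"
    using has_real_derivative_partial[OF h, of "x /\<^sub>R r" i 0] by simp
  moreover have "((\<lambda>s. s / r) has_real_derivative 1 / r) (at 0)"
    by (rule DERIV_cdivide) (rule DERIV_ident)
  ultimately have "((\<lambda>s. h (x /\<^sub>R r + (s / r) *\<^sub>R axis i 1)) has_real_derivative partial i h (x /\<^sub>R r) * (1 / r)) (at 0)"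
    by (rule DERIV_chain2)
  then show ?thesis by (simp add: scaleR_add_right divide_inverse mult.commute)
qed

lemma abs_divide_fact_le: "\<bar>a / fact n\<bar> \<le> \<bar>a :: real\<bar>"
proof -
  have "\<bar>a\<bar> / fact n \<le> \<bar>a\<bar> / 1" by (intro divide_left_mono fact_ge_1) auto
  then show ?thesis by (simp add: abs_divide)
qed

context decaying_profile
begin

text \<open>
  With \<open>r = t\<^sup>1\<^sup>/\<^sup>d\<close> this is the kernel at time \<open>t\<close>. All estimates are made in terms of the length \<open>r\<close>.
\<close>

definition scaled :: "real \<Rightarrow> real ^ 'n \<Rightarrow> real" where
  "scaled r x = F (x /\<^sub>R r) / r ^ CARD('n)"

lemma word_deriv_scaled:
  assumes "length is \<le> k"
  shows "word_deriv is (scaled r) x = word_deriv is F (x /\<^sub>R r) / r ^ (CARD('n) + length is)"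
  using assms
proof (induction "is" arbitrary: x)
  case (Cons i "is")
  have C: "Ck_on (Suc 0) UNIV (word_deriv is F)"
    by (rule Ck_on_word_deriv) (rule Ck_on_le[OF Ck], use Cons.prems in simp)
  have "word_deriv is (scaled r) = (\<lambda>x. word_deriv is F (x /\<^sub>R r) / r ^ (CARD('n) + length is))"
    using Cons by (intro ext) auto
  then have "word_deriv (i # is) (scaled r) x
      = partial i (\<lambda>x. word_deriv is F (x /\<^sub>R r) / r ^ (CARD('n) + length is)) x" by simp
  also have "\<dots> = partial i (word_deriv is F) (x /\<^sub>R r) / r / r ^ (CARD('n) + length is)"
    unfolding dir_deriv_def[of _ "\<lambda>x. word_deriv is F (x /\<^sub>R r) / r ^ (CARD('n) + length is)"]
    by (rule DERIV_imp_deriv) (rule DERIV_cdivide[OF DERIV_scaled[OF C]])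
  finally show ?case by (simp add: mult.commute)
qed (simp add: scaled_def)

lemma Ck_on_scaled: "Ck_on k UNIV (scaled r)"
proof (rule Ck_onI)
  have eq: "word_deriv is (scaled r) = (\<lambda>x. word_deriv is F (x /\<^sub>R r) / r ^ (CARD('n) + length is))"
    if "length is \<le> k" for "is"
    by (rule ext) (rule word_deriv_scaled[OF that])
  show "continuous_on UNIV (word_deriv is (scaled r))" if "length is \<le> k" for "is"
    unfolding eq[OF that] divide_inverse
    by (intro continuous_on_mult continuous_on_const continuous_on_compose2[OF Ck_onD_continuous[OF Ck that]] continuous_intros) auto
  show "(\<lambda>s. word_deriv is (scaled r) (x + s *\<^sub>R axis i 1)) differentiable (at 0)" if "length is < k" for "is" i x
  proof -
    have C: "Ck_on (Suc 0) UNIV (word_deriv is F)"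
      by (rule Ck_on_word_deriv) (rule Ck_on_le[OF Ck], use that in simp)
    have "((\<lambda>s. word_deriv is F ((x + s *\<^sub>R axis i 1) /\<^sub>R r) / r ^ (CARD('n) + length is)) has_real_derivative
        partial i (word_deriv is F) (x /\<^sub>R r) / r / r ^ (CARD('n) + length is)) (at 0)"
      by (rule DERIV_cdivide[OF DERIV_scaled[OF C]])
    then show ?thesis
      unfolding eq[OF less_imp_le[OF that]] real_differentiable_def by blast
  qed
qed

lemma measurable_scaled [measurable]: "scaled r \<in> borel_measurable borel"
  unfolding scaled_def[abs_def] by measurable

lemma scaled_decay:
  assumes "r > 0" "length is \<le> k"
  shows "\<bar>word_deriv is (scaled r) x\<bar> \<le> B / r ^ (CARD('n) + length is) * weight (- p) (x /\<^sub>R r)"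
  using decay[OF assms(2), of "x /\<^sub>R r"] assms
  by (simp add: word_deriv_scaled abs_divide divide_simps)

lemma scaled_bounded_word:
  assumes "r > 0" "length is \<le> k"
  shows "\<bar>word_deriv is (scaled r) x\<bar> \<le> B / r ^ (CARD('n) + length is)"
proof -
  have "weight (- p) (x /\<^sub>R r) \<le> 1"
    using p_pos powr_mono[of "- p" 0 "1 + norm (x /\<^sub>R r)"] by (simp split: if_splits)
  then have "B / r ^ (CARD('n) + length is) * weight (- p) (x /\<^sub>R r) \<le> B / r ^ (CARD('n) + length is) * 1"
    using B_nonneg assms(1) by (intro mult_left_mono) auto
  then show ?thesis using scaled_decay[OF assms, of x] by linarith
qed

lemma scaled_bounded:
  assumes "r > 0" "length is \<le> k"
  shows "\<bar>word_deriv is (scaled r) x\<bar> \<le> (\<Sum>j\<le>k. B / r ^ (CARD('n) + j))"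
proof -
  have "B / r ^ (CARD('n) + length is) \<le> (\<Sum>j\<le>k. B / r ^ (CARD('n) + j))"
    using assms B_nonneg by (intro member_le_sum) auto
  then show ?thesis using scaled_bounded_word[OF assms, of x] by linarith
qed

lemma integrable_scaled:
  assumes r: "r > 0"
  shows "integrable lborel (scaled r)"
proof (rule integrableI_bounded)
  have "(\<integral>\<^sup>+x. ennreal (norm (scaled r x)) \<partial>lborel)
      = (\<integral>\<^sup>+x. (\<lambda>x. ennreal (norm (F x) / r ^ CARD('n))) (x /\<^sub>R r) \<partial>lborel)"
    using r by (simp add: scaled_def)
  also have "\<dots> = ennreal (r ^ DIM(real ^ 'n)) * (\<integral>\<^sup>+x. ennreal (norm (F x) / r ^ CARD('n)) \<partial>lborel)"
    by (rule nn_integral_scale) (use r in measurable)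
  also have "\<dots> < \<infinity>"
  proof -
    have "integrable lborel (\<lambda>x. norm (F x) / r ^ CARD('n))"
      using integrable_F by (intro integrable_divide integrable_norm)
    then have "(\<integral>\<^sup>+x. ennreal (norm (norm (F x) / r ^ CARD('n))) \<partial>lborel) < \<infinity>"
      by (simp only: integrable_iff_bounded)
    then show ?thesis using r by (simp add: ennreal_mult_less_top)
  qed
  finally show "(\<integral>\<^sup>+x. ennreal (norm (scaled r x)) \<partial>lborel) < \<infinity>" .
qed measurable

lemma integral_scaled: "r > 0 \<Longrightarrow> (LBINT x. scaled r x) = (LBINT x. F x)"
  unfolding scaled_def using integral_scale[OF measurable_F, of r] by simp

lemma word_deriv_conv_scaled:
  assumes "r > 0" "integrable lborel h" "length is \<le> k"
  shows "word_deriv is (conv (scaled r) h) = conv (word_deriv is (scaled r)) h"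
  by (rule word_deriv_conv[OF Ck_on_scaled scaled_bounded assms(2,3)]) (use assms in auto)

lemma Ck_on_conv_scaled:
  assumes "r > 0" "integrable lborel h"
  shows "Ck_on k UNIV (conv (scaled r) h)"
  by (rule Ck_on_conv[OF Ck_on_scaled scaled_bounded assms(2)]) (use assms in auto)

lemma abs_conv_le:
  fixes g h :: "real ^ 'n \<Rightarrow> real"
  assumes "integrable lborel (\<lambda>y. g (x - y) * h y)"
  shows "ennreal \<bar>conv g h x\<bar> \<le> (\<integral>\<^sup>+y. ennreal \<bar>g (x - y)\<bar> * ennreal \<bar>h y\<bar> \<partial>lborel)"
  using integral_norm_bound_ennreal[OF assms] by (simp add: conv_def abs_mult ennreal_mult)

lemma integrable_conv_kernel:
  assumes "r > 0" "integrable lborel h" "length is \<le> k"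
  shows "integrable lborel (\<lambda>y. word_deriv is (scaled r) (x - y) * h y)"
proof (rule conv_integrable[OF _ scaled_bounded[OF assms(1,3)] assms(2)])
  show "word_deriv is (scaled r) \<in> borel_measurable borel"
    using Ck_onD_continuous[OF Ck_on_scaled assms(3)] by (rule borel_measurable_continuous_onI)
qed

lemma conv_scaled_sup_le:
  assumes r: "r > 0" and h: "integrable lborel h" and l: "length is \<le> k"
  shows "ennreal \<bar>word_deriv is (conv (scaled r) h) x\<bar>
    \<le> ennreal (B / r ^ (CARD('n) + length is)) * l1norm h"
proof -
  have [measurable]: "h \<in> borel_measurable borel" using h by auto
  have "ennreal \<bar>word_deriv is (conv (scaled r) h) x\<bar>
      \<le> (\<integral>\<^sup>+y. ennreal \<bar>word_deriv is (scaled r) (x - y)\<bar> * ennreal \<bar>h y\<bar> \<partial>lborel)"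
    unfolding word_deriv_conv_scaled[OF assms] by (rule abs_conv_le) (rule integrable_conv_kernel[OF assms])
  also have "\<dots> \<le> (\<integral>\<^sup>+y. ennreal (B / r ^ (CARD('n) + length is)) * ennreal \<bar>h y\<bar> \<partial>lborel)"
    by (intro nn_integral_mono mult_right_mono ennreal_leI scaled_bounded_word r l) auto
  also have "\<dots> = ennreal (B / r ^ (CARD('n) + length is)) * l1norm h"
    by (rule nn_integral_cmult) measurable
  finally show ?thesis .
qed

text \<open>
  The weight lives on a length \<open>\<sigma>\<close> that is at least the length \<open>r\<close> of the kernel, so that the part of the
  weight that falls on the kernel is harmless after rescaling. For large times \<open>\<sigma> = r\<close> is used, for small
  times \<open>\<sigma> = 1\<close>.
\<close>

lemma conv_scaled_weight_le:
  assumes r: "0 < r" "r \<le> \<sigma>" and h: "integrable lborel h" and l: "length is \<le> k"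
    and K: "0 \<le> K" "K < p - real CARD('n)"
  shows "swnorm \<sigma> K (word_deriv is (conv (scaled r) h))
    \<le> ennreal (B * weight_mass K / r ^ length is) * swnorm \<sigma> K h"
proof -
  have [measurable]: "h \<in> borel_measurable borel" using h by auto
  define b where "b = B / r ^ (CARD('n) + length is)"
  have b: "b \<ge> 0" using B_nonneg r by (simp add: b_def)
  have "swnorm \<sigma> K (word_deriv is (conv (scaled r) h))
    \<le> (\<integral>\<^sup>+x. (\<integral>\<^sup>+y. ennreal (b * weight (- p) ((x - y) /\<^sub>R r)) * ennreal \<bar>h y\<bar> \<partial>lborel)
          * ennreal (weight K (x /\<^sub>R \<sigma>)) \<partial>lborel)"
  proof (rule nn_integral_mono)
    fix x
    have "ennreal \<bar>word_deriv is (conv (scaled r) h) x\<bar>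
        \<le> (\<integral>\<^sup>+y. ennreal \<bar>word_deriv is (scaled r) (x - y)\<bar> * ennreal \<bar>h y\<bar> \<partial>lborel)"
      unfolding word_deriv_conv_scaled[OF r(1) h l] by (rule abs_conv_le) (rule integrable_conv_kernel[OF r(1) h l])
    also have "\<dots> \<le> (\<integral>\<^sup>+y. ennreal (b * weight (- p) ((x - y) /\<^sub>R r)) * ennreal \<bar>h y\<bar> \<partial>lborel)"
      unfolding b_def by (intro nn_integral_mono mult_right_mono ennreal_leI scaled_decay r l) auto
    finally show "ennreal (\<bar>word_deriv is (conv (scaled r) h) x\<bar> * weight K (x /\<^sub>R \<sigma>))
      \<le> (\<integral>\<^sup>+y. ennreal (b * weight (- p) ((x - y) /\<^sub>R r)) * ennreal \<bar>h y\<bar> \<partial>lborel)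
          * ennreal (weight K (x /\<^sub>R \<sigma>))"
      by (subst ennreal_mult) (auto intro!: mult_right_mono)
  qed
  also have "\<dots> \<le> (\<integral>\<^sup>+x. ennreal (b * weight (- p) (x /\<^sub>R r :: real ^ 'n)) * ennreal (weight K (x /\<^sub>R r)) \<partial>lborel)
      * (\<integral>\<^sup>+y. ennreal \<bar>h y\<bar> * ennreal (weight K (y /\<^sub>R \<sigma>)) \<partial>lborel)"
  proof (rule nn_conv_weight[where k = "\<lambda>x. ennreal (b * weight (- p) (x /\<^sub>R r))"
        and h = "\<lambda>y. ennreal \<bar>h y\<bar>" and a = "\<lambda>x. ennreal (weight K (x /\<^sub>R r))"
        and b = "\<lambda>y. ennreal (weight K (y /\<^sub>R \<sigma>))" and c = "\<lambda>x. ennreal (weight K (x /\<^sub>R \<sigma>))"])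
    fix x y :: "real ^ 'n"
    have "weight K ((x + y) /\<^sub>R \<sigma>) \<le> weight K (x /\<^sub>R \<sigma>) * weight K (y /\<^sub>R \<sigma>)"
      using weight_add_le[OF K(1), of "x /\<^sub>R \<sigma>" "y /\<^sub>R \<sigma>"] by (simp add: scaleR_add_right)
    also have "\<dots> \<le> weight K (x /\<^sub>R r) * weight K (y /\<^sub>R \<sigma>)"
    proof (intro mult_right_mono powr_mono2 K(1))
      have "inverse \<sigma> \<le> inverse r" using r by (intro le_imp_inverse_le)
      then show "1 + norm (x /\<^sub>R \<sigma>) \<le> 1 + norm (x /\<^sub>R r)" using r by (auto intro!: mult_right_mono)
    qed auto
    finally show "ennreal (weight K ((x + y) /\<^sub>R \<sigma>))
        \<le> ennreal (weight K (x /\<^sub>R r)) * ennreal (weight K (y /\<^sub>R \<sigma>))"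
      by (subst ennreal_mult[symmetric]) (auto intro!: ennreal_leI)
  qed measurable
  also have "(\<integral>\<^sup>+x. ennreal (b * weight (- p) (x /\<^sub>R r :: real ^ 'n)) * ennreal (weight K (x /\<^sub>R r)) \<partial>lborel)
      = (\<integral>\<^sup>+x. (\<lambda>x :: real ^ 'n. ennreal b * ennreal (weight (K - p) x)) (x /\<^sub>R r) \<partial>lborel)"
  proof (rule nn_integral_cong)
    fix x :: "real ^ 'n"
    let ?u = "1 + norm (x /\<^sub>R r)"
    have "?u powr (- p) * ?u powr K = ?u powr (K - p)" by (simp only: powr_add[symmetric]) simp
    then have "b * ?u powr (- p) * ?u powr K = b * ?u powr (K - p)" by simp
    then show "ennreal (b * ?u powr (- p)) * ennreal (?u powr K) = ennreal b * ennreal (?u powr (K - p))"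
      using b by (simp only: ennreal_mult[symmetric] mult_nonneg_nonneg powr_ge_zero)
  qed
  also have "\<dots> = ennreal (r ^ DIM(real ^ 'n)) * (\<integral>\<^sup>+x. ennreal b * ennreal (weight (K - p) (x :: real ^ 'n)) \<partial>lborel)"
    by (rule nn_integral_scale) (use r in measurable)
  also have "\<dots> = ennreal (r ^ CARD('n)) * (ennreal b * ennreal (weight_mass K))"
    by (subst nn_integral_cmult) (auto simp: nn_weight_mass[OF K(2)])
  also have "\<dots> = ennreal (r ^ CARD('n) * (b * weight_mass K))"
    using r b weight_mass_nonneg by (simp only: ennreal_mult[symmetric] mult_nonneg_nonneg zero_le_power less_imp_le)
  also have "r ^ CARD('n) * (b * weight_mass K) = B * weight_mass K / r ^ length is"
    using r by (simp add: b_def power_add)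
  also have "(\<integral>\<^sup>+y. ennreal \<bar>h y\<bar> * ennreal (weight K (y /\<^sub>R \<sigma>)) \<partial>lborel)
      = swnorm \<sigma> K h"
    by (simp add: ennreal_mult)
  finally show ?thesis .
qed

section \<open>The Taylor remainder of the profile\<close>

definition taylor_rem :: "nat \<Rightarrow> real ^ 'n \<Rightarrow> real ^ 'n \<Rightarrow> real" where
  "taylor_rem m x z = F (x - z) - (\<Sum>j\<le>m. line_deriv j (- z) F x / fact j)"

lemma line_deriv_monomials:
  "line_deriv j (c *\<^sub>R z) F x = (\<Sum>is | length is = j. c ^ j * word_deriv is F x * mi_power z (count (mset is)))"
  unfolding line_deriv_def by (intro sum.cong) (auto simp: mi_power_eq_prod_list)

lemma measurable_taylor_rem:
  assumes "m \<le> k"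
  shows "(\<lambda>(x, z). taylor_rem m x z) \<in> borel_measurable (borel \<Otimes>\<^sub>M borel)"
proof -
  have eq: "line_deriv j (- z) F x = (\<Sum>is | length is = j. (- 1) ^ j * word_deriv is F x * mi_power z (count (mset is)))" for j x z
    using line_deriv_monomials[of j "- 1" z x] by simp
  have meas: "(\<lambda>p. word_deriv is F (fst p)) \<in> borel_measurable (borel \<Otimes>\<^sub>M borel)"
    if "length is \<le> k" for "is" :: "'n list"
    by (rule measurable_compose[OF measurable_fst measurable_word_deriv[OF that]])
  have "(\<lambda>p. F (fst p - snd p)) \<in> borel_measurable (borel \<Otimes>\<^sub>M borel)" by measurable
  then show ?thesis
    unfolding taylor_rem_def eq case_prod_unfold using assms
    by (intro borel_measurable_diff borel_measurable_sum borel_measurable_divide borel_measurable_times borel_measurable_const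
         measurable_compose[OF measurable_snd measurable_mi_power] meas) auto
qed

definition word_count :: "nat \<Rightarrow> real" where
  "word_count m = real (card {is :: 'n list. length is = m})"

lemma word_count_nonneg: "word_count m \<ge> 0" by (simp add: word_count_def)

text \<open>
  One derivative more than \<open>m\<close> gains the power \<open>Suc m > K\<close> of \<open>z\<close>; for \<open>|z| \<le> 1\<close> the intermediate point of
  Taylor's formula stays within distance one of \<open>x\<close> and the decay in \<open>x\<close> survives.
\<close>

lemma taylor_rem_small:
  assumes "Suc m \<le> k" "norm z \<le> 1"
  shows "\<bar>taylor_rem m x z\<bar> \<le> word_count (Suc m) * B * 2 powr p * norm z ^ Suc m * weight (- p) x"
proof -
  from Taylor_along_line[OF Ck_on_le[OF Ck assms(1)], of x "- z"]
  obtain s where s: "0 < s" "s < 1" and eq: "F (x + (- z)) = (\<Sum>j\<le>m. line_deriv j (- z) F x / fact j)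
      + line_deriv (Suc m) (- z) F (x + s *\<^sub>R (- z)) / fact (Suc m)" by blast
  have "norm (s *\<^sub>R (- z)) \<le> 1 * 1"
    unfolding norm_scaleR using s assms(2) by (intro mult_mono) auto
  then have "\<bar>line_deriv (Suc m) (- z) F (x + s *\<^sub>R (- z))\<bar>
      \<le> word_count (Suc m) * norm (- z) ^ Suc m * (B * 2 powr p * weight (- p) x)"
    unfolding word_count_def using assms(1) by (intro abs_line_deriv_le decay_near) auto
  moreover have "\<bar>taylor_rem m x z\<bar> \<le> \<bar>line_deriv (Suc m) (- z) F (x + s *\<^sub>R (- z))\<bar>"
  proof -
    have "taylor_rem m x z = line_deriv (Suc m) (- z) F (x + s *\<^sub>R (- z)) / fact (Suc m)"
      using eq by (simp add: taylor_rem_def)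
    then show ?thesis by (simp only: abs_divide_fact_le)
  qed
  ultimately show ?thesis by (simp add: mult_ac del: power_Suc)
qed

text \<open>
  For \<open>|z| \<ge> 1\<close> nothing cancels: the remainder is estimated term by term, and the powers \<open>|z|\<^sup>j\<close> with
  \<open>j \<le> m \<le> K\<close> are at most \<open>|z|\<^sup>K\<close>.
\<close>

lemma taylor_rem_large:
  assumes "m \<le> k" "norm z \<ge> 1" "real m \<le> K"
  shows "\<bar>taylor_rem m x z\<bar> \<le> B * weight (- p) (x - z)
    + (\<Sum>j\<le>m. word_count j) * B * norm z powr K * weight (- p) x"
proof -
  have "\<bar>line_deriv j (- z) F x / fact j\<bar> \<le> word_count j * norm z powr K * (B * weight (- p) x)" if "j \<le> m" for j
  proof -
    have "\<bar>line_deriv j (- z) F x / fact j\<bar> \<le> \<bar>line_deriv j (- z) F x\<bar>"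
      by (rule abs_divide_fact_le)
    also have "\<dots> \<le> word_count j * norm (- z) ^ j * (B * weight (- p) x)"
      unfolding word_count_def using assms(1) that by (intro abs_line_deriv_le decay) auto
    also have "\<dots> \<le> word_count j * norm z powr K * (B * weight (- p) x)"
    proof (intro mult_right_mono mult_left_mono word_count_nonneg)
      have "norm (- z) ^ j = norm z powr (real j)"
        using assms(2) by (subst powr_realpow) auto
      also have "\<dots> \<le> norm z powr K" using assms that by (intro powr_mono) auto
      finally show "norm (- z) ^ j \<le> norm z powr K" .
    qed (use B_nonneg in auto)
    finally show ?thesis .
  qed
  then have "\<bar>\<Sum>j\<le>m. line_deriv j (- z) F x / fact j\<bar>
      \<le> (\<Sum>j\<le>m. word_count j * (B * norm z powr K * weight (- p) x))"
    by (intro order_trans[OF sum_abs] sum_mono) (simp add: mult_ac)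
  then have "\<bar>\<Sum>j\<le>m. line_deriv j (- z) F x / fact j\<bar>
      \<le> (\<Sum>j\<le>m. word_count j) * B * norm z powr K * weight (- p) x"
    by (simp only: sum_distrib_right[symmetric] mult.assoc)
  moreover have "\<bar>F (x - z)\<bar> \<le> B * weight (- p) (x - z)"
    using decay[of "[]" "x - z"] by simp
  ultimately show ?thesis unfolding taylor_rem_def by linarith
qed

end

section \<open>Cancellation\<close>

text \<open>
  What remains of a point mass at \<open>z\<close> (in units of the kernel length) after subtracting its Taylor polynomial
  of order \<open>\<lfloor>K\<rfloor>\<close>. It is at most \<open>|z|\<^sup>K\<close>, which gives the rate of decay, and strictly smaller than of order \<open>|z|\<^sup>K\<close>
  near zero, which gives the limit zero.
\<close>

definition cancel_weight :: "real \<Rightarrow> real ^ 'n::finite \<Rightarrow> real" where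
  "cancel_weight K z = min (norm z powr K) (norm z ^ Suc (nat \<lfloor>K\<rfloor>))"

lemma cancel_weight_nonneg: "cancel_weight K z \<ge> 0"
  by (simp add: cancel_weight_def)

lemma measurable_cancel_weight [measurable]: "cancel_weight K \<in> borel_measurable borel"
  unfolding cancel_weight_def[abs_def] by measurable

lemma floor_bounds:
  assumes "0 \<le> K"
  shows "real (nat \<lfloor>K\<rfloor>) \<le> K" "K < real (Suc (nat \<lfloor>K\<rfloor>))"
  using assms by (simp_all add: of_nat_nat) linarith

lemma cancel_weight_small:
  assumes "0 \<le> K" "norm z \<le> 1"
  shows "cancel_weight K z = norm z ^ Suc (nat \<lfloor>K\<rfloor>)"
proof (cases "z = 0")
  case False
  have "norm z ^ Suc (nat \<lfloor>K\<rfloor>) = norm z powr (real (Suc (nat \<lfloor>K\<rfloor>)))"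
    using False by (subst powr_realpow) auto
  also have "\<dots> \<le> norm z powr K"
    using assms False floor_bounds[of K] by (intro powr_mono') auto
  finally show ?thesis by (simp add: cancel_weight_def)
qed (simp add: cancel_weight_def)

lemma cancel_weight_large:
  assumes "0 \<le> K" "1 \<le> norm z"
  shows "cancel_weight K z = norm z powr K"
proof -
  have "norm z powr K \<le> norm z powr (real (Suc (nat \<lfloor>K\<rfloor>)))"
    using assms floor_bounds[of K] by (intro powr_mono) auto
  also have "\<dots> = norm z ^ Suc (nat \<lfloor>K\<rfloor>)"
    using assms by (subst powr_realpow) auto
  finally show ?thesis by (simp add: cancel_weight_def)
qed

lemma powr_mult_cancel_weight:
  assumes r: "r > 0"
  shows "r powr K * cancel_weight K (y /\<^sub>R r)
    = min (norm y powr K) (norm y ^ Suc (nat \<lfloor>K\<rfloor>) * r powr (K - real (Suc (nat \<lfloor>K\<rfloor>))))"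
proof -
  have n: "norm (y /\<^sub>R r) = norm y / r" using r by (simp add: divide_inverse mult.commute)
  have 1: "r powr K * (norm y / r) powr K = norm y powr K"
    using r by (simp add: powr_divide)
  have "r powr (real (Suc (nat \<lfloor>K\<rfloor>))) = r ^ Suc (nat \<lfloor>K\<rfloor>)" by (rule powr_realpow[OF r])
  then have 2: "r powr K * (norm y / r) ^ Suc (nat \<lfloor>K\<rfloor>)
      = norm y ^ Suc (nat \<lfloor>K\<rfloor>) * r powr (K - real (Suc (nat \<lfloor>K\<rfloor>)))"
    by (simp only: powr_diff power_divide) simp
  show ?thesis
    unfolding cancel_weight_def n 1[symmetric] 2[symmetric] by (rule min_mult_distrib_left[THEN trans]) (use r in simp)
qed

text \<open>
  An integrable function seen by a kernel of length \<open>r\<close> when all its moments of order up to \<open>K\<close> vanish.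
\<close>

definition cancel_mass :: "real \<Rightarrow> (real ^ 'n::finite \<Rightarrow> real) \<Rightarrow> real \<Rightarrow> ennreal" where
  "cancel_mass K w r = (\<integral>\<^sup>+y. ennreal (cancel_weight K (y /\<^sub>R r) * \<bar>w y\<bar>) \<partial>lborel)"

lemma cancel_mass_le:
  fixes w :: "real ^ 'n::finite \<Rightarrow> real"
  assumes [measurable]: "w \<in> borel_measurable borel" and r: "r > 0" and K: "0 \<le> K"
  shows "cancel_mass K w r \<le> ennreal (r powr (- K)) * wnorm K w"
proof -
  have "cancel_weight K (y /\<^sub>R r) \<le> r powr (- K) * weight K y" for y :: "real ^ 'n"
  proof -
    have "r powr K * cancel_weight K (y /\<^sub>R r) \<le> norm y powr K" by (simp add: powr_mult_cancel_weight[OF r])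
    also have "\<dots> \<le> weight K y" using K by (intro powr_mono2) auto
    finally show ?thesis using r by (simp add: powr_minus field_simps)
  qed
  then have "cancel_mass K w r \<le> (\<integral>\<^sup>+y. ennreal (r powr (- K)) * ennreal (\<bar>w y\<bar> * weight K y) \<partial>lborel)"
    unfolding cancel_mass_def
    by (intro nn_integral_mono, subst ennreal_mult[symmetric])
       (auto intro!: ennreal_leI simp: mult.left_commute[of _ "\<bar>_\<bar>"] mult.commute[of "cancel_weight _ _"] mult_left_mono)
  also have "\<dots> = ennreal (r powr (- K)) * wnorm K w"
    by (rule nn_integral_cmult) measurable
  finally show ?thesis .
qed

text \<open>
  After multiplication by \<open>r\<^sup>K\<close> the weight is dominated by \<open>|y|\<^sup>K\<close> and tends to zero at every \<open>y\<close>, because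
  \<open>K < \<lfloor>K\<rfloor> + 1\<close>.
\<close>

lemma cancel_mass_tendsto_0:
  fixes w :: "real ^ 'n::finite \<Rightarrow> real"
  assumes w[measurable]: "w \<in> borel_measurable borel" and K: "0 \<le> K"
    and fin: "wnorm K w < \<infinity>"
  shows "((\<lambda>r. ennreal (r powr K) * cancel_mass K w r) \<longlongrightarrow> 0) at_top"
proof (rule tendsto_at_topI_sequentially)
  fix X :: "nat \<Rightarrow> real" assume X: "filterlim X at_top sequentially"
  define u where "u n y = \<bar>w y\<bar> * min (norm y powr K) (norm y ^ Suc (nat \<lfloor>K\<rfloor>) * X n powr (K - real (Suc (nat \<lfloor>K\<rfloor>))))" for n y
  have u0: "0 \<le> u n y" for n y by (simp add: u_def)
  have "(\<lambda>n. \<integral>\<^sup>+y. ennreal (u n y) \<partial>lborel) \<longlonglongrightarrow> (\<integral>\<^sup>+y. ennreal 0 \<partial>(lborel :: (real ^ 'n) measure))"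
  proof (rule nn_integral_dominated_convergence[where w = "\<lambda>y. ennreal (\<bar>w y\<bar> * weight K y)"])
    show "(\<lambda>y. ennreal (u n y)) \<in> borel_measurable lborel" for n unfolding u_def by measurable
    show "AE y in lborel. ennreal (u n y) \<le> ennreal (\<bar>w y\<bar> * weight K y)" for n
    proof (rule AE_I2)
      fix y :: "real ^ 'n"
      have "min (norm y powr K) (norm y ^ Suc (nat \<lfloor>K\<rfloor>) * X n powr (K - real (Suc (nat \<lfloor>K\<rfloor>)))) \<le> norm y powr K" by simp
      also have "\<dots> \<le> weight K y" using K by (intro powr_mono2) auto
      finally show "ennreal (u n y) \<le> ennreal (\<bar>w y\<bar> * weight K y)"
        unfolding u_def by (intro ennreal_leI mult_left_mono) auto
    qed
    show "AE y in lborel. (\<lambda>n. ennreal (u n y)) \<longlonglongrightarrow> ennreal 0"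
    proof (rule AE_I2)
      fix y :: "real ^ 'n"
      have "(\<lambda>n. X n powr (K - real (Suc (nat \<lfloor>K\<rfloor>)))) \<longlonglongrightarrow> 0"
        using floor_bounds(2)[OF K] by (intro tendsto_neg_powr X) simp
      then have "(\<lambda>n. u n y) \<longlonglongrightarrow> \<bar>w y\<bar> * min (norm y powr K) (norm y ^ Suc (nat \<lfloor>K\<rfloor>) * 0)"
        unfolding u_def by (intro tendsto_mult tendsto_min tendsto_const)
      then have "(\<lambda>n. u n y) \<longlonglongrightarrow> 0" by simp
      then show "(\<lambda>n. ennreal (u n y)) \<longlonglongrightarrow> ennreal 0" by (rule tendsto_ennrealI)
    qed
  qed (use fin in measurable)
  then have "(\<lambda>n. \<integral>\<^sup>+y. ennreal (u n y) \<partial>lborel) \<longlonglongrightarrow> 0" by simp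
  moreover have "eventually (\<lambda>n. (\<integral>\<^sup>+y. ennreal (u n y) \<partial>lborel) = ennreal (X n powr K) * cancel_mass K w (X n)) sequentially"
  proof -
    have "eventually (\<lambda>n. X n > 0) sequentially"
      using X by (simp add: filterlim_at_top_dense)
    then show ?thesis
    proof eventually_elim
      fix n assume n: "X n > 0"
      have "ennreal (X n powr K) * cancel_mass K w (X n)
          = (\<integral>\<^sup>+y. ennreal (X n powr K) * ennreal (cancel_weight K (y /\<^sub>R X n) * \<bar>w y\<bar>) \<partial>lborel)"
        unfolding cancel_mass_def by (rule nn_integral_cmult[symmetric]) measurable
      also have "\<dots> = (\<integral>\<^sup>+y. ennreal (u n y) \<partial>lborel)"
      proof (rule nn_integral_cong)
        fix y :: "real ^ 'n"
        have "X n powr K * (cancel_weight K (y /\<^sub>R X n) * \<bar>w y\<bar>) = (X n powr K * cancel_weight K (y /\<^sub>R X n)) * \<bar>w y\<bar>" by simp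
        also have "\<dots> = u n y" unfolding powr_mult_cancel_weight[OF n] u_def by simp
        finally show "ennreal (X n powr K) * ennreal (cancel_weight K (y /\<^sub>R X n) * \<bar>w y\<bar>) = ennreal (u n y)"
          by (subst ennreal_mult[symmetric]) (auto simp: cancel_weight_nonneg)
      qed
      finally show "(\<integral>\<^sup>+y. ennreal (u n y) \<partial>lborel) = ennreal (X n powr K) * cancel_mass K w (X n)" by simp
    qed
  qed
  ultimately show "(\<lambda>n. ennreal (X n powr K) * cancel_mass K w (X n)) \<longlonglongrightarrow> 0"
    by (rule Lim_transform_eventually)
qed

context decaying_profile
begin

lemma weight_powr_combine: "weight (- p) (x :: real ^ 'n) * weight K x = weight (K - p) x"
  by (simp only: powr_add[symmetric]) simp

text \<open>
  The two regimes in one inequality. For large \<open>z\<close> the term \<open>F (x - z)\<close> is concentrated near \<open>z\<close>, and the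
  weight there is of size \<open>|z|\<^sup>K\<close>.
\<close>

lemma taylor_rem_weight_le:
  assumes K: "0 \<le> K" and m: "Suc (nat \<lfloor>K\<rfloor>) \<le> k"
  shows "\<exists>C\<ge>0. \<forall>x z. \<bar>taylor_rem (nat \<lfloor>K\<rfloor>) x z\<bar> * weight K x
    \<le> C * cancel_weight K z * (weight (K - p) x + weight (K - p) (x - z))"
proof -
  let ?m = "nat \<lfloor>K\<rfloor>"
  define c1 where "c1 = word_count (Suc ?m) * B * 2 powr p"
  define S where "S = (\<Sum>j\<le>?m. word_count j) * B"
  define C where "C = c1 + B * 2 powr K + S"
  have nn: "c1 \<ge> 0" "S \<ge> 0" "B * 2 powr K \<ge> 0"
    using B_nonneg word_count_nonneg by (auto simp: c1_def S_def intro!: mult_nonneg_nonneg sum_nonneg)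
  have mono: "c * cancel_weight K z * w \<le> C * cancel_weight K z * w" if "c \<le> C" "w \<ge> 0" for c w and z :: "real ^ 'n"
    using that cancel_weight_nonneg[of K z] by (intro mult_right_mono)
  have "\<bar>taylor_rem ?m x z\<bar> * weight K x \<le> C * cancel_weight K z * (weight (K - p) x + weight (K - p) (x - z))" for x z
  proof (cases "norm z \<le> 1")
    case True
    have "\<bar>taylor_rem ?m x z\<bar> * weight K x \<le> (c1 * cancel_weight K z * weight (- p) x) * weight K x"
      using taylor_rem_small[OF m True, of x] unfolding c1_def cancel_weight_small[OF K True] by (intro mult_right_mono) auto
    also have "\<dots> = c1 * cancel_weight K z * weight (K - p) x"
      by (simp only: mult.assoc weight_powr_combine)
    also have "\<dots> \<le> c1 * cancel_weight K z * (weight (K - p) x + weight (K - p) (x - z))"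
      using nn cancel_weight_nonneg[of K z] by (intro mult_left_mono) auto
    also have "\<dots> \<le> C * cancel_weight K z * (weight (K - p) x + weight (K - p) (x - z))"
      using nn by (intro mono) (auto simp: C_def)
    finally show ?thesis .
  next
    case False
    then have z: "1 \<le> norm z" by simp
    have "weight K x \<le> weight K (x - z) * weight K z"
      using weight_add_le[OF K, of "x - z" z] by simp
    also have "\<dots> \<le> weight K (x - z) * (2 * norm z) powr K"
      using z K by (intro mult_left_mono powr_mono2) auto
    also have "(2 * norm z) powr K = 2 powr K * cancel_weight K z"
      by (simp add: powr_mult cancel_weight_large[OF K z])
    finally have wt: "weight K x \<le> weight K (x - z) * (2 powr K * cancel_weight K z)" .
    have "\<bar>taylor_rem ?m x z\<bar> * weight K x
        \<le> (B * weight (- p) (x - z) + S * cancel_weight K z * weight (- p) x) * weight K x"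
      using taylor_rem_large[of ?m z K x] m z floor_bounds(1)[OF K]
      unfolding S_def cancel_weight_large[OF K z] by (intro mult_right_mono) auto
    also have "\<dots> = B * weight (- p) (x - z) * weight K x + S * cancel_weight K z * weight (K - p) x"
      by (simp only: distrib_right mult.assoc weight_powr_combine)
    also have "B * weight (- p) (x - z) * weight K x
        \<le> B * weight (- p) (x - z) * (weight K (x - z) * (2 powr K * cancel_weight K z))"
      using B_nonneg by (intro mult_left_mono wt) auto
    also have "\<dots> = B * (weight (- p) (x - z) * weight K (x - z)) * (2 powr K * cancel_weight K z)"
      by (simp only: mult.assoc)
    also have "\<dots> = B * 2 powr K * cancel_weight K z * weight (K - p) (x - z)"
      by (simp only: weight_powr_combine) (simp only: mult_ac)
    also have "\<dots> \<le> C * cancel_weight K z * weight (K - p) (x - z)"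
      using nn by (intro mono) (auto simp: C_def)
    also have "S * cancel_weight K z * weight (K - p) x \<le> C * cancel_weight K z * weight (K - p) x"
      using nn by (intro mono) (auto simp: C_def)
    finally show ?thesis by (simp add: distrib_left add.commute)
  qed
  moreover have "C \<ge> 0" using nn by (simp add: C_def)
  ultimately show ?thesis by blast
qed

lemma taylor_rem_integral_le:
  assumes K: "0 \<le> K" "K < p - real CARD('n)" and m: "Suc (nat \<lfloor>K\<rfloor>) \<le> k"
  shows "\<exists>C\<ge>0. \<forall>z. (\<integral>\<^sup>+x. ennreal (\<bar>taylor_rem (nat \<lfloor>K\<rfloor>) x z\<bar> * weight K x) \<partial>lborel) \<le> ennreal (C * cancel_weight K z)"
proof -
  obtain C where C: "C \<ge> 0" "\<And>x z. \<bar>taylor_rem (nat \<lfloor>K\<rfloor>) x z\<bar> * weight K x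
      \<le> C * cancel_weight K z * (weight (K - p) x + weight (K - p) (x - z))"
    using taylor_rem_weight_le[OF K(1) m] by blast
  have "(\<integral>\<^sup>+x. ennreal (\<bar>taylor_rem (nat \<lfloor>K\<rfloor>) x z\<bar> * weight K x) \<partial>lborel)
      \<le> ennreal (C * (2 * weight_mass K) * cancel_weight K z)" for z
  proof -
    let ?c = "C * cancel_weight K z"
    have c: "?c \<ge> 0" using C(1) cancel_weight_nonneg[of K z] by simp
    have "(\<integral>\<^sup>+x. ennreal (\<bar>taylor_rem (nat \<lfloor>K\<rfloor>) x z\<bar> * weight K x) \<partial>lborel)
        \<le> (\<integral>\<^sup>+x. ennreal ?c * (ennreal (weight (K - p) (x :: real ^ 'n)) + ennreal (weight (K - p) (x - z))) \<partial>lborel)"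
      using C(2) c by (intro nn_integral_mono) (simp add: ennreal_leI flip: ennreal_mult ennreal_plus)
    also have "\<dots> = ennreal ?c * (ennreal (weight_mass K) + (\<integral>\<^sup>+x. ennreal (weight (K - p) (x - z)) \<partial>lborel))"
      by (simp add: nn_integral_cmult nn_integral_add nn_weight_mass[OF K(2)])
    also have "(\<integral>\<^sup>+x. ennreal (weight (K - p) (x - z)) \<partial>lborel) = (\<integral>\<^sup>+x. ennreal (weight (K - p) (x :: real ^ 'n)) \<partial>lborel)"
      by (rule nn_integral_shift) measurable
    also have "ennreal ?c * (ennreal (weight_mass K) + \<dots>) = ennreal ?c * ennreal (2 * weight_mass K)"
      using weight_mass_nonneg[of K] by (simp add: nn_weight_mass[OF K(2)] flip: ennreal_plus)
    also have "\<dots> = ennreal (?c * (2 * weight_mass K))"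
      using c weight_mass_nonneg[of K] by (intro ennreal_mult[symmetric]) auto
    finally show ?thesis by (simp add: mult_ac)
  qed
  moreover have "C * (2 * weight_mass K) \<ge> 0" using C(1) weight_mass_nonneg[of K] by simp
  ultimately show ?thesis by blast
qed

lemma integrable_of_weighted:
  fixes w :: "real ^ 'n \<Rightarrow> real"
  assumes [measurable]: "w \<in> borel_measurable borel" and K: "0 \<le> K"
    and fin: "wnorm K w < \<infinity>"
    and a: "real (mi_abs \<alpha>) \<le> K"
  shows "integrable lborel (\<lambda>y. mi_power y \<alpha> * w y)"
proof (rule integrableI_bounded)
  have "(\<integral>\<^sup>+y. ennreal (norm (mi_power y \<alpha> * w y)) \<partial>lborel) \<le> wnorm K w"
    using abs_mi_power_le_weight[OF a]
    by (intro nn_integral_mono ennreal_leI) (auto simp: abs_mult mult.commute intro!: mult_left_mono)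
  with fin show "(\<integral>\<^sup>+y. ennreal (norm (mi_power y \<alpha> * w y)) \<partial>lborel) < \<infinity>" by (rule order_le_less_trans[rotated])
qed measurable

lemma integrable_of_weighted_0:
  fixes w :: "real ^ 'n \<Rightarrow> real"
  assumes "w \<in> borel_measurable borel" "0 \<le> K"
    and "wnorm K w < \<infinity>"
  shows "integrable lborel w"
  using integrable_of_weighted[OF assms, of "\<lambda>_. 0"] assms(2) by (simp add: mi_power_def mi_abs_def)

text \<open>
  Every term of the Taylor polynomial is a monomial in \<open>y\<close> of degree at most \<open>K\<close> times a function of \<open>x\<close>, so
  subtracting it from the kernel does not change the convolution with a function without moments.
\<close>

lemma conv_scaled_taylor:
  fixes w :: "real ^ 'n \<Rightarrow> real"
  assumes w[measurable]: "w \<in> borel_measurable borel" and K: "0 \<le> K" and m: "Suc (nat \<lfloor>K\<rfloor>) \<le> k"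
    and fin: "wnorm K w < \<infinity>"
    and mom: "\<And>\<alpha>. real (mi_abs \<alpha>) \<le> K \<Longrightarrow> (LBINT y. mi_power y \<alpha> * w y) = 0"
    and r: "r > 0"
  shows "integrable lborel (\<lambda>y. taylor_rem (nat \<lfloor>K\<rfloor>) (x /\<^sub>R r) (y /\<^sub>R r) / r ^ CARD('n) * w y)"
    and "conv (scaled r) w x = (LBINT y. taylor_rem (nat \<lfloor>K\<rfloor>) (x /\<^sub>R r) (y /\<^sub>R r) / r ^ CARD('n) * w y)"
proof -
  let ?m = "nat \<lfloor>K\<rfloor>"
  define c where "c j is = (- inverse r) ^ j * word_deriv is F (x /\<^sub>R r) / fact j / r ^ CARD('n)" for j "is"
  let ?P = "\<lambda>y. \<Sum>j\<le>?m. \<Sum>is | length is = j. c j is * (mi_power y (count (mset is)) * w y)"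
  have abs: "real (mi_abs (count (mset is))) \<le> K" if "j \<le> ?m" "length is = j" for j and "is" :: "'n list"
    using that floor_bounds(1)[OF K] length_eq_mi_abs_count[of "is"] by linarith
  have eq: "taylor_rem ?m (x /\<^sub>R r) (y /\<^sub>R r) / r ^ CARD('n) * w y = scaled r (x - y) * w y - ?P y" for y
  proof -
    have ld: "line_deriv j (- (y /\<^sub>R r)) F (x /\<^sub>R r)
       = (\<Sum>is | length is = j. (- inverse r) ^ j * word_deriv is F (x /\<^sub>R r) * mi_power y (count (mset is)))" for j
      using line_deriv_monomials[of j "- inverse r" y] by simp
    have "taylor_rem ?m (x /\<^sub>R r) (y /\<^sub>R r) / r ^ CARD('n) * w y = scaled r (x - y) * w y
        - (\<Sum>j\<le>?m. line_deriv j (- (y /\<^sub>R r)) F (x /\<^sub>R r) / fact j) / r ^ CARD('n) * w y"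
      by (simp add: taylor_rem_def scaled_def scaleR_diff_right diff_divide_distrib left_diff_distrib)
    also have "(\<Sum>j\<le>?m. line_deriv j (- (y /\<^sub>R r)) F (x /\<^sub>R r) / fact j) / r ^ CARD('n) * w y = ?P y"
      unfolding ld c_def
      by (simp only: sum_divide_distrib sum_distrib_right) (intro sum.cong refl, simp add: mult_ac)
    finally show ?thesis .
  qed
  have int_w: "integrable lborel w" by (rule integrable_of_weighted_0[OF w K fin])
  have int_s: "integrable lborel (\<lambda>y. scaled r (x - y) * w y)"
    using integrable_conv_kernel[OF r int_w, of "[]"] by simp
  have int_m: "integrable lborel (\<lambda>y. c j is * (mi_power y (count (mset is)) * w y))" if "j \<le> ?m" "length is = j" for j "is"
    by (intro integrable_mult_right integrable_of_weighted[OF w K fin] abs[OF that])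
  have int_j: "integrable lborel (\<lambda>y. \<Sum>is | length is = j. c j is * (mi_power y (count (mset is)) * w y))" if "j \<le> ?m" for j
    by (intro Bochner_Integration.integrable_sum int_m that) simp
  have int_P: "integrable lborel ?P"
    by (intro Bochner_Integration.integrable_sum int_j) simp
  have zero: "(LBINT y. ?P y) = 0"
  proof -
    have "(LBINT y. ?P y) = (\<Sum>j\<le>?m. \<integral>y. (\<Sum>is | length is = j. c j is * (mi_power y (count (mset is)) * w y)) \<partial>lborel)"
      by (intro Bochner_Integration.integral_sum int_j) simp
    also have "\<dots> = (\<Sum>j\<le>?m. \<Sum>is | length is = j. \<integral>y. c j is * (mi_power y (count (mset is)) * w y) \<partial>lborel)"
      by (intro sum.cong refl Bochner_Integration.integral_sum int_m) auto
    also have "\<dots> = 0"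
      by (intro sum.neutral ballI) (use abs mom in auto)
    finally show ?thesis .
  qed
  show "integrable lborel (\<lambda>y. taylor_rem ?m (x /\<^sub>R r) (y /\<^sub>R r) / r ^ CARD('n) * w y)"
    unfolding eq using int_s int_P by (rule Bochner_Integration.integrable_diff)
  show "conv (scaled r) w x = (LBINT y. taylor_rem ?m (x /\<^sub>R r) (y /\<^sub>R r) / r ^ CARD('n) * w y)"
    unfolding eq conv_def Bochner_Integration.integral_diff[OF int_s int_P] zero by simp
qed

text \<open>
  The heart of the matter: Tonelli's theorem and a rescaling reduce the weighted norm of the convolution to
  the integral of the Taylor remainder over \<open>x\<close> at a fixed point \<open>y\<close>.
\<close>

lemma conv_moment_free_le:
  assumes K: "0 \<le> K" "K < p - real CARD('n)" and m: "Suc (nat \<lfloor>K\<rfloor>) \<le> k"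
  shows "\<exists>C\<ge>0. \<forall>w r. w \<in> borel_measurable borel \<longrightarrow>
     wnorm K w < \<infinity> \<longrightarrow>
     moment_free K w \<longrightarrow> r > 0 \<longrightarrow>
     swnorm r K (conv (scaled r) w) \<le> ennreal C * cancel_mass K w r"
proof -
  let ?R = "taylor_rem (nat \<lfloor>K\<rfloor>)"
  obtain C where C: "C \<ge> 0" "\<And>z. (\<integral>\<^sup>+x. ennreal (\<bar>?R x z\<bar> * weight K x) \<partial>lborel) \<le> ennreal (C * cancel_weight K z)"
    using taylor_rem_integral_le[OF assms] by blast
  show ?thesis
  proof (intro exI[of _ C] conjI allI impI C(1))
    fix w :: "real ^ 'n \<Rightarrow> real" and r :: real
    assume w[measurable]: "w \<in> borel_measurable borel" and r: "r > 0"
      and fin: "wnorm K w < \<infinity>"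
      and mom: "moment_free K w"
    have "nat \<lfloor>K\<rfloor> \<le> k" using m by simp
    from measurable_taylor_rem[OF this]
    have R[measurable]: "(\<lambda>p. ?R (fst p) (snd p)) \<in> borel_measurable (borel \<Otimes>\<^sub>M borel)" by (simp add: case_prod_unfold)
    have R1[measurable]: "(\<lambda>x. ?R x z) \<in> borel_measurable borel" for z
      using measurable_compose[OF _ R, of "\<lambda>x. (x, z)" borel] by simp
    have R2[measurable]: "(\<lambda>(x, y). ?R (x /\<^sub>R r) (y /\<^sub>R r)) \<in> borel_measurable (lborel \<Otimes>\<^sub>M lborel)"
      using measurable_compose[OF _ R, of "\<lambda>q. (fst q /\<^sub>R r, snd q /\<^sub>R r)" "lborel \<Otimes>\<^sub>M lborel"] by (simp add: case_prod_unfold)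
    have R3[measurable]: "(\<lambda>y. ?R (x /\<^sub>R r) (y /\<^sub>R r)) \<in> borel_measurable borel" for x
      using measurable_compose[OF _ R, of "\<lambda>y. (x /\<^sub>R r, y /\<^sub>R r)" borel] by simp
    have "swnorm r K (conv (scaled r) w)
       \<le> (\<integral>\<^sup>+x. \<integral>\<^sup>+y. ennreal (\<bar>?R (x /\<^sub>R r) (y /\<^sub>R r)\<bar> * weight K (x /\<^sub>R r)) * ennreal (\<bar>w y\<bar> / r ^ CARD('n)) \<partial>lborel \<partial>lborel)"
    proof (rule nn_integral_mono)
      fix x :: "real ^ 'n"
      let ?c = "weight K (x /\<^sub>R r)"
      note T = conv_scaled_taylor[OF w K(1) m fin _ r, of x]
      have "ennreal (\<bar>conv (scaled r) w x\<bar> * ?c) = ennreal ?c * ennreal \<bar>conv (scaled r) w x\<bar>"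
        by (simp add: ennreal_mult mult.commute)
      also have "\<dots> \<le> ennreal ?c * (\<integral>\<^sup>+y. ennreal (norm (?R (x /\<^sub>R r) (y /\<^sub>R r) / r ^ CARD('n) * w y)) \<partial>lborel)"
        using integral_norm_bound_ennreal[OF T(1)] T(2) mom by (intro mult_left_mono) auto
      also have "\<dots> = (\<integral>\<^sup>+y. ennreal ?c * ennreal (norm (?R (x /\<^sub>R r) (y /\<^sub>R r) / r ^ CARD('n) * w y)) \<partial>lborel)"
        by (rule nn_integral_cmult[symmetric]) measurable
      also have "\<dots> = (\<integral>\<^sup>+y. ennreal (\<bar>?R (x /\<^sub>R r) (y /\<^sub>R r)\<bar> * ?c) * ennreal (\<bar>w y\<bar> / r ^ CARD('n)) \<partial>lborel)"
        using r by (intro nn_integral_cong) (simp add: ennreal_mult[symmetric] abs_mult abs_divide mult_ac)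
      finally show "ennreal (\<bar>conv (scaled r) w x\<bar> * ?c)
        \<le> (\<integral>\<^sup>+y. ennreal (\<bar>?R (x /\<^sub>R r) (y /\<^sub>R r)\<bar> * ?c) * ennreal (\<bar>w y\<bar> / r ^ CARD('n)) \<partial>lborel)" .
    qed
    also have "\<dots> = (\<integral>\<^sup>+y. \<integral>\<^sup>+x. ennreal (\<bar>?R (x /\<^sub>R r) (y /\<^sub>R r)\<bar> * weight K (x /\<^sub>R r)) * ennreal (\<bar>w y\<bar> / r ^ CARD('n)) \<partial>lborel \<partial>lborel)"
      by (rule lborel_pair.Fubini'[symmetric]) measurable
    also have "\<dots> = (\<integral>\<^sup>+y. (ennreal (r ^ CARD('n)) * (\<integral>\<^sup>+x. ennreal (\<bar>?R x (y /\<^sub>R r)\<bar> * weight K x) \<partial>lborel)) * ennreal (\<bar>w y\<bar> / r ^ CARD('n)) \<partial>lborel)"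
    proof (rule nn_integral_cong)
      fix y :: "real ^ 'n"
      have "(\<integral>\<^sup>+x. ennreal (\<bar>?R (x /\<^sub>R r) (y /\<^sub>R r)\<bar> * weight K (x /\<^sub>R r)) * ennreal (\<bar>w y\<bar> / r ^ CARD('n)) \<partial>lborel)
        = (\<integral>\<^sup>+x. (\<lambda>x. ennreal (\<bar>?R x (y /\<^sub>R r)\<bar> * weight K x)) (x /\<^sub>R r) \<partial>lborel) * ennreal (\<bar>w y\<bar> / r ^ CARD('n))"
        by (rule nn_integral_multc) measurable
      also have "(\<integral>\<^sup>+x. (\<lambda>x. ennreal (\<bar>?R x (y /\<^sub>R r)\<bar> * weight K x)) (x /\<^sub>R r) \<partial>lborel)
          = ennreal (r ^ DIM(real ^ 'n)) * (\<integral>\<^sup>+x. ennreal (\<bar>?R x (y /\<^sub>R r)\<bar> * weight K x) \<partial>lborel)"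
        by (rule nn_integral_scale) (use r in measurable)
      finally show "(\<integral>\<^sup>+x. ennreal (\<bar>?R (x /\<^sub>R r) (y /\<^sub>R r)\<bar> * weight K (x /\<^sub>R r)) * ennreal (\<bar>w y\<bar> / r ^ CARD('n)) \<partial>lborel)
        = (ennreal (r ^ CARD('n)) * (\<integral>\<^sup>+x. ennreal (\<bar>?R x (y /\<^sub>R r)\<bar> * weight K x) \<partial>lborel)) * ennreal (\<bar>w y\<bar> / r ^ CARD('n))"
        by simp
    qed
    also have "\<dots> \<le> (\<integral>\<^sup>+y. (ennreal (r ^ CARD('n)) * ennreal (C * cancel_weight K (y /\<^sub>R r))) * ennreal (\<bar>w y\<bar> / r ^ CARD('n)) \<partial>lborel)"
      by (intro nn_integral_mono mult_right_mono mult_left_mono C(2)) auto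
    also have "\<dots> = (\<integral>\<^sup>+y. ennreal C * ennreal (cancel_weight K (y /\<^sub>R r) * \<bar>w y\<bar>) \<partial>lborel)"
    proof (rule nn_integral_cong)
      fix y :: "real ^ 'n"
      have "r ^ CARD('n) * (C * cancel_weight K (y /\<^sub>R r)) * (\<bar>w y\<bar> / r ^ CARD('n)) = C * (cancel_weight K (y /\<^sub>R r) * \<bar>w y\<bar>)"
        using r by simp
      then show "(ennreal (r ^ CARD('n)) * ennreal (C * cancel_weight K (y /\<^sub>R r))) * ennreal (\<bar>w y\<bar> / r ^ CARD('n))
          = ennreal C * ennreal (cancel_weight K (y /\<^sub>R r) * \<bar>w y\<bar>)"
        using r C(1) cancel_weight_nonneg[of K "y /\<^sub>R r"] by (simp add: ennreal_mult[symmetric])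
    qed
    also have "\<dots> = ennreal C * cancel_mass K w r"
      unfolding cancel_mass_def by (rule nn_integral_cmult) measurable
    finally show "swnorm r K (conv (scaled r) w) \<le> ennreal C * cancel_mass K w r" .
  qed
qed

end

section \<open>The norms of the theorem\<close>

text \<open>
  Interpolation: \<open>|U|\<^sup>q \<le> (sup |U|)\<^sup>q\<^sup>-\<^sup>1 |U|\<close>. The powers of time \<open>a\<close> and \<open>b\<close> are kept apart from the size \<open>e\<close>, which
  may vanish.
\<close>

lemma Lq_norm_le:
  fixes U :: "real ^ 'n::finite \<Rightarrow> real"
  assumes U: "continuous_on UNIV U" "\<And>x. 0 \<le> U x" and q: "1 \<le> q"
    and ab: "a > 0" "b > 0" "e \<ge> 0"
    and sup: "\<And>x. U x \<le> a * e" and int: "(\<integral>\<^sup>+x. ennreal (U x) \<partial>lborel) \<le> ennreal (b * e)"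
  shows "Lq_norm q U \<le> ennreal (a powr (1 - enn2real (1 / q)) * b powr (enn2real (1 / q)) * e)"
proof -
  have [measurable]: "U \<in> borel_measurable borel" using U(1) by (rule borel_measurable_continuous_onI)
  show ?thesis
  proof (cases "q = \<infinity>")
    case True
    have "esssup lebesgue (\<lambda>x. ennreal \<bar>U x\<bar>) \<le> ennreal (a * e)"
    proof (rule esssup_I)
      show "(\<lambda>x. ennreal \<bar>U x\<bar>) \<in> borel_measurable lebesgue"
        by (rule measurable_completion) measurable
      show "AE x in lebesgue. ennreal \<bar>U x\<bar> \<le> ennreal (a * e)"
        using sup U(2) by (intro AE_I2 ennreal_leI) simp
    qed
    then show ?thesis using True ab by (simp add: Lq_norm_def)
  next
    case False
    define Q where "Q = enn2real q"
    have qQ: "q = ennreal Q" using False by (simp add: Q_def less_top)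
    have Q: "1 \<le> Q" using q unfolding qQ by (metis ennreal_1 ennreal_le_iff2 not_one_le_zero zero_less_one_class.zero_le_one ennreal_eq_0_iff linorder_linear)
    have s: "enn2real (1 / q) = 1 / Q"
      unfolding qQ using Q by (simp add: divide_ennreal[of 1 Q, simplified])
    have pw: "U x powr Q \<le> (a * e) powr (Q - 1) * U x" for x
    proof (cases "U x = 0")
      case False
      then have "U x > 0" using U(2)[of x] by simp
      then have "U x powr Q = U x powr (Q - 1) * U x" by (simp add: powr_diff)
      also have "\<dots> \<le> (a * e) powr (Q - 1) * U x"
        using sup[of x] U(2)[of x] Q by (intro mult_right_mono powr_mono2) auto
      finally show ?thesis .
    qed simp
    have "(\<integral>\<^sup>+x. ennreal (\<bar>U x\<bar> powr Q) \<partial>lebesgue) = (\<integral>\<^sup>+x. ennreal (\<bar>U x\<bar> powr Q) \<partial>lborel)"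
      by (rule nn_integral_completion) 
    also have "\<dots> \<le> (\<integral>\<^sup>+x. ennreal ((a * e) powr (Q - 1)) * ennreal (U x) \<partial>lborel)"
      using pw U(2) by (intro nn_integral_mono) (simp add: ennreal_mult[symmetric] ennreal_leI)
    also have "\<dots> = ennreal ((a * e) powr (Q - 1)) * (\<integral>\<^sup>+x. ennreal (U x) \<partial>lborel)"
      by (rule nn_integral_cmult) measurable
    also have "\<dots> \<le> ennreal ((a * e) powr (Q - 1)) * ennreal (b * e)"
      by (intro mult_left_mono int) auto
    also have "\<dots> = ennreal ((a * e) powr (Q - 1) * (b * e))"
      using ab by (intro ennreal_mult[symmetric]) auto
    finally have I: "(\<integral>\<^sup>+x. ennreal (\<bar>U x\<bar> powr Q) \<partial>lebesgue) \<le> ennreal ((a * e) powr (Q - 1) * (b * e))" .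
    then have fin: "(\<integral>\<^sup>+x. ennreal (\<bar>U x\<bar> powr Q) \<partial>lebesgue) \<noteq> \<infinity>"
      by (metis ennreal_less_top infinity_ennreal_def not_less top.extremum top_unique)
    have "enn2real (\<integral>\<^sup>+x. ennreal (\<bar>U x\<bar> powr Q) \<partial>lebesgue) \<le> (a * e) powr (Q - 1) * (b * e)"
      using I ab by (intro enn2real_leI) auto
    then have "enn2real (\<integral>\<^sup>+x. ennreal (\<bar>U x\<bar> powr Q) \<partial>lebesgue) powr (1 / Q) \<le> ((a * e) powr (Q - 1) * (b * e)) powr (1 / Q)"
      using Q by (intro powr_mono2) auto
    also have "\<dots> = a powr (1 - 1 / Q) * b powr (1 / Q) * e"
    proof (cases "e = 0")
      case False
      then have e: "e > 0" using ab by simp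
      have "((a * e) powr (Q - 1) * (b * e)) powr (1 / Q) = (a * e) powr ((Q - 1) / Q) * (b * e) powr (1 / Q)"
        using ab e by (simp add: powr_mult powr_powr)
      also have "(Q - 1) / Q = 1 - 1 / Q" using Q by (simp add: diff_divide_distrib)
      also have "(a * e) powr (1 - 1 / Q) * (b * e) powr (1 / Q)
          = a powr (1 - 1 / Q) * b powr (1 / Q) * (e powr (1 - 1 / Q) * e powr (1 / Q))"
        using ab e by (simp add: powr_mult)
      also have "e powr (1 - 1 / Q) * e powr (1 / Q) = e"
        using e by (simp add: powr_add[symmetric])
      finally show ?thesis .
    qed simp
    finally show ?thesis
      using False fin unfolding Lq_norm_def s by (simp add: Let_def Q_def ennreal_leI)
  qed
qed

text \<open>
  With \<open>\<tau> = (1 + t)\<^sup>1\<^sup>/\<^sup>d\<close> or \<open>\<tau> = t\<^sup>1\<^sup>/\<^sup>d\<close> the left-hand side is the weight that the theorem puts on the solution.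
  Both \<open>1\<close> and \<open>|x|\<close> are divided by a length that is at least their unit on the right.
\<close>

lemma weight_compare:
  fixes x :: "'a::real_normed_vector"
  assumes "0 < \<sigma>" "\<sigma> \<le> \<tau>" "1 \<le> \<tau>" "0 \<le> l" "l \<le> K"
  shows "\<tau> powr (- l) * (1 + norm x powr l) \<le> 2 * weight K (x /\<^sub>R \<sigma>)"
proof -
  have "1 powr l \<le> weight l x" "norm x powr l \<le> weight l x"
    using assms by (intro powr_mono2; simp)+
  then have "1 + norm x powr l \<le> 2 * weight l x" by simp
  then have "\<tau> powr (- l) * (1 + norm x powr l) \<le> \<tau> powr (- l) * (2 * weight l x)"
    by (intro mult_left_mono) auto
  also have "\<dots> = 2 * ((1 + norm x) / \<tau>) powr l"
    using assms by (simp add: powr_divide powr_minus_divide)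
  also have "((1 + norm x) / \<tau>) powr l \<le> weight l (x /\<^sub>R \<sigma>)"
  proof (rule powr_mono2)
    have "1 / \<tau> \<le> 1" using assms by simp
    moreover have "norm x / \<tau> \<le> norm x / \<sigma>" using assms by (intro divide_left_mono) auto
    moreover have "norm (x /\<^sub>R \<sigma>) = norm x / \<sigma>" using assms by (simp add: divide_inverse mult.commute)
    ultimately show "(1 + norm x) / \<tau> \<le> 1 + norm (x /\<^sub>R \<sigma>)"
      unfolding add_divide_distrib by linarith
  qed (use assms in auto)
  also have "weight l (x /\<^sub>R \<sigma>) \<le> weight K (x /\<^sub>R \<sigma>)"
    using assms by (intro powr_mono) auto
  finally show ?thesis by simp
qed

text \<open>
  All norms in the theorem follow from two of them: the supremum, and the \<open>L\<^sup>1\<close> norm with the weight of the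
  highest exponent \<open>K\<close>. The constant is \<open>1 + 2\<close>, the \<open>2\<close> coming from \<open>1 + |x|\<^sup>l \<le> 2 (1 + |x|)\<^sup>l\<close>.
\<close>

lemma norms_le:
  fixes U :: "real ^ 'n::finite \<Rightarrow> real"
  assumes U: "continuous_on UNIV U" "\<And>x. 0 \<le> U x" and t: "t > 0" and q: "1 \<le> q"
    and w: "0 < \<sigma>" "\<sigma> \<le> \<tau>" "1 \<le> \<tau>" "0 \<le> l" "l \<le> K" and E: "E < \<infinity>"
    and sup: "\<And>x. ennreal (t powr ((real CARD('n) + real j) / d) * U x) \<le> E"
    and int: "ennreal (t powr (real j / d)) * (\<integral>\<^sup>+x. ennreal (U x * weight K (x /\<^sub>R \<sigma>)) \<partial>lborel) \<le> E"
  shows "ennreal (t powr (real CARD('n) / d * (1 - enn2real (1 / q)) + real j / d)) * Lq_norm q U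
      + ennreal (t powr (real j / d) * \<tau> powr (- l)) * weighted_norm l U \<le> 3 * E"
proof -
  have [measurable]: "U \<in> borel_measurable borel" using U(1) by (rule borel_measurable_continuous_onI)
  obtain e where e: "e \<ge> 0" "E = ennreal e" using E by (cases E) auto
  define s where "s = enn2real (1 / q)"
  define a where "a = t powr (- ((real CARD('n) + real j) / d))"
  define b where "b = t powr (- (real j / d))"
  have ab: "a > 0" "b > 0" using t by (auto simp: a_def b_def)
  have cancel: "t powr (- z) * (t powr z * y) = y" for y z
    using t by (simp add: powr_minus)
  have "U x \<le> a * e" for x
  proof -
    have "t powr ((real CARD('n) + real j) / d) * U x \<le> e" using sup[of x] e by simp
    then have "a * (t powr ((real CARD('n) + real j) / d) * U x) \<le> a * e" using ab by (intro mult_left_mono) auto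
    then show ?thesis unfolding a_def cancel .
  qed
  moreover have "(\<integral>\<^sup>+x. ennreal (U x) \<partial>lborel) \<le> ennreal (b * e)"
  proof -
    have one: "1 \<le> weight K (x /\<^sub>R \<sigma>)" for x :: "real ^ 'n"
      using w by (intro ge_one_powr_ge_zero) auto
    have "(\<integral>\<^sup>+x. ennreal (U x) \<partial>lborel) \<le> (\<integral>\<^sup>+x. ennreal (U x * weight K (x /\<^sub>R \<sigma>)) \<partial>lborel)"
    proof (intro nn_integral_mono ennreal_leI)
      show "U x \<le> U x * weight K (x /\<^sub>R \<sigma>)" for x
        using mult_left_mono[OF one[of x] U(2)[of x]] by simp
    qed
    also have "\<dots> = ennreal b * (ennreal (t powr (real j / d)) * (\<integral>\<^sup>+x. ennreal (U x * weight K (x /\<^sub>R \<sigma>)) \<partial>lborel))"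
      using t by (simp add: b_def mult.assoc[symmetric] ennreal_mult[symmetric] powr_add[symmetric])
    also have "\<dots> \<le> ennreal b * E" by (intro mult_left_mono int) auto
    also have "\<dots> = ennreal (b * e)" using ab e by (simp add: ennreal_mult)
    finally show ?thesis .
  qed
  moreover have exponents: "- (m + n) * (1 - s) + - n * s = - (m * (1 - s) + n)" for m n :: real
    by (simp add: algebra_simps)
  ultimately have "Lq_norm q U \<le> ennreal (a powr (1 - s) * b powr s * e)"
    unfolding s_def using Lq_norm_le[OF U q ab e(1)] by blast
  also have "a powr (1 - s) * b powr s = t powr (- (real CARD('n) / d * (1 - s) + real j / d))"
    unfolding a_def b_def powr_powr powr_add[symmetric]
    by (rule arg_cong[where f = "\<lambda>z. t powr z"]) (simp only: add_divide_distrib exponents)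
  finally have "ennreal (t powr (real CARD('n) / d * (1 - s) + real j / d)) * Lq_norm q U
      \<le> ennreal (t powr (real CARD('n) / d * (1 - s) + real j / d))
        * ennreal (t powr (- (real CARD('n) / d * (1 - s) + real j / d)) * e)"
    by (intro mult_left_mono) auto
  also have "\<dots> = E"
    using t e by (simp add: ennreal_mult[symmetric] mult.assoc[symmetric] powr_add[symmetric])
  finally have 1: "ennreal (t powr (real CARD('n) / d * (1 - s) + real j / d)) * Lq_norm q U \<le> E" .
  have "ennreal (t powr (real j / d) * \<tau> powr (- l)) * weighted_norm l U
      = ennreal (t powr (real j / d) * \<tau> powr (- l)) * (\<integral>\<^sup>+x. ennreal (U x * (1 + norm x powr l)) \<partial>lborel)"
    unfolding weighted_norm_def using U(2) by (subst nn_integral_completion) auto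
  also have "\<dots> = ennreal (t powr (real j / d)) * (\<integral>\<^sup>+x. ennreal (\<tau> powr (- l)) * ennreal (U x * (1 + norm x powr l)) \<partial>lborel)"
    by (subst nn_integral_cmult) (auto simp: ennreal_mult mult.assoc)
  also have "\<dots> \<le> ennreal (t powr (real j / d)) * (\<integral>\<^sup>+x. 2 * ennreal (U x * weight K (x /\<^sub>R \<sigma>)) \<partial>lborel)"
  proof (intro mult_left_mono nn_integral_mono)
    fix x :: "real ^ 'n"
    have "\<tau> powr (- l) * (U x * (1 + norm x powr l)) = U x * (\<tau> powr (- l) * (1 + norm x powr l))" by simp
    also have "\<dots> \<le> U x * (2 * weight K (x /\<^sub>R \<sigma>))"
      by (intro mult_left_mono weight_compare w U(2))
    finally have "ennreal (\<tau> powr (- l) * (U x * (1 + norm x powr l))) \<le> ennreal (2 * (U x * weight K (x /\<^sub>R \<sigma>)))"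
      by (intro ennreal_leI) simp
    then show "ennreal (\<tau> powr (- l)) * ennreal (U x * (1 + norm x powr l)) \<le> 2 * ennreal (U x * weight K (x /\<^sub>R \<sigma>))"
      using U(2)[of x] by (simp add: ennreal_mult)
  qed auto
  also have "\<dots> = 2 * (ennreal (t powr (real j / d)) * (\<integral>\<^sup>+x. ennreal (U x * weight K (x /\<^sub>R \<sigma>)) \<partial>lborel))"
    by (subst nn_integral_cmult) (auto simp: mult_ac)
  also have "\<dots> \<le> 2 * E" by (intro mult_left_mono int) auto
  finally have 2: "ennreal (t powr (real j / d) * \<tau> powr (- l)) * weighted_norm l U \<le> 2 * E" .
  have "E + 2 * E = (1 + 2) * E" by (simp only: distrib_right mult_1_left)
  then have "E + 2 * E = 3 * E" by simp
  then show ?thesis using add_mono[OF 1 2] unfolding s_def by simp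
qed

lemma nabla_norm_le_sum:
  "nabla_norm j f x \<le> (\<Sum>\<alpha> | mi_abs \<alpha> = j. \<bar>word_deriv (mi_word \<alpha>) f x\<bar>)"
  unfolding nabla_norm_def mi_deriv_eq_word_deriv by (rule L2_set_le_sum_abs)

lemma nabla_norm_nonneg: "0 \<le> nabla_norm j f x"
  by (simp add: nabla_norm_def L2_set_nonneg)

lemma continuous_on_nabla_norm:
  assumes "Ck_on k UNIV f" "j \<le> k"
  shows "continuous_on UNIV (nabla_norm j f)"
  unfolding nabla_norm_def[abs_def] L2_set_def mi_deriv_eq_word_deriv
  using assms by (intro continuous_intros Ck_onD_continuous[OF assms(1)]) (auto simp: length_mi_word)

lemma nabla_sup_le:
  fixes f :: "real ^ 'n::finite \<Rightarrow> real"
  assumes "\<And>is. length is = j \<Longrightarrow> ennreal \<bar>word_deriv is f x\<bar> \<le> E"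
  shows "ennreal (nabla_norm j f x) \<le> of_nat (card {\<alpha> :: 'n \<Rightarrow> nat. mi_abs \<alpha> = j}) * E"
proof -
  have "ennreal (nabla_norm j f x) \<le> ennreal (\<Sum>\<alpha> | mi_abs \<alpha> = j. \<bar>word_deriv (mi_word \<alpha>) f x\<bar>)"
    by (intro ennreal_leI nabla_norm_le_sum)
  also have "\<dots> = (\<Sum>\<alpha> | mi_abs \<alpha> = j. ennreal \<bar>word_deriv (mi_word \<alpha>) f x\<bar>)"
    by (simp add: sum_ennreal)
  also have "\<dots> \<le> (\<Sum>\<alpha>\<in>{\<alpha> :: 'n \<Rightarrow> nat. mi_abs \<alpha> = j}. E)"
    by (intro sum_mono assms) (simp add: length_mi_word)
  finally show ?thesis by simp
qed

lemma nabla_int_le: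
  fixes f :: "real ^ 'n::finite \<Rightarrow> real"
  assumes f: "Ck_on k UNIV f" "j \<le> k" and c[measurable]: "c \<in> borel_measurable borel" and c0: "\<And>x. c x \<ge> 0"
    and E: "\<And>is. length is = j \<Longrightarrow> (\<integral>\<^sup>+x. ennreal (\<bar>word_deriv is f x\<bar> * c x) \<partial>lborel) \<le> E"
  shows "(\<integral>\<^sup>+x. ennreal (nabla_norm j f x * c x) \<partial>lborel) \<le> of_nat (card {\<alpha> :: 'n \<Rightarrow> nat. mi_abs \<alpha> = j}) * E"
proof -
  have "(\<integral>\<^sup>+x. ennreal (nabla_norm j f x * c x) \<partial>lborel)
      \<le> (\<integral>\<^sup>+x. (\<Sum>\<alpha> | mi_abs \<alpha> = j. ennreal (\<bar>word_deriv (mi_word \<alpha>) f x\<bar> * c x)) \<partial>lborel)"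
  proof (rule nn_integral_mono)
    fix x
    have "nabla_norm j f x * c x \<le> (\<Sum>\<alpha> | mi_abs \<alpha> = j. \<bar>word_deriv (mi_word \<alpha>) f x\<bar> * c x)"
      unfolding sum_distrib_right[symmetric] by (intro mult_right_mono nabla_norm_le_sum c0)
    then show "ennreal (nabla_norm j f x * c x) \<le> (\<Sum>\<alpha> | mi_abs \<alpha> = j. ennreal (\<bar>word_deriv (mi_word \<alpha>) f x\<bar> * c x))"
      using c0[of x] by (subst sum_ennreal) (auto intro: ennreal_leI)
  qed
  also have "\<dots> = (\<Sum>\<alpha> | mi_abs \<alpha> = j. \<integral>\<^sup>+x. ennreal (\<bar>word_deriv (mi_word \<alpha>) f x\<bar> * c x) \<partial>lborel)"
  proof (rule nn_integral_sum)
    fix \<alpha> :: "'n \<Rightarrow> nat" assume "\<alpha> \<in> {\<alpha>. mi_abs \<alpha> = j}"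
    then have "word_deriv (mi_word \<alpha>) f \<in> borel_measurable borel"
      using f by (intro borel_measurable_continuous_onI Ck_onD_continuous) (auto simp: length_mi_word)
    then show "(\<lambda>x. ennreal (\<bar>word_deriv (mi_word \<alpha>) f x\<bar> * c x)) \<in> borel_measurable lborel" by measurable
  qed
  also have "\<dots> \<le> (\<Sum>\<alpha>\<in>{\<alpha> :: 'n \<Rightarrow> nat. mi_abs \<alpha> = j}. E)"
    by (intro sum_mono E) (simp add: length_mi_word)
  finally show ?thesis by simp
qed

section \<open>The semigroup generated by the profile\<close>

lemma ennreal_mult3:
  "0 \<le> a \<Longrightarrow> 0 \<le> b \<Longrightarrow> 0 \<le> c \<Longrightarrow> ennreal a * (ennreal b * (ennreal c * E)) = ennreal (a * (b * c)) * E"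
  by (simp only: ennreal_mult mult_nonneg_nonneg mult.assoc)

locale self_similar_semigroup = decaying_profile F k B p
  for F :: "real ^ 'n::finite \<Rightarrow> real" and k B p +
  fixes d :: real
  assumes d_pos: "d > 0" and k_pos: "1 \<le> k"
    and semigroup: "\<And>x s t. 0 < s \<Longrightarrow> s < t \<Longrightarrow>
      scaled (t powr (1 / d)) x = conv (scaled ((t - s) powr (1 / d))) (scaled (s powr (1 / d))) x"
begin

definition kern :: "real \<Rightarrow> real ^ 'n \<Rightarrow> real" where
  "kern t = scaled (t powr (1 / d))"

lemma kern_1: "kern 1 = F"
  by (simp add: kern_def scaled_def[abs_def])

lemma kern_semigroup: "0 < s \<Longrightarrow> s < t \<Longrightarrow> kern t = conv (kern (t - s)) (kern s)"
  unfolding kern_def by (rule ext) (rule semigroup)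

lemma integrable_kern: "t > 0 \<Longrightarrow> integrable lborel (kern t)"
  unfolding kern_def by (rule integrable_scaled) simp

lemma kern_bounded: "t > 0 \<Longrightarrow> \<exists>C. \<forall>x. \<bar>kern t x\<bar> \<le> C"
  using scaled_bounded[of "t powr (1 / d)" "[]"] unfolding kern_def by auto

text \<open>
  The semigroup property, applied to a datum. Half of the time will produce cancellation and the other half
  derivatives.
\<close>

lemma conv_kern_split:
  assumes "0 < s" "s < t" "integrable lborel h"
  shows "conv (kern t) h = conv (kern (t - s)) (conv (kern s) h)"
proof
  fix x
  obtain C where C: "\<And>x. \<bar>kern (t - s) x\<bar> \<le> C" using kern_bounded[of "t - s"] assms by auto
  have "conv (kern (t - s)) (conv (kern s) h) x = conv (conv (kern (t - s)) (kern s)) h x"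
    by (rule conv_assoc[OF _ C integrable_kern[OF assms(1)] assms(3)]) (simp add: kern_def)
  then show "conv (kern t) h x = conv (kern (t - s)) (conv (kern s) h) x"
    unfolding kern_semigroup[OF assms(1,2)] by simp
qed

lemma nn_integral_abs_kern:
  assumes t: "t > 0"
  shows "l1norm (kern t) = l1norm F"
proof -
  define r where "r = t powr (1 / d)"
  have r: "r > 0" using t by (simp add: r_def)
  have "l1norm (kern t) = (\<integral>\<^sup>+x. (\<lambda>x. ennreal (\<bar>F x\<bar> / r ^ CARD('n))) (x /\<^sub>R r) \<partial>lborel)"
    using r by (simp add: kern_def scaled_def r_def abs_divide)
  also have "\<dots> = ennreal (r ^ DIM(real ^ 'n)) * (\<integral>\<^sup>+x. ennreal (\<bar>F x\<bar> / r ^ CARD('n)) \<partial>lborel)"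
    by (rule nn_integral_scale) (use r in measurable)
  also have "\<dots> = (\<integral>\<^sup>+x. ennreal (r ^ CARD('n)) * ennreal (\<bar>F x\<bar> / r ^ CARD('n)) \<partial>lborel)"
    using r by (subst nn_integral_cmult) auto
  also have "\<dots> = l1norm F"
    using r by (simp add: ennreal_mult[symmetric])
  finally show ?thesis .
qed

text \<open>
  The mass \<open>m\<close> of the kernel is preserved by rescaling and multiplicative under convolution, so \<open>m\<^sup>2 = m\<close>. If
  \<open>m = 0\<close>, then \<open>F\<close> itself is a datum without moments of order zero, and the cancellation estimate with \<open>K = 0\<close>
  says that the \<open>L\<^sup>1\<close> norm of the kernel at time \<open>t + 1\<close> tends to zero as \<open>t\<close> grows. But this norm does not depend
  on time; so \<open>F\<close> vanishes. In the degenerate case the theorem is trivial, and otherwise the kernel has mass one,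
  as the formula that defines the moments \<open>M\<^sub>\<alpha>\<close> presupposes.
\<close>

lemma mass_dichotomy: "(LBINT x. F x) = 1 \<or> (\<forall>x. F x = 0)"
proof (cases "(LBINT x. F x) = 0")
  case False
  have "(LBINT x. kern 2 x) = (LBINT x. conv (kern 1) (kern 1) x)"
    using kern_semigroup[of 1 2] by simp
  also have "\<dots> = (LBINT x. kern 1 x) * (LBINT x. kern 1 x)"
    by (rule integral_conv) (simp_all add: integrable_kern)
  finally show ?thesis using False by (simp add: kern_def integral_scaled)
next
  case True
  have "p - real CARD('n) > 0" using p_gt by simp
  with conv_moment_free_le[of 0] k_pos obtain C where C: "C \<ge> 0"
    "\<And>w r. w \<in> borel_measurable borel \<Longrightarrow>
     wnorm 0 w < \<infinity> \<Longrightarrow>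
     moment_free 0 w \<Longrightarrow> r > 0 \<Longrightarrow>
     swnorm r 0 (conv (scaled r) w) \<le> ennreal C * cancel_mass 0 w r"
    by auto
  have one: "1 + norm y \<noteq> 0" for y :: "real ^ 'n" by (metis add_pos_nonneg less_irrefl norm_ge_zero zero_less_one)
  have finF: "wnorm 0 F < \<infinity>"
    using integrable_F one by (simp add: integrable_iff_bounded)
  have momF: "moment_free 0 F"
  proof (intro allI impI)
    fix \<alpha> :: "'n \<Rightarrow> nat" assume "real (mi_abs \<alpha>) \<le> 0"
    then have "\<alpha> i = 0" for i by (simp add: mi_abs_def del: of_nat_sum)
    then show "(LBINT y. mi_power y \<alpha> * F y) = 0" using True by (simp add: mi_power_def)
  qed
  have le: "l1norm F \<le> ennreal C * cancel_mass 0 F r" if r: "r > 0" for r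
  proof -
    \<comment> \<open>Every length occurs as the length of the kernel at some time.\<close>
    define t where "t = r powr d"
    have t: "t > 0" and r_eq: "r = t powr (1 / d)" using r d_pos by (auto simp: t_def powr_powr)
    have "l1norm F = l1norm (kern (t + 1))"
      using t by (simp add: nn_integral_abs_kern)
    also have "kern (t + 1) = conv (scaled r) F"
      using kern_semigroup[of 1 "t + 1"] t unfolding kern_1 by (simp add: kern_def r_eq)
    also have "l1norm (conv (scaled r) F)
        = swnorm r 0 (conv (scaled r) F)"
      using one by (simp del: norm_scaleR)
    also have "\<dots> \<le> ennreal C * cancel_mass 0 F r" by (rule C(2)[OF measurable_F finF momF r])
    finally show ?thesis .
  qed
  have "((\<lambda>r. ennreal C * (ennreal (r powr 0) * cancel_mass 0 F r)) \<longlongrightarrow> ennreal C * 0) at_top"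
    by (intro ennreal_tendsto_cmult cancel_mass_tendsto_0 measurable_F finF) auto
  then have "((\<lambda>r. ennreal C * (ennreal (r powr 0) * cancel_mass 0 F r)) \<longlongrightarrow> 0) at_top" by simp
  moreover have "eventually (\<lambda>r. l1norm F \<le> ennreal C * (ennreal (r powr 0) * cancel_mass 0 F r)) at_top"
    using eventually_gt_at_top[of 0] by eventually_elim (use le in simp)
  ultimately have "l1norm F \<le> 0"
    by (rule tendsto_lowerbound) simp
  then have zero: "l1norm (kern (1/2)) = 0"
    by (simp add: nn_integral_abs_kern)
  have "F x = 0" for x
  proof -
    have F: "F = conv (scaled ((1/2) powr (1 / d))) (kern (1/2))"
      using kern_semigroup[of "1/2" 1] by (simp add: kern_1) (simp add: kern_def)
    have "ennreal \<bar>conv (scaled ((1/2) powr (1 / d))) (kern (1/2)) x\<bar> \<le> 0"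
      using conv_scaled_sup_le[of "(1/2) powr (1 / d)" "kern (1/2)" "[]" x] zero integrable_kern[of "1/2"] by simp
    then have "conv (scaled ((1/2) powr (1 / d))) (kern (1/2)) x = 0" by simp
    with fun_cong[OF F, of x] show ?thesis by (rule trans)
  qed
  then show ?thesis by blast
qed

definition multiindex_count :: "nat \<Rightarrow> real" where
  "multiindex_count j = real (card {\<alpha> :: 'n \<Rightarrow> nat. mi_abs \<alpha> = j})"

lemma multiindex_count_nonneg: "multiindex_count j \<ge> 0" by (simp add: multiindex_count_def)

lemma nabla_conv_sup_le:
  assumes r: "r > 0" and h: "integrable lborel h" and j: "j \<le> k"
    and E: "l1norm h \<le> E"
  shows "ennreal (r ^ (CARD('n) + j) * nabla_norm j (conv (scaled r) h) x) \<le> ennreal (multiindex_count j * B) * E"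
proof -
  have "ennreal (nabla_norm j (conv (scaled r) h) x) \<le> of_nat (card {\<alpha> :: 'n \<Rightarrow> nat. mi_abs \<alpha> = j}) * (ennreal (B / r ^ (CARD('n) + j)) * E)"
  proof (rule nabla_sup_le)
    fix "is" :: "'n list" assume l: "length is = j"
    have "ennreal \<bar>word_deriv is (conv (scaled r) h) x\<bar> \<le> ennreal (B / r ^ (CARD('n) + j)) * l1norm h"
      using conv_scaled_sup_le[OF r h, of "is" x] l j by simp
    also have "\<dots> \<le> ennreal (B / r ^ (CARD('n) + j)) * E" by (intro mult_left_mono E) simp
    finally show "ennreal \<bar>word_deriv is (conv (scaled r) h) x\<bar> \<le> ennreal (B / r ^ (CARD('n) + j)) * E" .
  qed
  then have "ennreal (r ^ (CARD('n) + j)) * ennreal (nabla_norm j (conv (scaled r) h) x)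
      \<le> ennreal (r ^ (CARD('n) + j)) * (ennreal (multiindex_count j) * (ennreal (B / r ^ (CARD('n) + j)) * E))"
    unfolding multiindex_count_def ennreal_of_nat_eq_real_of_nat[symmetric] by (intro mult_left_mono) auto
  also have "\<dots> = ennreal (r ^ (CARD('n) + j) * (multiindex_count j * (B / r ^ (CARD('n) + j)))) * E"
    by (rule ennreal_mult3) (use r B_nonneg multiindex_count_nonneg in auto)
  also have "r ^ (CARD('n) + j) * (multiindex_count j * (B / r ^ (CARD('n) + j))) = multiindex_count j * B" using r by simp
  finally show ?thesis using r nabla_norm_nonneg[of j "conv (scaled r) h" x] by (subst ennreal_mult) auto
qed

lemma nabla_conv_weight_le:
  assumes r: "0 < r" "r \<le> \<sigma>" and h: "integrable lborel h" and j: "j \<le> k"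
    and K: "0 \<le> K" "K < p - real CARD('n)"
    and E: "swnorm \<sigma> K h \<le> E"
  shows "ennreal (r ^ j) * (\<integral>\<^sup>+x. ennreal (nabla_norm j (conv (scaled r) h) x * weight K (x /\<^sub>R \<sigma>)) \<partial>lborel)
    \<le> ennreal (multiindex_count j * B * weight_mass K) * E"
proof -
  have "(\<integral>\<^sup>+x. ennreal (nabla_norm j (conv (scaled r) h) x * weight K (x /\<^sub>R \<sigma>)) \<partial>lborel)
      \<le> of_nat (card {\<alpha> :: 'n \<Rightarrow> nat. mi_abs \<alpha> = j}) * (ennreal (B * weight_mass K / r ^ j) * E)"
  proof (rule nabla_int_le[OF Ck_on_conv_scaled[OF r(1) h] j])
    fix "is" :: "'n list" assume l: "length is = j"
    have "swnorm \<sigma> K (word_deriv is (conv (scaled r) h))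
      \<le> ennreal (B * weight_mass K / r ^ j) * swnorm \<sigma> K h"
      using conv_scaled_weight_le[OF r h _ K, of "is"] l j by simp
    also have "\<dots> \<le> ennreal (B * weight_mass K / r ^ j) * E" by (intro mult_left_mono E) simp
    finally show "swnorm \<sigma> K (word_deriv is (conv (scaled r) h))
      \<le> ennreal (B * weight_mass K / r ^ j) * E" .
  qed auto
  then have "ennreal (r ^ j) * (\<integral>\<^sup>+x. ennreal (nabla_norm j (conv (scaled r) h) x * weight K (x /\<^sub>R \<sigma>)) \<partial>lborel)
      \<le> ennreal (r ^ j) * (ennreal (multiindex_count j) * (ennreal (B * weight_mass K / r ^ j) * E))"
    unfolding multiindex_count_def ennreal_of_nat_eq_real_of_nat[symmetric] by (intro mult_left_mono) auto
  also have "\<dots> = ennreal (r ^ j * (multiindex_count j * (B * weight_mass K / r ^ j))) * E"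
    by (rule ennreal_mult3) (use r B_nonneg multiindex_count_nonneg weight_mass_nonneg in auto)
  also have "r ^ j * (multiindex_count j * (B * weight_mass K / r ^ j)) = multiindex_count j * B * weight_mass K" using r by simp
  finally show ?thesis .
qed

text \<open>
  The quantity estimated by the theorem, with the length \<open>\<tau>\<close> of the weight as a parameter.
\<close>

definition total_norm :: "real \<Rightarrow> real \<Rightarrow> real \<Rightarrow> nat \<Rightarrow> ennreal \<Rightarrow> (real ^ 'n \<Rightarrow> real) \<Rightarrow> ennreal" where
  "total_norm t \<tau> l j q v
    = ennreal (t powr (real CARD('n) / d * (1 - enn2real (1 / q)) + real j / d)) * Lq_norm q (nabla_norm j v)
      + ennreal (t powr (real j / d) * \<tau> powr (- l)) * weighted_norm l (nabla_norm j v)"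

lemma powr_of_nat_div: "t > 0 \<Longrightarrow> t powr (real m / d) = (t powr (1 / d)) ^ m"
proof -
  assume t: "t > 0"
  have "(t powr (1 / d)) ^ m = (t powr (1 / d)) powr real m" using t by (subst powr_realpow) auto
  then show ?thesis by (simp add: powr_powr)
qed

text \<open>
  Here \<open>r\<close> is the length of the kernel that produces the derivatives and \<open>c\<close> its ratio to \<open>t\<^sup>1\<^sup>/\<^sup>d\<close>, to which the
  powers of time refer.
\<close>

lemma total_norm_conv_le:
  assumes t: "t > 0" and r: "0 < r" "r \<le> \<sigma>" "\<sigma> \<le> \<tau>" "1 \<le> \<tau>" and c: "c \<ge> 1" "t powr (1 / d) = c * r"
    and h: "integrable lborel h" and j: "j \<le> k"
    and K: "0 \<le> l" "l \<le> K" "K < p - real CARD('n)" and q: "1 \<le> q"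
    and E: "swnorm \<sigma> K h \<le> E" and fin: "E < \<infinity>"
    and v: "v = conv (scaled r) h"
  shows "total_norm t \<tau> l j q v
    \<le> ennreal (3 * (c ^ (CARD('n) + j) * (multiindex_count j * B * (1 + weight_mass K)))) * E"
proof -
  let ?A = "c ^ (CARD('n) + j) * (multiindex_count j * B * (1 + weight_mass K))"
  have K0: "0 \<le> K" using K by simp
  have nn: "0 \<le> multiindex_count j * B" "0 \<le> multiindex_count j * B * weight_mass K"
    using multiindex_count_nonneg B_nonneg weight_mass_nonneg by auto
  have le1: "c ^ (CARD('n) + j) * (multiindex_count j * B) \<le> ?A"
    using nn c by (intro mult_left_mono) (auto simp: algebra_simps)
  have "c ^ j \<le> c ^ (CARD('n) + j)" using c by (intro power_increasing) auto
  then have "c ^ j * (multiindex_count j * B * weight_mass K) \<le> c ^ (CARD('n) + j) * (multiindex_count j * B * weight_mass K)"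
    using nn by (intro mult_right_mono) auto
  also have "\<dots> \<le> ?A" using nn c by (intro mult_left_mono) (auto simp: algebra_simps)
  finally have le2: "c ^ j * (multiindex_count j * B * weight_mass K) \<le> ?A" .
  have A: "?A \<ge> 0" using multiindex_count_nonneg B_nonneg weight_mass_nonneg c by (intro mult_nonneg_nonneg) auto
  have E0: "l1norm h \<le> E"
  proof (rule order_trans[OF _ E])
    have "1 \<le> weight K (y /\<^sub>R \<sigma>)" for y :: "real ^ 'n"
      using K0 by (intro ge_one_powr_ge_zero) auto
    from mult_left_mono[OF this abs_ge_zero]
    show "l1norm h \<le> swnorm \<sigma> K h"
      by (intro nn_integral_mono ennreal_leI) (simp del: norm_scaleR)
  qed
  have Ck_v: "Ck_on k UNIV v" unfolding v by (rule Ck_on_conv_scaled[OF r(1) h])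
  have "total_norm t \<tau> l j q v \<le> 3 * (ennreal ?A * E)"
    unfolding total_norm_def
  proof (rule norms_le[OF continuous_on_nabla_norm[OF Ck_v j] nabla_norm_nonneg t q])
    show "0 < \<sigma>" "\<sigma> \<le> \<tau>" "1 \<le> \<tau>" "0 \<le> l" "l \<le> K" using r K by auto
    show "ennreal ?A * E < \<infinity>" using fin by (simp add: ennreal_mult_less_top)
    show "ennreal (t powr ((real CARD('n) + real j) / d) * nabla_norm j v x) \<le> ennreal ?A * E" for x
    proof -
      have "t powr ((real CARD('n) + real j) / d) = c ^ (CARD('n) + j) * r ^ (CARD('n) + j)"
        using powr_of_nat_div[OF t, of "CARD('n) + j"] by (simp only: c(2) power_mult_distrib of_nat_add)
      then have "ennreal (t powr ((real CARD('n) + real j) / d) * nabla_norm j v x)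
         = ennreal (c ^ (CARD('n) + j)) * ennreal (r ^ (CARD('n) + j) * nabla_norm j v x)"
        using c r nabla_norm_nonneg[of j v x] by (simp only: mult.assoc) (rule ennreal_mult, auto)
      also have "\<dots> \<le> ennreal (c ^ (CARD('n) + j)) * (ennreal (multiindex_count j * B) * E)"
        unfolding v by (intro mult_left_mono nabla_conv_sup_le r h j E0) auto
      also have "\<dots> = ennreal (c ^ (CARD('n) + j) * (multiindex_count j * B)) * E"
        using c nn by (simp add: ennreal_mult mult.assoc)
      also have "\<dots> \<le> ennreal ?A * E" by (intro mult_right_mono ennreal_leI le1) auto
      finally show ?thesis .
    qed
    show "ennreal (t powr (real j / d)) * (\<integral>\<^sup>+x. ennreal (nabla_norm j v x * weight K (x /\<^sub>R \<sigma>)) \<partial>lborel) \<le> ennreal ?A * E"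
    proof -
      have "t powr (real j / d) = c ^ j * r ^ j"
        using powr_of_nat_div[OF t, of j] by (simp only: c(2) power_mult_distrib)
      then have "ennreal (t powr (real j / d)) * (\<integral>\<^sup>+x. ennreal (nabla_norm j v x * weight K (x /\<^sub>R \<sigma>)) \<partial>lborel)
         = ennreal (c ^ j) * (ennreal (r ^ j) * (\<integral>\<^sup>+x. ennreal (nabla_norm j v x * weight K (x /\<^sub>R \<sigma>)) \<partial>lborel))"
        using c r by (simp add: ennreal_mult mult.assoc)
      also have "\<dots> \<le> ennreal (c ^ j) * (ennreal (multiindex_count j * B * weight_mass K) * E)"
        unfolding v by (intro mult_left_mono nabla_conv_weight_le r h j E K K0) auto
      also have "\<dots> = ennreal (c ^ j * (multiindex_count j * B * weight_mass K)) * E"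
        using c nn by (simp add: ennreal_mult mult.assoc)
      also have "\<dots> \<le> ennreal ?A * E" by (intro mult_right_mono ennreal_leI le2) auto
      finally show ?thesis .
    qed
  qed
  also have "3 * (ennreal ?A * E) = ennreal (3 * ?A) * E"
    using A by (subst ennreal_mult) (auto simp: mult.assoc)
  finally show ?thesis .
qed

end

section \<open>Decay for data without moments\<close>

lemma filterlim_half_powr:
  assumes "d > 0"
  shows "filterlim (\<lambda>t :: real. (t / 2) powr (1 / d)) at_top at_top"
  unfolding filterlim_at_top
proof
  fix Z :: real
  show "eventually (\<lambda>t. Z \<le> (t / 2) powr (1 / d)) at_top"
    using eventually_ge_at_top[of "2 * (max 1 Z) powr d"]
  proof eventually_elim
    case (elim t)
    have "Z \<le> ((max 1 Z) powr d) powr (1 / d)" using assms by (simp add: powr_powr)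
    also have "\<dots> \<le> (t / 2) powr (1 / d)" using elim assms by (intro powr_mono2) auto
    finally show ?case .
  qed
qed

context self_similar_semigroup
begin

text \<open>
  The theorem for data without moments. For \<open>t \<ge> 1\<close> the function at time \<open>t / 2\<close> is small in \<open>L\<^sup>1\<close> by cancellation,
  and the derivatives of order \<open>j\<close> are taken on the kernel of the remaining time \<open>t / 2\<close>. This separation is what
  makes \<open>\<lfloor>K\<rfloor> + 1\<close> derivatives sufficient for the Taylor formula, whatever \<open>j\<close> is. For \<open>t \<le> 1\<close> no cancellation is
  required and the derivatives are taken directly.
\<close>

lemma moment_free_estimate:
  assumes K: "0 \<le> l" "l \<le> K" "K < p - real CARD('n)" and m: "Suc (nat \<lfloor>K\<rfloor>) \<le> k"
    and j: "j \<le> k" and q: "1 \<le> q"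
  shows "\<exists>C\<ge>0. \<forall>w. w \<in> borel_measurable borel \<longrightarrow>
     wnorm K w < \<infinity> \<longrightarrow>
     moment_free K w \<longrightarrow>
     (\<forall>t>0. total_norm t ((1 + t) powr (1 / d)) l j q (conv (kern t) w)
        \<le> ennreal (C * (1 + t) powr (- (K / d))) * wnorm K w) \<and>
     ((\<lambda>t. ennreal (t powr (K / d)) * total_norm t (t powr (1 / d)) l j q (conv (kern t) w)) \<longlongrightarrow> 0) at_top"
proof -
  have K0: "0 \<le> K" using K by simp
  obtain C0 where C0: "C0 \<ge> 0"
    "\<And>w r. w \<in> borel_measurable borel \<Longrightarrow>
     wnorm K w < \<infinity> \<Longrightarrow>
     moment_free K w \<Longrightarrow> r > 0 \<Longrightarrow>
     swnorm r K (conv (scaled r) w) \<le> ennreal C0 * cancel_mass K w r"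
    using conv_moment_free_le[OF K0 K(3) m] by blast
  define c where "c = 2 powr (1 / d)"
  have c: "c \<ge> 1" unfolding c_def using d_pos by (intro ge_one_powr_ge_zero) auto
  define D where "D = multiindex_count j * B * (1 + weight_mass K)"
  have D: "D \<ge> 0" unfolding D_def using multiindex_count_nonneg B_nonneg weight_mass_nonneg by (intro mult_nonneg_nonneg) auto
  define A1 where "A1 = 3 * (c ^ (CARD('n) + j) * D)"
  have A1_eq: "3 * (c ^ (CARD('n) + j) * (multiindex_count j * B * (1 + weight_mass K))) = A1"
    by (simp only: A1_def D_def)
  define A2 where "A2 = 3 * (1 ^ (CARD('n) + j) * D)"
  have A: "A1 \<ge> 0" "A2 \<ge> 0" using D c by (auto simp: A1_def A2_def)
  define C where "C = (A1 * C0 + A2) * 4 powr (K / d)"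
  have C: "C \<ge> 0" using A C0 by (simp add: C_def)
  show ?thesis
  proof (rule exI[of _ C], intro conjI C allI impI)
    fix w :: "real ^ 'n \<Rightarrow> real"
    assume w: "w \<in> borel_measurable borel"
      and fin: "wnorm K w < \<infinity>"
      and mom: "moment_free K w"
    define W where "W = wnorm K w"
    have int_w: "integrable lborel w" by (rule integrable_of_weighted_0[OF w K0 fin])
    have cm_le: "cancel_mass K w r \<le> ennreal (r powr (- K)) * W" if "r > 0" for r
      unfolding W_def by (rule cancel_mass_le[OF w that K0])
    have cm_fin: "cancel_mass K w r < \<infinity>" if "r > 0" for r
    proof (rule order_le_less_trans[OF cm_le[OF that]])
      show "ennreal (r powr (- K)) * W < \<infinity>"
        using fin unfolding W_def[symmetric] by (simp add: ennreal_mult_less_top)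
    qed
    have big: "total_norm t \<tau> l j q (conv (kern t) w)
       \<le> ennreal (A1 * C0) * cancel_mass K w ((t / 2) powr (1 / d))"
      if t: "t > 0" and \<tau>: "1 \<le> \<tau>" "(t / 2) powr (1 / d) \<le> \<tau>" for t \<tau>
    proof -
      define r where "r = (t / 2) powr (1 / d)"
      have r: "r > 0" using t by (simp add: r_def)
      have half: "kern (t / 2) = scaled r" by (simp add: kern_def r_def)
      have cr: "t powr (1 / d) = c * r"
        unfolding c_def r_def using t by (subst powr_mult[symmetric]) auto
      have int: "integrable lborel (conv (scaled r) w)"
        by (rule integrable_conv[OF integrable_scaled[OF r] int_w])
      have "total_norm t \<tau> l j q (conv (kern t) w)
         \<le> ennreal (3 * (c ^ (CARD('n) + j) * (multiindex_count j * B * (1 + weight_mass K)))) * (ennreal C0 * cancel_mass K w r)"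
      proof (rule total_norm_conv_le[OF t r order_refl _ \<tau>(1) c cr int j K q])
        show "r \<le> \<tau>" using \<tau> by (simp add: r_def)
        show "swnorm r K (conv (scaled r) w) \<le> ennreal C0 * cancel_mass K w r"
          by (rule C0(2)[OF w fin mom r])
        show "ennreal C0 * cancel_mass K w r < \<infinity>" using cm_fin[OF r] by (simp add: ennreal_mult_less_top)
        show "conv (kern t) w = conv (scaled r) (conv (scaled r) w)"
          using conv_kern_split[of "t / 2" t w] t int_w by (simp add: half)
      qed
      also have "\<dots> = ennreal (A1 * C0) * cancel_mass K w r"
        unfolding A1_eq using A C0(1) by (simp add: ennreal_mult mult.assoc)
      finally show ?thesis by (simp add: r_def)
    qed
    have small: "total_norm t \<tau> l j q (conv (kern t) w)
       \<le> ennreal A2 * W" if t: "0 < t" "t \<le> 1" and \<tau>: "1 \<le> \<tau>" for t \<tau>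
      unfolding A2_def D_def
    proof (rule total_norm_conv_le[where \<sigma> = 1 and r = "t powr (1 / d)", OF t(1) _ _ \<tau> \<tau> order_refl _ int_w j K q])
      show "t powr (1 / d) \<le> 1" using t d_pos powr_mono2[of "1 / d" t 1] by simp
      show "swnorm 1 K w \<le> W" by (simp add: W_def)
      show "W < \<infinity>" using fin by (simp add: W_def)
    qed (use t in \<open>auto simp: kern_def\<close>)
    \<comment> \<open>A time \<open>x\<close> may be replaced by \<open>1 + t\<close> as soon as \<open>x \<ge> (1 + t) / 4\<close>; this holds for \<open>x = 1\<close> if \<open>t \<le> 1\<close>, and for \<open>x = t / 2\<close> if \<open>t \<ge> 1\<close>.\<close>
    have four: "x powr (- (K / d)) \<le> 4 powr (K / d) * (1 + t) powr (- (K / d))" if "0 < t" "(1 + t) / 4 \<le> x" for x t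
    proof -
      have "x powr (- (K / d)) \<le> ((1 + t) / 4) powr (- (K / d))"
        using that K0 d_pos by (intro powr_mono2') auto
      also have "\<dots> = (1 + t) powr (- (K / d)) / 4 powr (- (K / d))"
        by (rule powr_divide)
      also have "\<dots> = 4 powr (K / d) * (1 + t) powr (- (K / d))"
        by (simp only: powr_minus[of 4] divide_inverse inverse_inverse_eq mult.commute)
      finally show ?thesis .
    qed
    show "total_norm t ((1 + t) powr (1 / d)) l j q (conv (kern t) w)
        \<le> ennreal (C * (1 + t) powr (- (K / d))) * wnorm K w" if t: "t > 0" for t
    proof -
      define \<tau> where "\<tau> = (1 + t) powr (1 / d)"
      have \<tau>: "1 \<le> \<tau>" unfolding \<tau>_def using t d_pos by (intro ge_one_powr_ge_zero) auto
      let ?L = "total_norm t \<tau> l j q (conv (kern t) w)"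
      let ?s = "4 powr (K / d) * (1 + t) powr (- (K / d))"
      have "?L \<le> ennreal ((A1 * C0 + A2) * ?s) * W"
      proof (cases "t \<le> 1")
        case True
        have "1 \<le> ?s" using four[of t 1] t True by simp
        then have "A2 * 1 \<le> (A1 * C0 + A2) * ?s" using A C0(1) by (intro mult_mono) auto
        then have "ennreal A2 * W \<le> ennreal ((A1 * C0 + A2) * ?s) * W" by (intro mult_right_mono ennreal_leI) auto
        with small[OF t True \<tau>] show ?thesis by (rule order_trans)
      next
        case False
        define r where "r = (t / 2) powr (1 / d)"
        have r: "r > 0" using t by (simp add: r_def)
        have "r \<le> \<tau>" unfolding r_def \<tau>_def using t d_pos by (intro powr_mono2) auto
        from big[OF t \<tau> this[unfolded r_def]] have "?L \<le> ennreal (A1 * C0) * cancel_mass K w r"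
          unfolding r_def .
        also have "\<dots> \<le> ennreal (A1 * C0) * (ennreal (r powr (- K)) * W)"
          by (intro mult_left_mono cm_le r) auto
        also have "r powr (- K) = (t / 2) powr (- (K / d))" by (simp add: r_def powr_powr)
        also have "ennreal (A1 * C0) * (ennreal ((t / 2) powr (- (K / d))) * W) = ennreal (A1 * C0 * (t / 2) powr (- (K / d))) * W"
          using A C0(1) by (simp add: ennreal_mult mult.assoc)
        also have "\<dots> \<le> ennreal ((A1 * C0 + A2) * ?s) * W"
          using four[of t "t / 2"] False A C0(1) by (intro mult_right_mono ennreal_leI mult_mono) auto
        finally show ?thesis .
      qed
      then show ?thesis unfolding C_def W_def \<tau>_def by (simp only: mult.assoc)
    qed
    let ?f = "\<lambda>t. ennreal (t powr (K / d)) * total_norm t (t powr (1 / d)) l j q (conv (kern t) w)"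
    let ?r = "\<lambda>t. (t / 2) powr (1 / d)"
    let ?g = "\<lambda>t. ennreal (A1 * C0 * 2 powr (K / d)) * (ennreal (?r t powr K) * cancel_mass K w (?r t))"
    have "((\<lambda>t. ennreal (?r t powr K) * cancel_mass K w (?r t)) \<longlongrightarrow> 0) at_top"
      by (rule filterlim_compose[OF cancel_mass_tendsto_0[OF w K0 fin] filterlim_half_powr[OF d_pos]])
    then have "(?g \<longlongrightarrow> ennreal (A1 * C0 * 2 powr (K / d)) * 0) at_top"
      by (intro ennreal_tendsto_cmult) auto
    then have g_lim: "(?g \<longlongrightarrow> 0) at_top" by simp
    have le: "eventually (\<lambda>t. ?f t \<le> ?g t) at_top"
      using eventually_ge_at_top[of 1]
    proof eventually_elim
      case (elim t)
      then have t: "t > 0" by simp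
      define \<tau> where "\<tau> = t powr (1 / d)"
      have \<tau>: "1 \<le> \<tau>" "?r t \<le> \<tau>"
        unfolding \<tau>_def using elim d_pos by (intro ge_one_powr_ge_zero powr_mono2; simp)+
      have "?f t \<le> ennreal (t powr (K / d)) * (ennreal (A1 * C0) * cancel_mass K w (?r t))"
        using big[OF t \<tau>] unfolding \<tau>_def by (intro mult_left_mono) auto
      also have "\<dots> = ?g t"
      proof -
        have "t powr (K / d) = 2 powr (K / d) * ?r t powr K"
          using t by (simp add: powr_powr powr_divide)
        then have "ennreal (t powr (K / d)) = ennreal (2 powr (K / d)) * ennreal (?r t powr K)"
          by (simp only: ennreal_mult powr_ge_zero)
        moreover have "ennreal (A1 * C0 * 2 powr (K / d)) = ennreal (A1 * C0) * ennreal (2 powr (K / d))"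
          by (rule ennreal_mult) (use A C0(1) in auto)
        ultimately show ?thesis by (simp only: mult_ac)
      qed
      finally show ?case .
    qed
    show "(?f \<longlongrightarrow> 0) at_top"
      by (rule tendsto_sandwich[OF _ le tendsto_const g_lim]) simp
  qed
qed

section \<open>Removing the moments\<close>

text \<open>
  The function \<open>g\<^sub>\<beta>\<close> at time zero.
\<close>

definition profile_term :: "('n \<Rightarrow> nat) \<Rightarrow> real ^ 'n \<Rightarrow> real" where
  "profile_term \<beta> x = (- 1) ^ mi_abs \<beta> / mi_fact \<beta> * word_deriv (mi_word \<beta>) F x"

lemma mi_fact_pos: "mi_fact \<beta> > 0"
  unfolding mi_fact_def by (intro prod_pos) simp

lemma order_bounded:
  assumes "real (mi_abs \<beta>) \<le> K" "Suc (nat \<lfloor>K\<rfloor>) \<le> k"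
  shows "mi_abs \<beta> \<le> k"
  using le_nat_floor[OF assms(1)] assms(2) by simp

lemma measurable_profile_term: "mi_abs \<beta> \<le> k \<Longrightarrow> profile_term \<beta> \<in> borel_measurable borel"
  unfolding profile_term_def[abs_def] using measurable_word_deriv[of "mi_word \<beta>"]
  by (intro borel_measurable_times) (auto simp: length_mi_word)

lemma profile_term_mass:
  assumes \<beta>: "mi_abs \<beta> \<le> k" and K: "K < p - real CARD('n)"
  shows "wnorm K (profile_term \<beta>) < \<infinity>"
proof -
  define c where "c = B / mi_fact \<beta>"
  have c: "c \<ge> 0" using B_nonneg mi_fact_pos[of \<beta>] by (simp add: c_def)
  have "wnorm K (profile_term \<beta>)
      \<le> (\<integral>\<^sup>+y. ennreal c * ennreal (weight (K - p) (y :: real ^ 'n)) \<partial>lborel)"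
  proof (rule nn_integral_mono)
    fix y :: "real ^ 'n"
    have "\<bar>profile_term \<beta> y\<bar> = \<bar>word_deriv (mi_word \<beta>) F y\<bar> / mi_fact \<beta>"
      using mi_fact_pos[of \<beta>] by (simp add: profile_term_def abs_mult abs_divide power_abs)
    also have "\<dots> \<le> (B * weight (- p) y) / mi_fact \<beta>"
      using decay[of "mi_word \<beta>" y] \<beta> mi_fact_pos[of \<beta>] by (intro divide_right_mono) (auto simp: length_mi_word)
    finally have "\<bar>profile_term \<beta> y\<bar> * weight K y \<le> c * weight (- p) y * weight K y"
      by (intro mult_right_mono) (auto simp: c_def)
    also have "\<dots> = c * weight (K - p) y" by (simp only: mult.assoc weight_powr_combine)
    finally show "ennreal (\<bar>profile_term \<beta> y\<bar> * weight K y) \<le> ennreal c * ennreal (weight (K - p) y)"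
      using c by (subst ennreal_mult[symmetric]) (auto intro: ennreal_leI)
  qed
  also have "\<dots> = ennreal c * ennreal (weight_mass K)"
    by (subst nn_integral_cmult) (auto simp: nn_weight_mass[OF K])
  also have "\<dots> < \<infinity>" by (simp add: ennreal_mult_less_top)
  finally show ?thesis .
qed

lemma moment_profile_term:
  assumes "real (mi_abs \<alpha>) < p - real CARD('n)" "mi_abs \<beta> \<le> k" and mass: "(LBINT x. F x) = 1"
  shows "\<not> \<beta> \<le> \<alpha> \<Longrightarrow> (LBINT x. mi_power x \<alpha> * profile_term \<beta> x) = 0"
    and "\<beta> = \<alpha> \<Longrightarrow> (LBINT x. mi_power x \<alpha> * profile_term \<beta> x) = 1"
proof -
  have len: "length (mi_word \<beta>) \<le> k" using assms(2) by (simp add: length_mi_word)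
  have eq: "(LBINT x. mi_power x \<alpha> * profile_term \<beta> x)
      = (- 1) ^ mi_abs \<beta> / mi_fact \<beta> * (LBINT x. mi_power x \<alpha> * word_deriv (mi_word \<beta>) F x)"
    unfolding profile_term_def by (subst integral_mult_right_zero[symmetric]) (simp add: mult.left_commute)
  show "\<not> \<beta> \<le> \<alpha> \<Longrightarrow> (LBINT x. mi_power x \<alpha> * profile_term \<beta> x) = 0"
    using moment_word_deriv_eq_0[OF len assms(1)] by (simp add: eq count_mset_mi_word)
  assume e: "\<beta> = \<alpha>"
  have "(LBINT x. mi_power x \<alpha> * word_deriv (mi_word \<beta>) F x) = (- 1) ^ mi_abs \<alpha> * mi_fact \<alpha> * 1"
    using moment_word_deriv_diag[OF len assms(1)] mass e by (simp add: count_mset_mi_word)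
  then have "(LBINT x. mi_power x \<alpha> * profile_term \<beta> x)
     = (- 1) ^ mi_abs \<beta> / mi_fact \<beta> * ((- 1) ^ mi_abs \<alpha> * mi_fact \<alpha> * 1)"
    by (simp only: eq)
  also have "\<dots> = 1" using mi_fact_pos[of \<alpha>] e by (simp add: power_mult_distrib[symmetric])
  finally show "(LBINT x. mi_power x \<alpha> * profile_term \<beta> x) = 1" .
qed

text \<open>
  The recursion that defines \<open>M\<^sub>\<alpha>(\<phi>, 0)\<close>, as a property of a family of numbers. For \<open>\<alpha> = 0\<close> the sum is empty and
  the monomial is one, so that the initial case of the recursion is included.
\<close>

definition moment_rec :: "real \<Rightarrow> (real ^ 'n \<Rightarrow> real) \<Rightarrow> (('n \<Rightarrow> nat) \<Rightarrow> real) \<Rightarrow> bool" where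
  "moment_rec K \<phi> M \<longleftrightarrow> (\<forall>\<alpha>. real (mi_abs \<alpha>) \<le> K \<longrightarrow>
     M \<alpha> = (LBINT x. mi_power x \<alpha> * \<phi> x)
       - (\<Sum>\<beta> | \<beta> \<le> \<alpha> \<and> \<beta> \<noteq> \<alpha>. M \<beta> * (LBINT x. mi_power x \<alpha> * profile_term \<beta> x)))"

text \<open>
  The datum of the error of the expansion.
\<close>

definition corrected :: "real \<Rightarrow> (real ^ 'n \<Rightarrow> real) \<Rightarrow> (('n \<Rightarrow> nat) \<Rightarrow> real) \<Rightarrow> real ^ 'n \<Rightarrow> real" where
  "corrected K \<phi> M x = \<phi> x - (\<Sum>\<beta> | real (mi_abs \<beta>) \<le> K. M \<beta> * profile_term \<beta> x)"

lemma measurable_corrected: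
  assumes m: "Suc (nat \<lfloor>K\<rfloor>) \<le> k" and \<phi>: "\<phi> \<in> borel_measurable borel"
  shows "corrected K \<phi> M \<in> borel_measurable borel"
  unfolding corrected_def[abs_def]
  by (intro borel_measurable_diff \<phi> borel_measurable_sum borel_measurable_times borel_measurable_const measurable_profile_term)
     (auto intro: order_bounded[OF _ m])

text \<open>
  By triangularity only \<open>\<beta> \<le> \<alpha>\<close> contribute to the moment of order \<open>\<alpha>\<close>; the term \<open>\<beta> = \<alpha>\<close> contributes \<open>M\<^sub>\<alpha>\<close>
  because the kernel has mass one, and the recursion is exactly the statement that the total vanishes.
\<close>

lemma corrected_moment_free:
  assumes K: "0 \<le> K" "K < p - real CARD('n)" and m: "Suc (nat \<lfloor>K\<rfloor>) \<le> k"
    and mass: "(LBINT x. F x) = 1" and \<phi>: "\<phi> \<in> borel_measurable borel"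
    and fin: "wnorm K \<phi> < \<infinity>"
    and M: "moment_rec K \<phi> M" and \<alpha>: "real (mi_abs \<alpha>) \<le> K"
  shows "(LBINT y. mi_power y \<alpha> * corrected K \<phi> M y) = 0"
proof -
  let ?S = "{\<beta> :: 'n \<Rightarrow> nat. real (mi_abs \<beta>) \<le> K}"
  have \<alpha>': "real (mi_abs \<alpha>) < p - real CARD('n)" using \<alpha> K by simp
  have int_\<phi>: "integrable lborel (\<lambda>y. mi_power y \<alpha> * \<phi> y)" by (rule integrable_of_weighted[OF \<phi> K(1) fin \<alpha>])
  have int_g: "integrable lborel (\<lambda>y. M \<beta> * (mi_power y \<alpha> * profile_term \<beta> y))" if "\<beta> \<in> ?S" for \<beta>
  proof -
    have k: "mi_abs \<beta> \<le> k" using that order_bounded[OF _ m] by auto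
    show ?thesis
      by (rule integrable_mult_right) (rule integrable_of_weighted[OF measurable_profile_term[OF k] K(1) profile_term_mass[OF k K(2)] \<alpha>])
  qed
  have "(LBINT y. mi_power y \<alpha> * corrected K \<phi> M y)
     = (LBINT y. mi_power y \<alpha> * \<phi> y - (\<Sum>\<beta>\<in>?S. M \<beta> * (mi_power y \<alpha> * profile_term \<beta> y)))"
    by (simp add: corrected_def right_diff_distrib sum_distrib_left mult.left_commute)
  also have "\<dots> = (LBINT y. mi_power y \<alpha> * \<phi> y) - (LBINT y. (\<Sum>\<beta>\<in>?S. M \<beta> * (mi_power y \<alpha> * profile_term \<beta> y)))"
    by (rule Bochner_Integration.integral_diff[OF int_\<phi>]) (rule Bochner_Integration.integrable_sum[OF int_g])
  also have "(LBINT y. (\<Sum>\<beta>\<in>?S. M \<beta> * (mi_power y \<alpha> * profile_term \<beta> y)))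
      = (\<Sum>\<beta>\<in>?S. M \<beta> * (LBINT y. mi_power y \<alpha> * profile_term \<beta> y))"
    by (subst Bochner_Integration.integral_sum[OF int_g]) auto
  also have "\<dots> = (\<Sum>\<beta>\<in>insert \<alpha> {\<beta>. \<beta> \<le> \<alpha> \<and> \<beta> \<noteq> \<alpha>}. M \<beta> * (LBINT y. mi_power y \<alpha> * profile_term \<beta> y))"
  proof (rule sum.mono_neutral_right[OF finite_mi_abs_le])
    show "insert \<alpha> {\<beta>. \<beta> \<le> \<alpha> \<and> \<beta> \<noteq> \<alpha>} \<subseteq> ?S"
      using \<alpha> by (auto dest!: mi_abs_mono)
    show "\<forall>\<beta>\<in>?S - insert \<alpha> {\<beta>. \<beta> \<le> \<alpha> \<and> \<beta> \<noteq> \<alpha>}. M \<beta> * (LBINT y. mi_power y \<alpha> * profile_term \<beta> y) = 0"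
      using moment_profile_term(1)[OF \<alpha>' order_bounded[OF _ m] mass] by auto
  qed
  also have "\<dots> = M \<alpha> + (\<Sum>\<beta> | \<beta> \<le> \<alpha> \<and> \<beta> \<noteq> \<alpha>. M \<beta> * (LBINT y. mi_power y \<alpha> * profile_term \<beta> y))"
    by (subst sum.insert) (auto simp: finite_mi_below moment_profile_term(2)[OF \<alpha>' order_bounded[OF \<alpha> m] mass refl])
  also have "M \<alpha> = (LBINT x. mi_power x \<alpha> * \<phi> x)
       - (\<Sum>\<beta> | \<beta> \<le> \<alpha> \<and> \<beta> \<noteq> \<alpha>. M \<beta> * (LBINT x. mi_power x \<alpha> * profile_term \<beta> x))"
    using M \<alpha> by (simp add: moment_rec_def)
  finally show ?thesis by simp
qed

text \<open>
  The constant must not depend on \<open>\<phi>\<close>. It is built up along the order of \<open>\<alpha>\<close>; the crude sum \<open>J\<close> of all moments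
  of the functions \<open>g\<^sub>\<beta>\<close> serves every step.
\<close>

lemma moment_rec_bound:
  assumes K: "0 \<le> K"
  shows "\<exists>C<\<infinity>. \<forall>\<alpha> \<phi> M. real (mi_abs \<alpha>) \<le> K \<longrightarrow> \<phi> \<in> borel_measurable borel \<longrightarrow> wnorm K \<phi> < \<infinity> \<longrightarrow>
    moment_rec K \<phi> M \<longrightarrow> ennreal \<bar>M \<alpha>\<bar> \<le> C * wnorm K \<phi>"
proof -
  let ?S = "{\<beta> :: 'n \<Rightarrow> nat. real (mi_abs \<beta>) \<le> K}"
  define I where "I \<alpha> \<beta> = (LBINT x. mi_power x \<alpha> * profile_term \<beta> x)" for \<alpha> \<beta>
  \<comment> \<open>Finite because the sums are; the moments \<open>I \<alpha> \<beta>\<close> do not involve \<open>\<phi>\<close>.\<close>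
  define J where "J = (\<Sum>\<alpha>\<in>?S. \<Sum>\<beta>\<in>?S. ennreal \<bar>I \<alpha> \<beta>\<bar>)"
  have J: "J < \<infinity>" by (simp add: J_def)
  have "\<exists>C<\<infinity>. \<forall>\<alpha> \<phi> M. mi_abs \<alpha> < n \<longrightarrow> real (mi_abs \<alpha>) \<le> K \<longrightarrow> \<phi> \<in> borel_measurable borel \<longrightarrow> wnorm K \<phi> < \<infinity> \<longrightarrow>
    moment_rec K \<phi> M \<longrightarrow> ennreal \<bar>M \<alpha>\<bar> \<le> C * wnorm K \<phi>" for n
  proof (induction n)
    case 0
    show ?case by (intro exI[of _ 0]) simp
  next
    case (Suc n)
    then obtain C where C: "C < \<infinity>" "\<And>\<alpha> \<phi> M. mi_abs \<alpha> < n \<Longrightarrow> real (mi_abs \<alpha>) \<le> K \<Longrightarrow> \<phi> \<in> borel_measurable borel \<Longrightarrow>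
      wnorm K \<phi> < \<infinity> \<Longrightarrow> moment_rec K \<phi> M \<Longrightarrow> ennreal \<bar>M \<alpha>\<bar> \<le> C * wnorm K \<phi>" by auto
    show ?case
    proof (intro exI[of _ "1 + C * J"] conjI allI impI)
      show "1 + C * J < \<infinity>" using C(1) J by (simp add: ennreal_mult_less_top)
      fix \<alpha> :: "'n \<Rightarrow> nat" and \<phi> :: "real ^ 'n \<Rightarrow> real" and M
      assume \<alpha>: "mi_abs \<alpha> < Suc n" "real (mi_abs \<alpha>) \<le> K"
        and \<phi>: "\<phi> \<in> borel_measurable borel" and fin: "wnorm K \<phi> < \<infinity>" and M: "moment_rec K \<phi> M"
      let ?T = "{\<beta>. \<beta> \<le> \<alpha> \<and> \<beta> \<noteq> \<alpha>}"
      have T: "mi_abs \<beta> < n" "real (mi_abs \<beta>) \<le> K" if "\<beta> \<in> ?T" for \<beta>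
        using that mi_abs_strict_mono[of \<beta> \<alpha>] \<alpha> by auto
      have "ennreal \<bar>LBINT x. mi_power x \<alpha> * \<phi> x\<bar> \<le> (\<integral>\<^sup>+x. ennreal (norm (mi_power x \<alpha> * \<phi> x)) \<partial>lborel)"
        using integral_norm_bound_ennreal[OF integrable_of_weighted[OF \<phi> K fin \<alpha>(2)]] by simp
      also have "\<dots> \<le> wnorm K \<phi>"
        using abs_mi_power_le_weight[OF \<alpha>(2)]
        by (intro nn_integral_mono ennreal_leI) (auto simp: abs_mult mult.commute intro!: mult_left_mono)
      finally have 1: "ennreal \<bar>LBINT x. mi_power x \<alpha> * \<phi> x\<bar> \<le> wnorm K \<phi>" .
      have "ennreal \<bar>\<Sum>\<beta>\<in>?T. M \<beta> * I \<alpha> \<beta>\<bar> \<le> ennreal (\<Sum>\<beta>\<in>?T. \<bar>M \<beta>\<bar> * \<bar>I \<alpha> \<beta>\<bar>)"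
        unfolding abs_mult[symmetric] by (intro ennreal_leI sum_abs)
      also have "\<dots> = (\<Sum>\<beta>\<in>?T. ennreal \<bar>M \<beta>\<bar> * ennreal \<bar>I \<alpha> \<beta>\<bar>)"
        by (subst sum_ennreal[symmetric]) (auto simp: ennreal_mult)
      also have "\<dots> \<le> (\<Sum>\<beta>\<in>?T. C * wnorm K \<phi> * ennreal \<bar>I \<alpha> \<beta>\<bar>)"
        by (intro sum_mono mult_right_mono C(2)[OF T \<phi> fin M]) auto
      also have "\<dots> = C * wnorm K \<phi> * (\<Sum>\<beta>\<in>?T. ennreal \<bar>I \<alpha> \<beta>\<bar>)" by (rule sum_distrib_left[symmetric])
      also have "\<dots> \<le> C * wnorm K \<phi> * J"
      proof (rule mult_left_mono)
        have "(\<Sum>\<beta>\<in>?T. ennreal \<bar>I \<alpha> \<beta>\<bar>) \<le> (\<Sum>\<beta>\<in>?S. ennreal \<bar>I \<alpha> \<beta>\<bar>)"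
          using T by (intro sum_mono2 finite_mi_abs_le) auto
        also have "\<dots> \<le> J"
          unfolding J_def using \<alpha> by (intro member_le_sum finite_mi_abs_le) auto
        finally show "(\<Sum>\<beta>\<in>?T. ennreal \<bar>I \<alpha> \<beta>\<bar>) \<le> J" .
      qed simp
      finally have 2: "ennreal \<bar>\<Sum>\<beta>\<in>?T. M \<beta> * I \<alpha> \<beta>\<bar> \<le> C * wnorm K \<phi> * J" .
      have "M \<alpha> = (LBINT x. mi_power x \<alpha> * \<phi> x) - (\<Sum>\<beta>\<in>?T. M \<beta> * I \<alpha> \<beta>)"
        using M \<alpha> by (simp add: moment_rec_def I_def)
      then have "ennreal \<bar>M \<alpha>\<bar> \<le> ennreal (\<bar>LBINT x. mi_power x \<alpha> * \<phi> x\<bar> + \<bar>\<Sum>\<beta>\<in>?T. M \<beta> * I \<alpha> \<beta>\<bar>)"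
        by (intro ennreal_leI) (simp add: abs_triangle_ineq4)
      also have "\<dots> \<le> wnorm K \<phi> + C * wnorm K \<phi> * J"
        using add_mono[OF 1 2] by simp
      also have "\<dots> = (1 + C * J) * wnorm K \<phi>" by (simp add: distrib_right mult_ac)
      finally show "ennreal \<bar>M \<alpha>\<bar> \<le> (1 + C * J) * wnorm K \<phi>" .
    qed
  qed
  from this[of "Suc (nat \<lfloor>K\<rfloor>)"] obtain C where C: "C < \<infinity> \<and> (\<forall>\<alpha> \<phi> M. mi_abs \<alpha> < Suc (nat \<lfloor>K\<rfloor>) \<longrightarrow>
    real (mi_abs \<alpha>) \<le> K \<longrightarrow> \<phi> \<in> borel_measurable borel \<longrightarrow> wnorm K \<phi> < \<infinity> \<longrightarrow>
    moment_rec K \<phi> M \<longrightarrow> ennreal \<bar>M \<alpha>\<bar> \<le> C * wnorm K \<phi>)" ..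
  have "mi_abs \<alpha> < Suc (nat \<lfloor>K\<rfloor>)" if "real (mi_abs \<alpha>) \<le> K" for \<alpha> :: "'n \<Rightarrow> nat"
    using le_nat_floor[OF that] by simp
  with C show ?thesis by (intro exI[of _ C]) simp
qed

lemma corrected_norm_bound:
  assumes K: "0 \<le> K" "K < p - real CARD('n)" and m: "Suc (nat \<lfloor>K\<rfloor>) \<le> k"
  shows "\<exists>C\<ge>0. \<forall>\<phi> M. \<phi> \<in> borel_measurable borel \<longrightarrow> wnorm K \<phi> < \<infinity> \<longrightarrow> moment_rec K \<phi> M \<longrightarrow>
    wnorm K (corrected K \<phi> M) \<le> ennreal C * wnorm K \<phi>"
proof -
  let ?S = "{\<beta> :: 'n \<Rightarrow> nat. real (mi_abs \<beta>) \<le> K}"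
  obtain C where C: "C < \<infinity>" "\<And>\<alpha> \<phi> M. real (mi_abs \<alpha>) \<le> K \<Longrightarrow> \<phi> \<in> borel_measurable borel \<Longrightarrow> wnorm K \<phi> < \<infinity> \<Longrightarrow>
    moment_rec K \<phi> M \<Longrightarrow> ennreal \<bar>M \<alpha>\<bar> \<le> C * wnorm K \<phi>"
    using moment_rec_bound[OF K(1)] by auto
  define D where "D = 1 + C * (\<Sum>\<beta>\<in>?S. wnorm K (profile_term \<beta>))"
  have "(\<Sum>\<beta>\<in>?S. wnorm K (profile_term \<beta>)) < \<infinity>"
    using profile_term_mass[OF order_bounded[OF _ m] K(2)] by (simp add: finite_mi_abs_le)
  then have "D < \<infinity>" using C(1) by (simp add: D_def ennreal_mult_less_top)
  then obtain c where c: "c \<ge> 0" "D = ennreal c" by (cases D) auto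
  show ?thesis
  proof (intro exI[of _ c] conjI allI impI c(1))
    fix \<phi> :: "real ^ 'n \<Rightarrow> real" and M
    assume \<phi>: "\<phi> \<in> borel_measurable borel" and fin: "wnorm K \<phi> < \<infinity>" and M: "moment_rec K \<phi> M"
    have "wnorm K (corrected K \<phi> M) \<le> wnorm K \<phi> + (\<Sum>\<beta>\<in>?S. ennreal \<bar>M \<beta>\<bar> * wnorm K (profile_term \<beta>))"
      unfolding corrected_def
      by (rule wnorm_diff_sum_le[OF finite_mi_abs_le \<phi> measurable_profile_term]) (auto intro: order_bounded[OF _ m])
    also have "\<dots> \<le> wnorm K \<phi> + (\<Sum>\<beta>\<in>?S. C * wnorm K \<phi> * wnorm K (profile_term \<beta>))"
      by (intro add_left_mono sum_mono mult_right_mono C(2)[OF _ \<phi> fin M]) auto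
    also have "\<dots> = D * wnorm K \<phi>"
      unfolding D_def distrib_right mult_1_left sum_distrib_left sum_distrib_right
      by (intro arg_cong2[where f = "(+)"] refl sum.cong) (simp add: mult_ac)
    finally show "wnorm K (corrected K \<phi> M) \<le> ennreal c * wnorm K \<phi>" unfolding c(2) .
  qed
qed

text \<open>
  The evolution takes \<open>g\<^sub>\<beta>\<close> at time zero to \<open>g\<^sub>\<beta>\<close> at time \<open>t\<close>: by commutativity of the convolution the derivative
  may be pulled out of it, and the semigroup property evaluates what is left.
\<close>

lemma conv_kern_profile_term:
  assumes t: "t > 0" and \<beta>: "mi_abs \<beta> \<le> k"
  shows "conv (kern t) (profile_term \<beta>) x = (- 1) ^ mi_abs \<beta> / mi_fact \<beta> * word_deriv (mi_word \<beta>) (kern (t + 1)) x"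
proof -
  let ?D = "word_deriv (mi_word \<beta>)"
  have len: "length (mi_word \<beta>) \<le> k" using \<beta> by (simp add: length_mi_word)
  have F: "scaled 1 = F" using kern_1 by (simp add: kern_def)
  have "conv (kern t) (profile_term \<beta>) x = (- 1) ^ mi_abs \<beta> / mi_fact \<beta> * conv (kern t) (?D F) x"
    unfolding conv_def profile_term_def by (subst integral_mult_right_zero[symmetric]) (simp add: mult.left_commute)
  also have "conv (kern t) (?D F) x = conv (?D F) (kern t) x"
    by (rule conv_commute) (auto simp: kern_def intro: measurable_word_deriv len)
  also have "conv (?D F) (kern t) = ?D (conv F (kern t))"
    using word_deriv_conv_scaled[OF zero_less_one integrable_kern[OF t] len] unfolding F by simp
  also have "conv F (kern t) = kern (t + 1)"
    using kern_semigroup[of t "t + 1"] t by (simp add: kern_1)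
  finally show ?thesis .
qed

text \<open>
  The function \<open>v\<close> of the theorem, for Borel measurable data and coefficients \<open>M\<close>.
\<close>

definition expansion_error :: "real \<Rightarrow> (real ^ 'n \<Rightarrow> real) \<Rightarrow> (('n \<Rightarrow> nat) \<Rightarrow> real) \<Rightarrow> real \<Rightarrow> real ^ 'n \<Rightarrow> real" where
  "expansion_error K \<phi> M t x = conv (kern t) \<phi> x
     - (\<Sum>\<beta> | real (mi_abs \<beta>) \<le> K. M \<beta> * ((- 1) ^ mi_abs \<beta> / mi_fact \<beta> * word_deriv (mi_word \<beta>) (kern (t + 1)) x))"

lemma conv_kern_corrected:
  assumes K: "0 \<le> K" "K < p - real CARD('n)" and m: "Suc (nat \<lfloor>K\<rfloor>) \<le> k"
    and \<phi>: "\<phi> \<in> borel_measurable borel"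
    and fin: "wnorm K \<phi> < \<infinity>" and t: "t > 0"
  shows "conv (kern t) (corrected K \<phi> M) = expansion_error K \<phi> M t"
proof
  fix x
  let ?S = "{\<beta> :: 'n \<Rightarrow> nat. real (mi_abs \<beta>) \<le> K}"
  have r: "t powr (1 / d) > 0" using t by simp
  have ik: "integrable lborel (\<lambda>y. kern t (x - y) * h y)" if "integrable lborel h" for h
    using integrable_conv_kernel[OF r that, of "[]" x] by (simp add: kern_def)
  have i\<phi>: "integrable lborel (\<lambda>y. kern t (x - y) * \<phi> y)"
    by (rule ik) (rule integrable_of_weighted_0[OF \<phi> K(1) fin])
  have ig: "integrable lborel (\<lambda>y. M \<beta> * (kern t (x - y) * profile_term \<beta> y))" if "\<beta> \<in> ?S" for \<beta>
  proof -
    have k: "mi_abs \<beta> \<le> k" using that order_bounded[OF _ m] by auto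
    show ?thesis
      by (rule integrable_mult_right, rule ik, rule integrable_of_weighted_0[OF measurable_profile_term[OF k] K(1) profile_term_mass[OF k K(2)]])
  qed
  have "conv (kern t) (corrected K \<phi> M) x
      = (LBINT y. kern t (x - y) * \<phi> y - (\<Sum>\<beta>\<in>?S. M \<beta> * (kern t (x - y) * profile_term \<beta> y)))"
    by (simp add: conv_def corrected_def right_diff_distrib sum_distrib_left mult.left_commute)
  also have "\<dots> = conv (kern t) \<phi> x - (LBINT y. (\<Sum>\<beta>\<in>?S. M \<beta> * (kern t (x - y) * profile_term \<beta> y)))"
    unfolding conv_def
    by (rule Bochner_Integration.integral_diff[OF i\<phi>]) (rule Bochner_Integration.integrable_sum[OF ig])
  also have "(LBINT y. (\<Sum>\<beta>\<in>?S. M \<beta> * (kern t (x - y) * profile_term \<beta> y))) = (\<Sum>\<beta>\<in>?S. M \<beta> * conv (kern t) (profile_term \<beta>) x)"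
    unfolding conv_def by (subst Bochner_Integration.integral_sum[OF ig]) auto
  also have "\<dots> = (\<Sum>\<beta>\<in>?S. M \<beta> * ((- 1) ^ mi_abs \<beta> / mi_fact \<beta> * word_deriv (mi_word \<beta>) (kern (t + 1)) x))"
    by (intro sum.cong refl arg_cong2[where f = "(*)"] conv_kern_profile_term t) (auto intro: order_bounded[OF _ m])
  finally show "conv (kern t) (corrected K \<phi> M) x = expansion_error K \<phi> M t x" by (simp add: expansion_error_def)
qed

lemma expansion_error_of_trivial_kernel:
  assumes "\<And>x. F x = 0"
  shows "expansion_error K \<phi> M t = (\<lambda>_. 0)"
proof -
  have "kern s = (\<lambda>_. 0)" for s by (simp add: kern_def scaled_def[abs_def] assms)
  moreover have "word_deriv is (\<lambda>_. 0) = (\<lambda>_ :: real ^ 'n. 0)" for "is"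
    by (induction "is") (auto simp: dir_deriv_def)
  ultimately show ?thesis by (simp add: expansion_error_def[abs_def] conv_def)
qed

text \<open>
  The error of the expansion is the evolution of a datum without moments whose norm is controlled by that of
  \<open>\<phi>\<close>. If the kernel has mass one, this datum is \<open>corrected K \<phi> M\<close>; if the kernel vanishes, it is zero.
\<close>

lemma expansion_error_eq_conv:
  assumes K: "0 \<le> K" "K < p - real CARD('n)" and m: "Suc (nat \<lfloor>K\<rfloor>) \<le> k"
  shows "\<exists>C\<ge>0. \<forall>\<phi> M. \<phi> \<in> borel_measurable borel \<longrightarrow>
    wnorm K \<phi> < \<infinity> \<longrightarrow> moment_rec K \<phi> M \<longrightarrow>
    (\<exists>w. w \<in> borel_measurable borel \<and>
      wnorm K w
        \<le> ennreal C * wnorm K \<phi> \<and>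
      wnorm K w < \<infinity> \<and>
      moment_free K w \<and>
      (\<forall>t>0. expansion_error K \<phi> M t = conv (kern t) w))"
proof -
  from corrected_norm_bound[OF K m] obtain C where C: "0 \<le> C"
    "\<forall>\<phi> M. \<phi> \<in> borel_measurable borel \<longrightarrow> wnorm K \<phi> < \<infinity> \<longrightarrow> moment_rec K \<phi> M \<longrightarrow> wnorm K (corrected K \<phi> M) \<le> ennreal C * wnorm K \<phi>"
    by (elim exE conjE)
  show ?thesis
  proof (intro exI[of _ C] conjI C(1) allI impI)
    fix \<phi> :: "real ^ 'n \<Rightarrow> real" and M
    assume \<phi>: "\<phi> \<in> borel_measurable borel" and fin: "wnorm K \<phi> < \<infinity>" and M: "moment_rec K \<phi> M"
    show "\<exists>w. w \<in> borel_measurable borel \<and> wnorm K w \<le> ennreal C * wnorm K \<phi> \<and> wnorm K w < \<infinity> \<and>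
      moment_free K w \<and>
      (\<forall>t>0. expansion_error K \<phi> M t = conv (kern t) w)"
      using mass_dichotomy
    proof
      assume mass: "(LBINT x. F x) = 1"
      have le: "wnorm K (corrected K \<phi> M) \<le> ennreal C * wnorm K \<phi>"
        using C(2)[rule_format, OF \<phi> fin M] .
      show ?thesis
      proof (intro exI[of _ "corrected K \<phi> M"] conjI allI impI)
        show "corrected K \<phi> M \<in> borel_measurable borel" by (rule measurable_corrected[OF m \<phi>])
        show "wnorm K (corrected K \<phi> M) \<le> ennreal C * wnorm K \<phi>" by (rule le)
        show "wnorm K (corrected K \<phi> M) < \<infinity>"
          by (rule order_le_less_trans[OF le]) (use fin in \<open>simp add: ennreal_mult_less_top\<close>)
        show "(LBINT y. mi_power y \<alpha> * corrected K \<phi> M y) = 0" if "real (mi_abs \<alpha>) \<le> K" for \<alpha>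
          by (rule corrected_moment_free[OF K m mass \<phi> fin M that])
        show "expansion_error K \<phi> M t = conv (kern t) (corrected K \<phi> M)" if "0 < t" for t
          by (rule conv_kern_corrected[OF K m \<phi> fin that, symmetric])
      qed
    next
      assume "\<forall>x. F x = 0"
      then have "expansion_error K \<phi> M t = (\<lambda>_. 0)" for t by (intro expansion_error_of_trivial_kernel) simp
      then show ?thesis by (intro exI[of _ "\<lambda>_. 0"]) (auto simp: conv_def[abs_def])
    qed
  qed
qed

end

section \<open>The asymptotic expansion\<close>

lemma Ck_on_slice:
  fixes f :: "'a::euclidean_space \<Rightarrow> real \<Rightarrow> real"
  assumes "Ck_on k (UNIV \<times> {0<..}) (\<lambda>(x, t). f x t)" "t > 0"
  shows "Ck_on k UNIV (\<lambda>x. f x t)"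
  using assms(1)
proof (induction k arbitrary: f)
  case 0
  then have c: "continuous_on (UNIV \<times> {0<..}) (\<lambda>(x, t). f x t)" by simp
  have "continuous_on UNIV (\<lambda>x. (\<lambda>(x, t). f x t) (x, t))"
    by (rule continuous_on_compose2[OF c]) (auto intro!: continuous_intros simp: assms(2))
  then show ?case by simp
next
  case (Suc k)
  have c: "continuous_on (UNIV \<times> {0<..}) (\<lambda>(x, t). f x t)" using Suc.prems by simp
  have "continuous_on UNIV (\<lambda>x. (\<lambda>(x, t). f x t) (x, t))"
    by (rule continuous_on_compose2[OF c]) (auto intro!: continuous_intros simp: assms(2))
  moreover have "(\<forall>x\<in>UNIV. (\<lambda>s. f (x + s *\<^sub>R b) t) differentiable (at 0)) \<and> Ck_on k UNIV (dir_deriv b (\<lambda>x. f x t))"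
    if b: "b \<in> Basis" for b
  proof
    have bB: "(b, 0) \<in> (Basis :: ('a \<times> real) set)" using b by (simp add: Basis_prod_def)
    have eq: "dir_deriv (b, 0) (\<lambda>(x, t). f x t) = (\<lambda>(x, t). dir_deriv b (\<lambda>y. f y t) x)"
      by (auto simp: dir_deriv_def)
    have "Ck_on k (UNIV \<times> {0<..}) (dir_deriv (b, 0) (\<lambda>(x, t). f x t))" using Suc.prems bB by simp
    then show "Ck_on k UNIV (dir_deriv b (\<lambda>x. f x t))"
      unfolding eq by (rule Suc.IH[of "\<lambda>x t. dir_deriv b (\<lambda>y. f y t) x"])
    show "\<forall>x\<in>UNIV. (\<lambda>s. f (x + s *\<^sub>R b) t) differentiable (at 0)"
    proof
      fix x
      have "(\<lambda>s. (\<lambda>(x, t). f x t) ((x, t) + s *\<^sub>R (b, 0))) differentiable (at 0)"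
        using Suc.prems bB assms(2) by (auto simp del: split_conv case_prod_conv plus_prod_def)
      then show "(\<lambda>s. f (x + s *\<^sub>R b) t) differentiable (at 0)" by simp
    qed
  qed
  ultimately show ?case by simp
qed

lemma abs_word_deriv_le_nabla_norm:
  fixes f :: "real ^ 'n::finite \<Rightarrow> real"
  assumes "Ck_on (length is) UNIV f"
  shows "\<bar>word_deriv is f x\<bar> \<le> nabla_norm (length is) f x"
proof -
  have "\<bar>word_deriv is f x\<bar> \<le> L2_set (\<lambda>\<alpha>. \<bar>mi_deriv \<alpha> f x\<bar>) {\<alpha>. mi_abs \<alpha> = length is}"
    unfolding word_deriv_eq_mi_deriv[OF assms]
    by (rule member_le_L2_set[where f = "\<lambda>\<alpha>. \<bar>mi_deriv \<alpha> f x\<bar>", OF finite_mi_abs_eq])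
       (simp add: length_eq_mi_abs_count)
  then show ?thesis by (simp add: nabla_norm_def L2_set_def)
qed

text \<open>
  The bounds on the decay are given for multi-indices. Derivatives commute, so they hold for words, and the rate
  \<open>N + L + j\<close> is at least \<open>N + L\<close>.
\<close>

lemma condition_G_semigroup:
  fixes G :: "real ^ 'n::finite \<Rightarrow> real \<Rightarrow> real"
  assumes "1 \<le> \<gamma>" "d > 0" "L > 0" and G: "condition_G \<gamma> d L G"
  obtains B where "self_similar_semigroup (\<lambda>x. G x 1) \<gamma> B (real CARD('n) + L) d"
    and "\<And>t x. t > 0 \<Longrightarrow> self_similar_semigroup.kern (\<lambda>x. G x 1) d t x = G x t"
proof -
  let ?F = "\<lambda>x. G x 1" and ?p = "real CARD('n) + L"
  have Ck: "Ck_on \<gamma> UNIV ?F" using G by (intro Ck_on_slice) (auto simp: condition_G_def)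
  have "\<exists>b. \<forall>x. weight (?p + real j) x * nabla_norm j ?F x \<le> b" if "j \<le> \<gamma>" for j
    using G that unfolding condition_G_def bdd_above_def by blast
  then have "\<exists>b. \<forall>j\<in>{..\<gamma>}. \<forall>x. weight (?p + real j) x * nabla_norm j ?F x \<le> b j"
    by (intro bchoice) auto
  then obtain b where b: "\<And>j x. j \<le> \<gamma> \<Longrightarrow> weight (?p + real j) x * nabla_norm j ?F x \<le> b j"
    by auto
  define B where "B = (\<Sum>j\<le>\<gamma>. \<bar>b j\<bar>)"
  have decay: "\<bar>word_deriv is ?F x\<bar> \<le> B * weight (- ?p) x" if l: "length is \<le> \<gamma>" for "is" x
  proof -
    let ?j = "length is"
    have "1 \<le> 1 + norm x" by simp
    have "weight ?p x * nabla_norm ?j ?F x \<le> weight (?p + real ?j) x * nabla_norm ?j ?F x"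
      by (intro mult_right_mono powr_mono) (auto simp: nabla_norm_nonneg)
    also have "\<dots> \<le> \<bar>b ?j\<bar>" using b[OF l, of x] by linarith
    also have "\<dots> \<le> B" unfolding B_def using l by (intro member_le_sum) auto
    finally have "weight (- ?p) x * (weight ?p x * nabla_norm ?j ?F x) \<le> weight (- ?p) x * B"
      by (intro mult_left_mono) auto
    moreover have "weight (- ?p) x * (weight ?p x * nabla_norm ?j ?F x) = nabla_norm ?j ?F x"
    proof -
      have "1 + norm x > 0" by (simp add: add_pos_nonneg)
      then show ?thesis by (simp add: mult.assoc[symmetric] powr_add[symmetric])
    qed
    moreover have "\<bar>word_deriv is ?F x\<bar> \<le> nabla_norm ?j ?F x"
      by (rule abs_word_deriv_le_nabla_norm) (rule Ck_on_le[OF Ck l])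
    ultimately have "\<bar>word_deriv is ?F x\<bar> \<le> weight (- ?p) x * B" by linarith
    then show ?thesis by (simp only: mult.commute)
  qed
  interpret decaying_profile ?F \<gamma> B ?p
    by unfold_locales (use Ck decay \<open>L > 0\<close> in auto)
  have scaled_eq: "scaled (t powr (1 / d)) x = G x t" if "t > 0" for t x
  proof -
    have "(t powr (1 / d)) ^ CARD('n) = (t powr (1 / d)) powr (real CARD('n))"
      using that by (subst powr_realpow) auto
    then have "(t powr (1 / d)) ^ CARD('n) = t powr (real CARD('n) / d)" by (simp add: powr_powr)
    moreover have "G x t = t powr (- (real CARD('n) / d)) * G (x /\<^sub>R (t powr (1 / d))) 1"
      using G that unfolding condition_G_def by blast
    ultimately show ?thesis by (simp add: scaled_def powr_minus_divide)
  qed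
  have semi: "scaled (t powr (1 / d)) x = conv (scaled ((t - s) powr (1 / d))) (scaled (s powr (1 / d))) x"
    if "0 < s" "s < t" for x s t
  proof -
    have meas[measurable]: "scaled r \<in> borel_measurable borel" for r by (rule measurable_scaled)
    have "G x t = (\<integral>y. G (x - y) (t - s) * G y s \<partial>lebesgue)"
      using G that unfolding condition_G_def by blast
    also have "\<dots> = (\<integral>y. scaled ((t - s) powr (1 / d)) (x - y) * scaled (s powr (1 / d)) y \<partial>lebesgue)"
      using that by (simp add: scaled_eq)
    also have "\<dots> = conv (scaled ((t - s) powr (1 / d))) (scaled (s powr (1 / d))) x"
      unfolding conv_def by (rule integral_completion) measurable
    finally show ?thesis using that by (simp add: scaled_eq)
  qed
  have S: "self_similar_semigroup ?F \<gamma> B ?p d"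
    by unfold_locales (use assms semi in auto)
  then show thesis
    using that[OF S] scaled_eq by (simp add: self_similar_semigroup.kern_def[OF S])
qed

lemma one_plus_powr_le:
  assumes "0 \<le> K" "0 \<le> (a::real)"
  shows "(1 + a) powr K \<le> 2 powr K * (1 + a powr K)"
proof -
  have "(1 + a) powr K \<le> (2 * max 1 a) powr K" using assms by (intro powr_mono2) auto
  also have "\<dots> = 2 powr K * (max 1 a) powr K" by (simp add: powr_mult)
  also have "(max 1 a) powr K \<le> 1 + a powr K" by (auto simp: max_def)
  finally show ?thesis by simp
qed

theorem theorem1p1:
  fixes G :: "real ^ 'n::finite \<Rightarrow> real \<Rightarrow> real"
    and \<gamma> :: nat and d L K :: real
  assumes "\<gamma> \<ge> 1" and "d > 0" and "L > 0"
    and "condition_G \<gamma> d L G"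
    and "0 \<le> K" and "K < L" and "\<lfloor>K\<rfloor> + 1 \<le> int \<gamma>"
  shows "(\<forall>\<phi> \<in> L1_weighted K. \<forall>t>0. Ck_on \<gamma> UNIV (remainder_v G K \<phi> t)) \<and>
    (\<forall>j\<le>\<gamma>. \<forall>q::ennreal. \<forall>l\<in>{0..K}. 1 \<le> q \<longrightarrow>
      (\<exists>C::real. \<forall>\<phi> \<in> L1_weighted K. \<forall>t>0.
          ennreal (t powr (real CARD('n) / d * (1 - enn2real (1 / q)) + real j / d))
              * Lq_norm q (nabla_norm j (remainder_v G K \<phi> t))
          + ennreal (t powr (real j / d) * (1 + t) powr (- (l / d)))
              * weighted_norm l (nabla_norm j (remainder_v G K \<phi> t))
          \<le> ennreal (C * (1 + t) powr (- (K / d))) * weighted_norm K \<phi>) \<and>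
      (\<forall>\<phi> \<in> L1_weighted K.
        ((\<lambda>t. ennreal (t powr (K / d)) *
            (ennreal (t powr (real CARD('n) / d * (1 - enn2real (1 / q)) + real j / d))
               * Lq_norm q (nabla_norm j (remainder_v G K \<phi> t))
             + ennreal (t powr (- (l / d) + real j / d))
               * weighted_norm l (nabla_norm j (remainder_v G K \<phi> t))))
          \<longlongrightarrow> 0) at_top))"
proof -
  obtain B where S: "self_similar_semigroup (\<lambda>x. G x 1) \<gamma> B (real CARD('n) + L) d"
    and kern_G: "\<And>t x. t > 0 \<Longrightarrow> self_similar_semigroup.kern (\<lambda>x. G x 1) d t x = G x t"
    using condition_G_semigroup[OF assms(1-4)] by blast
  interpret self_similar_semigroup "\<lambda>x. G x 1" \<gamma> B "real CARD('n) + L" d by (rule S)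
  have kern_eq: "kern t = (\<lambda>x. G x t)" if "t > 0" for t using kern_G[OF that] by auto
  have K: "0 \<le> K" "K < real CARD('n) + L - real CARD('n)" using assms by auto
  have m: "Suc (nat \<lfloor>K\<rfloor>) \<le> \<gamma>" using assms(5,7) by (simp add: nat_le_iff Suc_le_eq) linarith
  \<comment> \<open>Everything depends on the class of the datum modulo null sets only, which has a Borel representative.\<close>
  have repr: "\<exists>\<psi>. \<psi> \<in> borel_measurable borel \<and> wnorm K \<psi> \<le> ennreal (2 powr K) * weighted_norm K \<phi> \<and> wnorm K \<psi> < \<infinity> \<and>
      moment_rec K \<psi> (moment G \<phi> 0) \<and> (\<forall>t>0. remainder_v G K \<phi> t = expansion_error K \<psi> (moment G \<phi> 0) t)"
    if \<phi>: "\<phi> \<in> L1_weighted K" for \<phi>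
  proof -
    have \<phi>_meas: "\<phi> \<in> borel_measurable lebesgue" and \<phi>_fin: "weighted_norm K \<phi> < \<infinity>"
      using \<phi> by (auto simp: L1_weighted_def)
    from completion_ex_borel_measurable_real[OF \<phi>_meas] obtain \<psi>
      where \<psi>': "\<psi> \<in> borel_measurable lborel" and ae: "AE x in lborel. \<phi> x = \<psi> x" by blast
    have \<psi>[measurable]: "\<psi> \<in> borel_measurable borel" using \<psi>' by simp
    have ae': "AE x in lebesgue. \<phi> x = \<psi> x" using ae by (rule AE_completion)
    have int_eq: "(\<integral>x. h x * \<phi> x \<partial>lebesgue) = (LBINT x. h x * \<psi> x)" if h: "h \<in> borel_measurable borel" for h
    proof -
      have hl: "h \<in> borel_measurable lebesgue" using h by (intro measurable_completion) simp
      have \<psi>l: "\<psi> \<in> borel_measurable lebesgue" using \<psi>' by (rule measurable_completion)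
      have "(\<integral>x. h x * \<phi> x \<partial>lebesgue) = (\<integral>x. h x * \<psi> x \<partial>lebesgue)"
        by (rule integral_cong_AE) (use hl \<phi>_meas \<psi>l ae' in auto)
      also have "\<dots> = (LBINT x. h x * \<psi> x)"
        by (rule integral_completion) (use h \<psi>' in auto)
      finally show ?thesis .
    qed
    have "wnorm K \<psi> \<le> (\<integral>\<^sup>+y. ennreal (2 powr K) * ennreal (\<bar>\<psi> y\<bar> * (1 + norm y powr K)) \<partial>lborel)"
    proof (rule nn_integral_mono)
      fix y :: "real ^ 'n"
      have "\<bar>\<psi> y\<bar> * weight K y \<le> \<bar>\<psi> y\<bar> * (2 powr K * (1 + norm y powr K))"
        by (intro mult_left_mono one_plus_powr_le K(1)) auto
      then have "ennreal (\<bar>\<psi> y\<bar> * weight K y) \<le> ennreal (2 powr K * (\<bar>\<psi> y\<bar> * (1 + norm y powr K)))"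
        by (intro ennreal_leI) (simp add: mult.left_commute)
      also have "\<dots> = ennreal (2 powr K) * ennreal (\<bar>\<psi> y\<bar> * (1 + norm y powr K))"
        by (rule ennreal_mult) auto
      finally show "ennreal (\<bar>\<psi> y\<bar> * weight K y) \<le> ennreal (2 powr K) * ennreal (\<bar>\<psi> y\<bar> * (1 + norm y powr K))" .
    qed
    also have "\<dots> = ennreal (2 powr K) * (\<integral>\<^sup>+y. ennreal (\<bar>\<psi> y\<bar> * (1 + norm y powr K)) \<partial>lborel)"
      by (rule nn_integral_cmult) measurable
    also have "(\<integral>\<^sup>+y. ennreal (\<bar>\<psi> y\<bar> * (1 + norm y powr K)) \<partial>lborel) = (\<integral>\<^sup>+y. ennreal (\<bar>\<phi> y\<bar> * (1 + norm y powr K)) \<partial>lborel)"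
      by (rule nn_integral_cong_AE) (use ae in eventually_elim, simp)
    also have "\<dots> = weighted_norm K \<phi>"
      by (simp add: weighted_norm_def nn_integral_completion)
    finally have N\<psi>: "wnorm K \<psi> \<le> ennreal (2 powr K) * weighted_norm K \<phi>" .
    then have fin: "wnorm K \<psi> < \<infinity>"
      by (rule order_le_less_trans) (use \<phi>_fin in \<open>simp add: ennreal_mult_less_top\<close>)
    have profile_term_eq: "g_fun G \<beta> x 0 = profile_term \<beta> x" for \<beta> x
      by (simp add: g_fun_def profile_term_def mi_deriv_eq_word_deriv)
    have rec: "moment_rec K \<psi> (moment G \<phi> 0)"
      unfolding moment_rec_def
    proof (intro allI impI)
      fix \<alpha> :: "'n \<Rightarrow> nat" assume \<alpha>: "real (mi_abs \<alpha>) \<le> K"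
      have int_g: "(\<integral>x. mi_power x \<alpha> * g_fun G \<beta> x 0 \<partial>lebesgue) = (LBINT x. mi_power x \<alpha> * profile_term \<beta> x)"
        if "\<beta> \<le> \<alpha>" for \<beta>
      proof -
        have "real (mi_abs \<beta>) \<le> K" using mi_abs_mono[OF that] \<alpha> by linarith
        from measurable_profile_term[OF order_bounded[OF this m]] show ?thesis
          unfolding profile_term_eq by (intro integral_completion) measurable
      qed
      show "moment G \<phi> 0 \<alpha> = (LBINT x. mi_power x \<alpha> * \<psi> x)
         - (\<Sum>\<beta> | \<beta> \<le> \<alpha> \<and> \<beta> \<noteq> \<alpha>. moment G \<phi> 0 \<beta> * (LBINT x. mi_power x \<alpha> * profile_term \<beta> x))"
      proof (cases "\<alpha> = (\<lambda>_. 0)")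
        case True
        have none: "{\<beta>. \<beta> \<le> \<alpha> \<and> \<beta> \<noteq> \<alpha>} = {}" unfolding True by (auto simp: le_fun_def fun_eq_iff)
        have one: "mi_power x \<alpha> = 1" for x by (simp add: mi_power_def True)
        have "moment G \<phi> 0 \<alpha> = (\<integral>x. \<phi> x \<partial>lebesgue)" by (subst moment.simps) (simp add: True)
        then show ?thesis unfolding none one using int_eq[of "\<lambda>_. 1"] by simp
      next
        case False
        have "(\<Sum>\<beta> | \<beta> \<le> \<alpha> \<and> \<beta> \<noteq> \<alpha>. moment G \<phi> 0 \<beta> * (\<integral>x. mi_power x \<alpha> * g_fun G \<beta> x 0 \<partial>lebesgue))
           = (\<Sum>\<beta> | \<beta> \<le> \<alpha> \<and> \<beta> \<noteq> \<alpha>. moment G \<phi> 0 \<beta> * (LBINT x. mi_power x \<alpha> * profile_term \<beta> x))"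
          by (intro sum.cong refl) (simp add: int_g)
        then show ?thesis
          using False int_eq[OF measurable_mi_power] by (subst moment.simps) simp
      qed
    qed
    have "remainder_v G K \<phi> t = expansion_error K \<psi> (moment G \<phi> 0) t" if t: "t > 0" for t
    proof
      fix x
      have meas: "(\<lambda>y. kern t (x - y)) \<in> borel_measurable borel"
        unfolding kern_def by (rule measurable_compose[OF _ measurable_scaled]) simp
      have "evol G t \<phi> x = (\<integral>y. kern t (x - y) * \<phi> y \<partial>lebesgue)"
        using t by (simp add: evol_def kern_eq[OF t])
      also have "\<dots> = conv (kern t) \<psi> x" unfolding conv_def by (rule int_eq[OF meas])
      finally have "evol G t \<phi> x = conv (kern t) \<psi> x" .
      moreover have "g_fun G \<beta> x t = (- 1) ^ mi_abs \<beta> / mi_fact \<beta> * word_deriv (mi_word \<beta>) (kern (t + 1)) x" for \<beta>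
        using t by (simp add: g_fun_def mi_deriv_eq_word_deriv kern_eq)
      ultimately show "remainder_v G K \<phi> t x = expansion_error K \<psi> (moment G \<phi> 0) t x"
        by (simp add: remainder_v_def expansion_error_def)
    qed
    with \<psi> N\<psi> fin rec show ?thesis by blast
  qed
  obtain C2 where C2: "0 \<le> C2" "\<forall>\<phi> M. \<phi> \<in> borel_measurable borel \<longrightarrow> wnorm K \<phi> < \<infinity> \<longrightarrow> moment_rec K \<phi> M \<longrightarrow>
    (\<exists>w. w \<in> borel_measurable borel \<and> wnorm K w \<le> ennreal C2 * wnorm K \<phi> \<and> wnorm K w < \<infinity> \<and>
      moment_free K w \<and>
      (\<forall>t>0. expansion_error K \<phi> M t = conv (kern t) w))"
    using expansion_error_eq_conv[OF K m] by (elim exE conjE)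
  have repr2: "\<exists>w. w \<in> borel_measurable borel \<and> wnorm K w \<le> ennreal (C2 * 2 powr K) * weighted_norm K \<phi> \<and> wnorm K w < \<infinity> \<and>
      moment_free K w \<and>
      (\<forall>t>0. remainder_v G K \<phi> t = conv (kern t) w)"
    if \<phi>: "\<phi> \<in> L1_weighted K" for \<phi>
  proof -
    from repr[OF \<phi>] obtain \<psi> where \<psi>: "\<psi> \<in> borel_measurable borel" and N\<psi>: "wnorm K \<psi> \<le> ennreal (2 powr K) * weighted_norm K \<phi>"
      and fin: "wnorm K \<psi> < \<infinity>" and rec: "moment_rec K \<psi> (moment G \<phi> 0)"
      and v: "\<forall>t>0. remainder_v G K \<phi> t = expansion_error K \<psi> (moment G \<phi> 0) t" by (elim exE conjE)
    from C2(2)[THEN spec, THEN spec, THEN mp, THEN mp, THEN mp, OF \<psi> fin rec] obtain w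
      where w: "w \<in> borel_measurable borel" "wnorm K w \<le> ennreal C2 * wnorm K \<psi>" "wnorm K w < \<infinity>"
        "moment_free K w"
        "\<forall>t>0. expansion_error K \<psi> (moment G \<phi> 0) t = conv (kern t) w" by (elim exE conjE)
    have "wnorm K w \<le> ennreal C2 * (ennreal (2 powr K) * weighted_norm K \<phi>)"
      using w(2) by (rule order_trans) (intro mult_left_mono N\<psi>, simp)
    also have "\<dots> = ennreal (C2 * 2 powr K) * weighted_norm K \<phi>"
      using C2(1) by (simp add: ennreal_mult mult.assoc)
    finally have "wnorm K w \<le> ennreal (C2 * 2 powr K) * weighted_norm K \<phi>" .
    then show ?thesis using w v by (intro exI[of _ w]) simp
  qed
  show ?thesis
  proof (intro conjI ballI allI impI, goal_cases)
    case (1 \<phi> t)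
    from repr2[OF 1(1)] obtain w where w: "w \<in> borel_measurable borel" "wnorm K w < \<infinity>"
      and v: "\<forall>t>0. remainder_v G K \<phi> t = conv (kern t) w" by (elim exE conjE)
    have "Ck_on \<gamma> UNIV (conv (kern t) w)"
      unfolding kern_def
      by (rule Ck_on_conv_scaled) (use 1 integrable_of_weighted_0[OF w(1) K(1) w(2)] in auto)
    then show ?case using v 1 by simp
  next
    case (2 j q l)
    then have l: "0 \<le> l" "l \<le> K" by auto
    from moment_free_estimate[OF l K(2) m 2(1,3)] obtain C where C: "0 \<le> C"
      and est: "\<forall>w. w \<in> borel_measurable borel \<longrightarrow> wnorm K w < \<infinity> \<longrightarrow> moment_free K w \<longrightarrow>
       (\<forall>t>0. total_norm t ((1 + t) powr (1 / d)) l j q (conv (kern t) w) \<le> ennreal (C * (1 + t) powr (- (K / d))) * wnorm K w) \<and>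
       ((\<lambda>t. ennreal (t powr (K / d)) * total_norm t (t powr (1 / d)) l j q (conv (kern t) w)) \<longlongrightarrow> 0) at_top"
      by (elim exE conjE)
    show ?case
    proof (intro exI[of _ "C * (C2 * 2 powr K)"] ballI allI impI, goal_cases)
      case (1 \<phi> t)
      from repr2[OF 1(1)] obtain w where w: "w \<in> borel_measurable borel"
        "wnorm K w \<le> ennreal (C2 * 2 powr K) * weighted_norm K \<phi>" "wnorm K w < \<infinity>" "moment_free K w"
        and v: "\<forall>t>0. remainder_v G K \<phi> t = conv (kern t) w" by (elim exE conjE)
      from est[THEN spec, THEN mp, THEN mp, THEN mp, OF w(1,3,4), THEN conjunct1] 1(2)
      have "total_norm t ((1 + t) powr (1 / d)) l j q (conv (kern t) w) \<le> ennreal (C * (1 + t) powr (- (K / d))) * wnorm K w" by blast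
      also have "\<dots> \<le> ennreal (C * (1 + t) powr (- (K / d))) * (ennreal (C2 * 2 powr K) * weighted_norm K \<phi>)"
        by (intro mult_left_mono w(2)) simp
      also have "\<dots> = ennreal (C * (1 + t) powr (- (K / d)) * (C2 * 2 powr K)) * weighted_norm K \<phi>"
        using C C2(1) by (simp add: mult.assoc[symmetric] flip: ennreal_mult)
      also have "C * (1 + t) powr (- (K / d)) * (C2 * 2 powr K) = C * (C2 * 2 powr K) * (1 + t) powr (- (K / d))" by simp
      finally show ?case
        using v 1(2) by (simp add: total_norm_def powr_powr)
    qed
  next
    case (3 j q l \<phi>)
    then have l: "0 \<le> l" "l \<le> K" by auto
    from repr2[OF 3(4)] obtain w where w: "w \<in> borel_measurable borel" "wnorm K w < \<infinity>" "moment_free K w"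
      and v: "\<forall>t>0. remainder_v G K \<phi> t = conv (kern t) w" by (elim exE conjE)
    have "((\<lambda>t. ennreal (t powr (K / d)) * total_norm t (t powr (1 / d)) l j q (conv (kern t) w)) \<longlongrightarrow> 0) at_top"
      using moment_free_estimate[OF l K(2) m 3(1,3)] w by (elim exE conjE) simp
    then show ?case
    proof (rule Lim_transform_eventually)
      have exponent: "t powr (real j / d) * (t powr (1 / d)) powr (- l) = t powr (- (l / d) + real j / d)" for t
        unfolding powr_powr powr_add[symmetric] by (rule arg_cong[where f = "\<lambda>z. t powr z"]) simp
      show "eventually (\<lambda>t. ennreal (t powr (K / d)) * total_norm t (t powr (1 / d)) l j q (conv (kern t) w)
        = ennreal (t powr (K / d)) *
            (ennreal (t powr (real CARD('n) / d * (1 - enn2real (1 / q)) + real j / d))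
               * Lq_norm q (nabla_norm j (remainder_v G K \<phi> t))
             + ennreal (t powr (- (l / d) + real j / d))
               * weighted_norm l (nabla_norm j (remainder_v G K \<phi> t)))) at_top"
        using eventually_gt_at_top[of 0] by eventually_elim (use v in \<open>simp add: total_norm_def exponent\<close>)
    qed
  qed
qed

end
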